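(* Consider a sharp theory with purification. Let $\rho$ and $\sigma$ be normalised states of the same system, and let $\mathbf p$ and $\mathbf q$ be their respective spectra. Then $\rho$ can be converted into $\sigma$ by a unital channel (i.e. $\sigma=\mathcal D\rho$ for some unital channel $\mathcal D$) if and only if $\mathbf p\succeq\mathbf q$, i.e. $\mathbf p$ majorises $\mathbf q$.
   Context: Framework. A causal operational probabilistic theory (OPT) has systems $A,B,\dots$ (including a trivial system $I$), with associative composites $AB$ ($AI=IA=A$; $AB$ and $BA$ related by a reversible swap), and tests. A test from $A$ to $B$ is a finite family $\{\mathcal C_i\}_{i\in X}$ of transformations from $A$ to $B$. Tests are closed under sequential composition, parallel composition $\otimes$ and coarse-graining (summing transformations over the blocks of a partition of $X$); identities $\mathcal I_A$ and swaps are one-outcome tests; systems and transformations form a strict symmetric monoidal category. Tests on $I$ are probability distributions, numbers compose by multiplication, and all probabilities in $[0,1]$ are available. A state of $A$ is a transformation $I\to A$, an effect is a transformation $A\to I$, $(a|\rho)\in[0,1]$ is their composition; tests $A\to I$ are observation-tests. States (effects) are equal iff they have the same pairing with all effects (states); transformations $\mathcal C,\mathcal C'$ from $A$ to $B$ are equal iff $(\mathcal C\otimes\mathcal I_S)\rho=(\mathcal C'\otimes\mathcal I_S)\rho$ for every system $S$ and state $\rho$ of $AS$. The spanned real vector spaces are finite-dimensional; the sets of states, effects and transformations are closed (hence compact). Every test $\{\mathcal A_i\}$ from $A$ to $B$ has the form $\mathcal A_i=(\mathcal I_B\otimes e_i)\mathcal A$ with $\mathcal A$ a deterministic transformation from $A$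 to some $BX$ and $\{e_i\}$ an observation-test on $X$. A channel is a deterministic (one-outcome-test) transformation; it is reversible if it has an inverse channel. A transformation $\mathcal T$ is pure if whenever $\mathcal T=\sum_{i\in X_0}\mathcal D_i$ with $X_0\subseteq X$ and $\{\mathcal D_i\}_{i\in X}$ a test, every $\mathcal D_i$, $i\in X_0$, is a multiple of $\mathcal T$. Causality: every system has a unique deterministic effect $u_A$; the marginal on $A$ of a state of $AB$ is obtained by applying $u_B$. A state is normalised if $(u|\rho)=1$; an effect is normalised if $\sup_\rho(a|\rho)=1$ over states. Tests may be chosen conditionally on earlier outcomes and randomised, so normalised states form a convex set; every nonzero state is a multiple of a normalised one. A sharp theory with purification is a causal OPT satisfying: Purity Preservation (sequential and parallel compositions of pure transformations are pure); Pure Sharpness (for every system there is a pure effect $a$ and a state $\rho$ with $(a|\rho)=1$); Purification (every normalised state $\rho$ of $A$ is the marginal of a normalised pure state of some composite $AB$, and if two normalised pure states $\Psi,\Psi'$ of $AB$ have the same marginal on $A$ then $\Psi'=(\mathcal I_A\otimes\mathcal U)\Psi$ for a reversible channel $\mathcal U$ on $B$). Normalised states $\{\rho_i\}$ are perfectly distinguishable if there is an observation-test $\{a_i\}$ with $(a_i|\rho_j)=\delta_{ij}$. A pure maximal set is a set of perfectly distinguishable normalised pure states to which no state can be added keeping perfect distinguishability. Facts fixing notation in sharp theories with purification: every normalised pure state $\alpha$ has a unique normalised pure effect $\alpha^\dagger$ with $(\alpha^\dagger|\alpha)=1$, and this is a bijection; all pure maximal sets of a system have the same cardinality $d$ (its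 dimension); every normalised state can be written $\rho=\sum_{i=1}^dp_i\alpha_i$ with $\{\alpha_i\}_{i=1}^d$ a pure maximal set and $\{p_i\}$ a probability distribution (a diagonalisation), and the vector $\mathbf p\in\mathbb R^d$ (the spectrum) is unique up to reordering; there is a unique normalised state $\chi$ invariant under all reversible channels (the microcanonical state), and $\chi=\frac1d\sum_{i=1}^d\alpha_i$ for any pure maximal set. A channel $\mathcal D$ from $A$ to $A'$ is unital if $\mathcal D\chi_A=\chi_{A'}$. For $\mathbf x,\mathbf y\in\mathbb R^d$, $\mathbf x\succeq\mathbf y$ means that, with entries rearranged in decreasing order, $\sum_{i=1}^kx_i\ge\sum_{i=1}^ky_i$ for $k=1,\dots,d-1$ and $\sum_{i=1}^dx_i=\sum_{i=1}^dy_i$. *)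

theory Defs
  imports "HOL-Analysis.Function_Topology" "HOL-Library.Nat_Bijection"
begin

section \<open>Operational probabilistic theories\<close>

text \<open>
  Every element of the type \<open>'s\<close> is a system. The type \<open>'t\<close> is an untyped universe of
  transformations: which of its elements are transformations from \<open>A\<close> to \<open>B\<close> is fixed by the tests
  (\<open>transf\<close> below), and all axioms are relativised to such elements. \<open>test \<Theta> A B X C\<close> says that the
  family \<open>C i\<close>, \<open>i \<in> X\<close>, is a test from \<open>A\<close> to \<open>B\<close>; outcomes are labelled by natural
  numbers. \<open>G \<odot> F\<close> is \<open>F\<close> followed by \<open>G\<close>, and \<open>prob\<close> turns transformations of the trivial
  system into numbers.
\<close>

record ('s, 't) opt =
  triv :: 's ("\<I>\<index>")
  sys_comp :: "'s \<Rightarrow> 's \<Rightarrow> 's" (infixr "\<boxtimes>\<index>" 75)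
  ident :: "'s \<Rightarrow> 't" ("\<one>\<index>")
  swap :: "'s \<Rightarrow> 's \<Rightarrow> 't" ("\<gamma>\<index>")
  seq :: "'t \<Rightarrow> 't \<Rightarrow> 't" (infixr "\<odot>\<index>" 70)
  par :: "'t \<Rightarrow> 't \<Rightarrow> 't" (infixr "\<otimes>\<index>" 75)
  prob :: "'t \<Rightarrow> real"
  test :: "'s \<Rightarrow> 's \<Rightarrow> nat set \<Rightarrow> (nat \<Rightarrow> 't) \<Rightarrow> bool"

definition transf :: "('s, 't) opt \<Rightarrow> 's \<Rightarrow> 's \<Rightarrow> 't set" where
  "transf \<Theta> A B = {C i | X C i. test \<Theta> A B X C \<and> i \<in> X}"

definition states :: "('s, 't) opt \<Rightarrow> 's \<Rightarrow> 't set" where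
  "states \<Theta> A = transf \<Theta> (triv \<Theta>) A"

definition effects :: "('s, 't) opt \<Rightarrow> 's \<Rightarrow> 't set" where
  "effects \<Theta> A = transf \<Theta> A (triv \<Theta>)"

text \<open>The pairing \<open>(a|\<rho>)\<close>.\<close>

definition pairing :: "('s, 't) opt \<Rightarrow> 't \<Rightarrow> 't \<Rightarrow> real" where
  "pairing \<Theta> a \<rho> = prob \<Theta> (seq \<Theta> a \<rho>)"

definition channel :: "('s, 't) opt \<Rightarrow> 's \<Rightarrow> 's \<Rightarrow> 't \<Rightarrow> bool" where
  "channel \<Theta> A B C \<longleftrightarrow> test \<Theta> A B {0} (\<lambda>_. C)"

definition reversible :: "('s, 't) opt \<Rightarrow> 's \<Rightarrow> 's \<Rightarrow> 't \<Rightarrow> bool" where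
  "reversible \<Theta> A B U \<longleftrightarrow> channel \<Theta> A B U \<and>
     (\<exists>V. channel \<Theta> B A V \<and> seq \<Theta> V U = ident \<Theta> A \<and> seq \<Theta> U V = ident \<Theta> B)"

subsection \<open>Linear combinations of transformations\<close>

text \<open>
  A transformation is determined by the probabilities it gives when applied locally to states of
  composite systems. The real vector space spanned by the transformations from \<open>A\<close> to \<open>B\<close> is the
  space spanned by these functions; sums (in particular coarse-grainings), multiples and mixtures
  of transformations are taken in it.
\<close>

definition stats :: "('s, 't) opt \<Rightarrow> 's \<Rightarrow> 's \<Rightarrow> 't \<Rightarrow> ('s \<times> 't \<times> 't \<Rightarrow> real)" where
  "stats \<Theta> A B C = (\<lambda>(S, \<rho>, e).
     if \<rho> \<in> states \<Theta> (sys_comp \<Theta> A S) \<and> e \<in> effects \<Theta> (sys_comp \<Theta> B S)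
     then pairing \<Theta> e (seq \<Theta> (par \<Theta> C (ident \<Theta> S)) \<rho>) else 0)"

text \<open>\<open>C = (\<Sum>i\<in>X. c i *\<^sub>R D i)\<close> for transformations from \<open>A\<close> to \<open>B\<close>.\<close>

definition lin_comb ::
    "('s, 't) opt \<Rightarrow> 's \<Rightarrow> 's \<Rightarrow> 't \<Rightarrow> 'i set \<Rightarrow> ('i \<Rightarrow> real) \<Rightarrow> ('i \<Rightarrow> 't) \<Rightarrow> bool" where
  "lin_comb \<Theta> A B C X c D \<longleftrightarrow>
     C \<in> transf \<Theta> A B \<and> finite X \<and> D ` X \<subseteq> transf \<Theta> A B \<and>
     (\<forall>z. stats \<Theta> A B C z = (\<Sum>i\<in>X. c i * stats \<Theta> A B (D i) z))"

definition is_sum :: "('s, 't) opt \<Rightarrow> 's \<Rightarrow> 's \<Rightarrow> 't \<Rightarrow> 'i set \<Rightarrow> ('i \<Rightarrow> 't) \<Rightarrow> bool" where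
  "is_sum \<Theta> A B C X D \<longleftrightarrow> lin_comb \<Theta> A B C X (\<lambda>_. 1) D"

definition is_multiple :: "('s, 't) opt \<Rightarrow> 's \<Rightarrow> 's \<Rightarrow> 't \<Rightarrow> 't \<Rightarrow> bool" where
  "is_multiple \<Theta> A B D C \<longleftrightarrow> (\<exists>r. lin_comb \<Theta> A B D {()} (\<lambda>_. r) (\<lambda>_. C))"

definition pure :: "('s, 't) opt \<Rightarrow> 's \<Rightarrow> 's \<Rightarrow> 't \<Rightarrow> bool" where
  "pure \<Theta> A B C \<longleftrightarrow> C \<in> transf \<Theta> A B \<and>
     (\<forall>X D. \<forall>X\<^sub>0 \<subseteq> X. test \<Theta> A B X D \<and> is_sum \<Theta> A B C X\<^sub>0 D \<longrightarrow>
        (\<forall>i\<in>X\<^sub>0. is_multiple \<Theta> A B (D i) C))"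

text \<open>Causality makes the following description proper.\<close>

definition discard :: "('s, 't) opt \<Rightarrow> 's \<Rightarrow> 't" where
  "discard \<Theta> A = (THE u. channel \<Theta> A (triv \<Theta>) u)"

definition normalised_states :: "('s, 't) opt \<Rightarrow> 's \<Rightarrow> 't set" where
  "normalised_states \<Theta> A = {\<rho> \<in> states \<Theta> A. pairing \<Theta> (discard \<Theta> A) \<rho> = 1}"

definition pure_states :: "('s, 't) opt \<Rightarrow> 's \<Rightarrow> 't set" where
  "pure_states \<Theta> A = {\<rho> \<in> normalised_states \<Theta> A. pure \<Theta> (triv \<Theta>) A \<rho>}"

text \<open>The marginal on \<open>A\<close> of a state of \<open>AB\<close>.\<close>

definition marginal :: "('s, 't) opt \<Rightarrow> 's \<Rightarrow> 's \<Rightarrow> 't \<Rightarrow> 't" where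
  "marginal \<Theta> A B \<Psi> = seq \<Theta> (par \<Theta> (ident \<Theta> A) (discard \<Theta> B)) \<Psi>"

subsection \<open>Axioms\<close>

locale opt_theory =
  fixes \<Theta> :: "('s, 't) opt" (structure)
  \<comment> \<open>systems and transformations form a strict symmetric monoidal category\<close>
  assumes sys_assoc: "(A \<boxtimes> B) \<boxtimes> C = A \<boxtimes> (B \<boxtimes> C)"
    and sys_unit: "A \<boxtimes> \<I> = A" "\<I> \<boxtimes> A = A"
    and ident_channel: "channel \<Theta> A A (\<one> A)"
    and seq_ident: "F \<in> transf \<Theta> A B \<Longrightarrow> F \<odot> \<one> A = F" "F \<in> transf \<Theta> A B \<Longrightarrow> \<one> B \<odot> F = F"
    and seq_assoc: "\<lbrakk>F \<in> transf \<Theta> A B; G \<in> transf \<Theta> B C; H \<in> transf \<Theta> C D\<rbrakk>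
      \<Longrightarrow> (H \<odot> G) \<odot> F = H \<odot> (G \<odot> F)"
    and par_ident: "\<one> A \<otimes> \<one> B = \<one> (A \<boxtimes> B)"
    and par_unit: "F \<in> transf \<Theta> A B \<Longrightarrow> F \<otimes> \<one> \<I> = F" "F \<in> transf \<Theta> A B \<Longrightarrow> \<one> \<I> \<otimes> F = F"
    and par_assoc: "\<lbrakk>F \<in> transf \<Theta> A A'; G \<in> transf \<Theta> B B'; H \<in> transf \<Theta> C C'\<rbrakk>
      \<Longrightarrow> (F \<otimes> G) \<otimes> H = F \<otimes> (G \<otimes> H)"
    and interchange: "\<lbrakk>F \<in> transf \<Theta> A B; G \<in> transf \<Theta> B C; F' \<in> transf \<Theta> A' B'; G' \<in> transf \<Theta> B' C'\<rbrakk>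
      \<Longrightarrow> (G \<odot> F) \<otimes> (G' \<odot> F') = (G \<otimes> G') \<odot> (F \<otimes> F')"
    and swap_channel: "channel \<Theta> (A \<boxtimes> B) (B \<boxtimes> A) (\<gamma> A B)"
    and swap_inverse: "\<gamma> B A \<odot> \<gamma> A B = \<one> (A \<boxtimes> B)"
    and swap_natural: "\<lbrakk>F \<in> transf \<Theta> A A'; G \<in> transf \<Theta> B B'\<rbrakk>
      \<Longrightarrow> \<gamma> A' B' \<odot> (F \<otimes> G) = (G \<otimes> F) \<odot> \<gamma> A B"
    and swap_hexagon: "\<gamma> A (B \<boxtimes> C) = (\<one> B \<otimes> \<gamma> A C) \<odot> (\<gamma> A B \<otimes> \<one> C)"
  \<comment> \<open>tests: sequential composition includes conditioning on earlier outcomes\<close>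
    and test_finite: "test \<Theta> A B X T \<Longrightarrow> finite X"
    and test_cong: "\<lbrakk>test \<Theta> A B X T; \<And>i. i \<in> X \<Longrightarrow> T' i = T i\<rbrakk> \<Longrightarrow> test \<Theta> A B X T'"
    and test_seq: "\<lbrakk>test \<Theta> A B X T; \<And>i. i \<in> X \<Longrightarrow> test \<Theta> B C (Z i) (R i)\<rbrakk>
      \<Longrightarrow> test \<Theta> A C (prod_encode ` (SIGMA i:X. Z i)) (\<lambda>n. case prod_decode n of (i, j) \<Rightarrow> R i j \<odot> T i)"
    and test_par: "\<lbrakk>test \<Theta> A B X T; test \<Theta> A' B' Y T'\<rbrakk>
      \<Longrightarrow> test \<Theta> (A \<boxtimes> A') (B \<boxtimes> B') (prod_encode ` (X \<times> Y)) (\<lambda>n. case prod_decode n of (i, j) \<Rightarrow> T i \<otimes> T' j)"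
    \<comment> \<open>the blocks of the partition are the fibres of \<open>f\<close>; injective \<open>f\<close> give relabellings\<close>
    and coarse_grain: "test \<Theta> A B X T
      \<Longrightarrow> \<exists>D. test \<Theta> A B (f ` X) D \<and> (\<forall>j\<in>f ` X. is_sum \<Theta> A B (D j) {i \<in> X. f i = j} T)"
  \<comment> \<open>numbers and probabilities\<close>
    and prob_bij: "bij_betw (prob \<Theta>) (transf \<Theta> \<I> \<I>) {0..1}"
    and prob_seq: "\<lbrakk>F \<in> transf \<Theta> \<I> \<I>; G \<in> transf \<Theta> \<I> \<I>\<rbrakk> \<Longrightarrow> prob \<Theta> (F \<odot> G) = prob \<Theta> F * prob \<Theta> G"
    and test_triv: "\<lbrakk>finite X; \<And>i. i \<in> X \<Longrightarrow> T i \<in> transf \<Theta> \<I> \<I>\<rbrakk>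
      \<Longrightarrow> test \<Theta> \<I> \<I> X T \<longleftrightarrow> (\<Sum>i\<in>X. prob \<Theta> (T i)) = 1"
  \<comment> \<open>operational equality\<close>
    and state_eqI: "\<lbrakk>\<rho> \<in> states \<Theta> A; \<rho>' \<in> states \<Theta> A;
        \<And>a. a \<in> effects \<Theta> A \<Longrightarrow> pairing \<Theta> a \<rho> = pairing \<Theta> a \<rho>'\<rbrakk> \<Longrightarrow> \<rho> = \<rho>'"
    and effect_eqI: "\<lbrakk>a \<in> effects \<Theta> A; a' \<in> effects \<Theta> A;
        \<And>\<rho>. \<rho> \<in> states \<Theta> A \<Longrightarrow> pairing \<Theta> a \<rho> = pairing \<Theta> a' \<rho>\<rbrakk> \<Longrightarrow> a = a'"
    and transf_eqI: "\<lbrakk>F \<in> transf \<Theta> A B; F' \<in> transf \<Theta> A B;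
        \<And>S \<rho>. \<rho> \<in> states \<Theta> (A \<boxtimes> S) \<Longrightarrow> (F \<otimes> \<one> S) \<odot> \<rho> = (F' \<otimes> \<one> S) \<odot> \<rho>\<rbrakk> \<Longrightarrow> F = F'"
  \<comment> \<open>finite dimension and closedness; the topology is that of pointwise convergence, which on a
    finite-dimensional space of functions is the only Hausdorff vector space topology\<close>
    and finite_dim: "\<exists>F \<subseteq> transf \<Theta> A B. finite F \<and>
        (\<forall>C \<in> transf \<Theta> A B. \<exists>c. lin_comb \<Theta> A B C F c (\<lambda>D. D))"
    and transf_closed: "closed (stats \<Theta> A B ` transf \<Theta> A B)"
  \<comment> \<open>every test is a channel followed by an observation-test on an ancillary system\<close>
    and test_dilation: "test \<Theta> A B X T \<Longrightarrow> \<exists>S D e. channel \<Theta> A (B \<boxtimes> S) D \<and> test \<Theta> S \<I> X e \<and>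
        (\<forall>i\<in>X. T i = (\<one> B \<otimes> e i) \<odot> D)"

locale causal_opt = opt_theory +
  assumes causality: "\<exists>!u. channel \<Theta> A \<I> u"
    and normalisable: "\<lbrakk>\<rho> \<in> states \<Theta> A; \<exists>a \<in> effects \<Theta> A. pairing \<Theta> a \<rho> \<noteq> 0\<rbrakk>
      \<Longrightarrow> \<exists>\<rho>' \<in> normalised_states \<Theta> A. is_multiple \<Theta> \<I> A \<rho> \<rho>'"

locale sharp_theory_with_purification = causal_opt +
  assumes purity_seq: "\<lbrakk>pure \<Theta> A B F; pure \<Theta> B C G\<rbrakk> \<Longrightarrow> pure \<Theta> A C (G \<odot> F)"
    and purity_par: "\<lbrakk>pure \<Theta> A B F; pure \<Theta> A' B' G\<rbrakk> \<Longrightarrow> pure \<Theta> (A \<boxtimes> A') (B \<boxtimes> B') (F \<otimes> G)"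
    and pure_sharpness: "\<exists>a. pure \<Theta> A \<I> a \<and> (\<exists>\<rho> \<in> states \<Theta> A. pairing \<Theta> a \<rho> = 1)"
    and purification: "\<rho> \<in> normalised_states \<Theta> A
      \<Longrightarrow> \<exists>B. \<exists>\<Psi> \<in> pure_states \<Theta> (A \<boxtimes> B). marginal \<Theta> A B \<Psi> = \<rho>"
    and purification_unique:
      "\<lbrakk>\<Psi> \<in> pure_states \<Theta> (A \<boxtimes> B); \<Psi>' \<in> pure_states \<Theta> (A \<boxtimes> B);
        marginal \<Theta> A B \<Psi> = marginal \<Theta> A B \<Psi>'\<rbrakk>
      \<Longrightarrow> \<exists>U. reversible \<Theta> B B U \<and> \<Psi>' = (\<one> A \<otimes> U) \<odot> \<Psi>"

section \<open>Spectra, unital channels and majorisation\<close>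

definition perfectly_distinguishable :: "('s, 't) opt \<Rightarrow> 's \<Rightarrow> 't set \<Rightarrow> bool" where
  "perfectly_distinguishable \<Theta> A M \<longleftrightarrow> M \<subseteq> normalised_states \<Theta> A \<and>
     (\<exists>X \<rho> a. bij_betw \<rho> X M \<and> test \<Theta> A (triv \<Theta>) X a \<and>
        (\<forall>i\<in>X. \<forall>j\<in>X. pairing \<Theta> (a i) (\<rho> j) = (if i = j then 1 else 0)))"

definition pure_maximal_set :: "('s, 't) opt \<Rightarrow> 's \<Rightarrow> 't set \<Rightarrow> bool" where
  "pure_maximal_set \<Theta> A M \<longleftrightarrow> M \<subseteq> pure_states \<Theta> A \<and> perfectly_distinguishable \<Theta> A M \<and>
     (\<forall>\<tau> \<in> normalised_states \<Theta> A - M. \<not> perfectly_distinguishable \<Theta> A (insert \<tau> M))"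

text \<open>Vectors in \<open>\<real>\<^sup>d\<close> are lists of length \<open>d\<close>. \<open>is_spectrum \<Theta> A \<rho> p\<close> says that \<open>\<rho>\<close> has a
  diagonalisation with weights \<open>p\<close>; this determines \<open>p\<close> up to reordering only.\<close>

definition is_spectrum :: "('s, 't) opt \<Rightarrow> 's \<Rightarrow> 't \<Rightarrow> real list \<Rightarrow> bool" where
  "is_spectrum \<Theta> A \<rho> p \<longleftrightarrow>
     (\<forall>x \<in> set p. 0 \<le> x) \<and> sum_list p = 1 \<and>
     (\<exists>\<alpha>. distinct \<alpha> \<and> length \<alpha> = length p \<and> pure_maximal_set \<Theta> A (set \<alpha>) \<and>
        lin_comb \<Theta> (triv \<Theta>) A \<rho> {..<length p} (\<lambda>i. p ! i) (\<lambda>i. \<alpha> ! i))"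

definition microcanonical :: "('s, 't) opt \<Rightarrow> 's \<Rightarrow> 't" where
  "microcanonical \<Theta> A = (THE \<chi>. \<chi> \<in> normalised_states \<Theta> A \<and>
     (\<forall>U. reversible \<Theta> A A U \<longrightarrow> seq \<Theta> U \<chi> = \<chi>))"

definition unital_channel :: "('s, 't) opt \<Rightarrow> 's \<Rightarrow> 's \<Rightarrow> 't \<Rightarrow> bool" where
  "unital_channel \<Theta> A A' D \<longleftrightarrow>
     channel \<Theta> A A' D \<and> seq \<Theta> D (microcanonical \<Theta> A) = microcanonical \<Theta> A'"

definition majorises :: "real list \<Rightarrow> real list \<Rightarrow> bool" where
  "majorises x y \<longleftrightarrow> length x = length y \<and>
     (\<forall>k \<in> {1..<length x}. sum_list (take k (rev (sort x))) \<ge> sum_list (take k (rev (sort y)))) \<and>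
     sum_list x = sum_list y"

end

theory Submission
  imports Defs "HOL-Combinatorics.List_Permutation" "HOL-Analysis.Convex"
begin

text \<open>
  No diagonalisation theorem is needed, since diagonalisations of \<open>\<rho>\<close> and \<open>\<sigma>\<close> are given. The heart of the
  matter is that an invariant state \<open>\<chi>\<close> (which exists by compactness) is the uniform mixture of every
  pure maximal set: by transitivity all sharp pure effects have the same probability \<open>p\<close> on \<open>\<chi>\<close>, so \<open>p\<close> is
  also the largest weight of a pure state in \<open>\<chi>\<close>, and a pure state detected with maximal probability
  can be split off. Splitting off the elements of the set leaves a remainder which, by steering, would
  extend the set if it were not zero. A unital channel \<open>D\<close> then turns the matrix \<open>(b\<^sub>i|D \<alpha>\<^sub>j)\<close> into a doubly stochastic
  one relating the spectra; conversely a doubly stochastic matrix gives a measure-and-prepare channel, and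
  the Hardy-Littlewood-Polya theorem translates both into majorisation.
\<close>

section \<open>Doubly stochastic matrices and majorisation\<close>

text \<open>Transitivity comes from reading the pure states of a system as purifications of the only
  normalised state of \<open>\<I>\<close>. A purification ties a system to its purifying system: an
  effect on either side prepares a component of the marginal on the other side, and the joint
  probability can be read from either side. Going across and back extracts from a state a pure
  component that carries the whole probability of a given pure effect. If that probability is
  maximal, the dual effect of the component forces the component to be the state detected with
  certainty.

  The obstacle is that the test distinguishing a pure maximal set need not consist of pure effects,
  so the sharp effects dual to its elements are not known to be orthogonal, and splitting off one
  element might lower the weight of the next. Orthogonality is therefore shown on the purifying
  system first. Uniformity holds for every invariant state and every pure maximal set, which also
  gives the uniqueness of the microcanonical state and the equal lengths of \<open>p\<close> and
  \<open>q\<close>.\<close>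

definition doubly_stochastic :: "nat \<Rightarrow> (nat \<Rightarrow> nat \<Rightarrow> real) \<Rightarrow> bool" where
  "doubly_stochastic n M \<longleftrightarrow> (\<forall>i<n. \<forall>j<n. 0 \<le> M i j) \<and> (\<forall>i<n. (\<Sum>j<n. M i j) = 1) \<and>
     (\<forall>j<n. (\<Sum>i<n. M i j) = 1)"

text \<open>Vectors are functions of which only the first \<open>n\<close> entries count, because
  the dimension is a property of a system and not of a type.\<close>

definition mixes_to :: "nat \<Rightarrow> (nat \<Rightarrow> real) \<Rightarrow> (nat \<Rightarrow> real) \<Rightarrow> bool" where
  "mixes_to n p q \<longleftrightarrow> (\<exists>M. doubly_stochastic n M \<and> (\<forall>i<n. q i = (\<Sum>j<n. M i j * p j)))"

lemma mixes_to_trans: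
  assumes "mixes_to n p q" "mixes_to n q r"
  shows "mixes_to n p r"
proof -
  obtain M where M: "doubly_stochastic n M" "\<forall>i<n. q i = (\<Sum>j<n. M i j * p j)"
    using assms(1) by (auto simp: mixes_to_def)
  obtain N where N: "doubly_stochastic n N" "\<forall>i<n. r i = (\<Sum>j<n. N i j * q j)"
    using assms(2) by (auto simp: mixes_to_def)
  define L where "L = (\<lambda>i j. \<Sum>k<n. N i k * M k j)"
  have "(\<Sum>j<n. L i j) = 1" if "i < n" for i
  proof -
    have "(\<Sum>j<n. L i j) = (\<Sum>k<n. N i k * (\<Sum>j<n. M k j))"
      unfolding L_def by (subst sum.swap) (simp add: sum_distrib_left)
    then show ?thesis using M N that by (simp add: doubly_stochastic_def)
  qed
  moreover have "(\<Sum>i<n. L i j) = 1" if "j < n" for j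
  proof -
    have "(\<Sum>i<n. L i j) = (\<Sum>k<n. (\<Sum>i<n. N i k) * M k j)"
      unfolding L_def by (subst sum.swap) (simp add: sum_distrib_right)
    then show ?thesis using M N that by (simp add: doubly_stochastic_def)
  qed
  moreover have "0 \<le> L i j" if "i < n" "j < n" for i j
    unfolding L_def using M N that by (auto simp: doubly_stochastic_def intro!: sum_nonneg)
  ultimately have "doubly_stochastic n L" by (simp add: doubly_stochastic_def)
  moreover have "r i = (\<Sum>j<n. L i j * p j)" if "i < n" for i
  proof -
    have "r i = (\<Sum>k<n. \<Sum>j<n. N i k * M k j * p j)"
      using M N that by (simp add: sum_distrib_left mult.assoc)
    also have "\<dots> = (\<Sum>j<n. L i j * p j)"
      unfolding L_def by (subst sum.swap) (simp add: sum_distrib_right)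
    finally show ?thesis .
  qed
  ultimately show ?thesis by (auto simp: mixes_to_def)
qed

lemma mixes_to_permute:
  assumes f: "bij_betw f {..<n} {..<n}" and q: "\<And>i. i < n \<Longrightarrow> q i = p (f i)"
  shows "mixes_to n p q"
proof -
  let ?M = "\<lambda>i j. if j = f i then 1 else 0 :: real"
  have f': "f i < n" if "i < n" for i using f that by (auto simp: bij_betw_def)
  have "(\<Sum>i<n. ?M i j) = 1" if "j < n" for j
  proof -
    have "(\<Sum>i<n. ?M i j) = (\<Sum>k<n. if j = k then 1 else 0)"
      by (rule sum.reindex_bij_betw[OF f, of "\<lambda>k. if j = k then 1 else 0 :: real"])
    then show ?thesis using that by simp
  qed
  then have "doubly_stochastic n ?M"
    using f' by (auto simp: doubly_stochastic_def)
  moreover have "q i = (\<Sum>j<n. ?M i j * p j)" if "i < n" for i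
    using f' q that by (simp add: if_distrib[where f = "\<lambda>x. x * _"] cong: if_cong)
  ultimately show ?thesis by (auto simp: mixes_to_def)
qed

lemma mixes_to_rearrange:
  assumes "mset xs = mset ys" "length xs = n"
  shows "mixes_to n ((!) ys) ((!) xs)"
proof -
  have "length ys = n" using assms by (metis size_mset)
  moreover obtain f where "bij_betw f {..<length xs} {..<length ys}" "\<forall>i<length xs. xs ! i = ys ! f i"
    using permutation_Ex_bij[OF assms(1)] by auto
  ultimately show ?thesis using assms(2) by (auto intro!: mixes_to_permute)
qed

lemma mixes_to_sum_eq:
  assumes "mixes_to n p q"
  shows "(\<Sum>i<n. q i) = (\<Sum>i<n. p i)"
proof -
  obtain M where M: "doubly_stochastic n M" "\<forall>i<n. q i = (\<Sum>j<n. M i j * p j)"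
    using assms by (auto simp: mixes_to_def)
  have "(\<Sum>i<n. q i) = (\<Sum>j<n. (\<Sum>i<n. M i j) * p j)"
    using M(2) by (simp add: sum_distrib_right) (rule sum.swap)
  then show ?thesis using M(1) by (simp add: doubly_stochastic_def)
qed

text \<open>Take \<open>p k\<close> as a threshold. Entries before \<open>k\<close> lie above it and
  later ones below, so replacing the weights by the indicator of \<open>{..<k}\<close> can only
  increase the shifted sum. The shift costs \<open>k * p k\<close> on both sides, since both
  weightings have total \<open>k\<close>.\<close>

lemma sum_le_sum_largest:
  fixes p c :: "nat \<Rightarrow> real"
  assumes dec: "\<And>i j. i \<le> j \<Longrightarrow> j < n \<Longrightarrow> p j \<le> p i"
    and c: "\<And>j. j < n \<Longrightarrow> 0 \<le> c j \<and> c j \<le> 1" and sum: "(\<Sum>j<n. c j) = real k" and k: "k < n"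
  shows "(\<Sum>j<n. c j * p j) \<le> (\<Sum>j<k. p j)"
proof -
  have ivl: "{..<n} = {..<k} \<union> {k..<n}" and dis: "{..<k} \<inter> {k..<n} = {}" using k by auto
  have "(\<Sum>j<n. c j * (p j - p k)) = (\<Sum>j<k. c j * (p j - p k)) + (\<Sum>j=k..<n. c j * (p j - p k))"
    unfolding ivl by (rule sum.union_disjoint) (auto simp: dis)
  also have "\<dots> \<le> (\<Sum>j<k. p j - p k) + (\<Sum>j=k..<n. 0)"
  proof (intro add_mono sum_mono)
    fix j assume "j \<in> {..<k}"
    then show "c j * (p j - p k) \<le> p j - p k"
      using c[of j] dec[of j k] k by (simp add: mult_left_le_one_le)
  next
    fix j assume "j \<in> {k..<n}"
    then show "c j * (p j - p k) \<le> 0"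
      using c[of j] dec[of k j] k by (simp add: mult_nonneg_nonpos)
  qed
  finally have "(\<Sum>j<n. c j * (p j - p k)) \<le> (\<Sum>j<k. p j) - k * p k"
    by (simp add: sum_subtractf)
  then show ?thesis using sum by (simp add: sum_subtractf right_diff_distrib flip: sum_distrib_right)
qed

text \<open>The first \<open>k\<close> rows of a doubly stochastic matrix add up to weights in
  \<open>[0,1]\<close> with total \<open>k\<close>, to which \<open>sum_le_sum_largest\<close>
  applies.\<close>

lemma mixes_to_imp_partial_sums:
  assumes "mixes_to n p q" and dec: "\<And>i j. i \<le> j \<Longrightarrow> j < n \<Longrightarrow> p j \<le> p i" and k: "k < n"
  shows "(\<Sum>i<k. q i) \<le> (\<Sum>i<k. p i)"
proof -
  obtain M where M: "doubly_stochastic n M" "\<forall>i<n. q i = (\<Sum>j<n. M i j * p j)"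
    using assms by (auto simp: mixes_to_def)
  define c where "c = (\<lambda>j. \<Sum>i<k. M i j)"
  have "(\<Sum>i<k. q i) = (\<Sum>i<k. \<Sum>j<n. M i j * p j)"
    using M(2) k by simp
  also have "\<dots> = (\<Sum>j<n. c j * p j)"
    unfolding c_def by (simp add: sum_distrib_right) (rule sum.swap)
  also have "\<dots> \<le> (\<Sum>i<k. p i)"
  proof (rule sum_le_sum_largest[OF dec _ _ k])
    fix j assume j: "j < n"
    have "c j \<le> (\<Sum>i<n. M i j)"
      unfolding c_def using M(1) k j by (intro sum_mono2) (auto simp: doubly_stochastic_def)
    moreover have "0 \<le> c j"
      unfolding c_def using M(1) k j by (intro sum_nonneg) (auto simp: doubly_stochastic_def)
    ultimately show "0 \<le> c j \<and> c j \<le> 1" using M(1) j by (simp add: doubly_stochastic_def)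
  next
    have "(\<Sum>j<n. c j) = (\<Sum>i<k. \<Sum>j<n. M i j)"
      unfolding c_def by (rule sum.swap)
    then show "(\<Sum>j<n. c j) = real k" using M(1) k by (simp add: doubly_stochastic_def)
  qed
  finally show ?thesis .
qed

text \<open>The matrix is a convex combination of the identity and the transposition of
  \<open>j\<close> and \<open>k\<close>. The full transposition would move \<open>p j - p k\<close>,
  so the weight \<open>t = d / (p j - p k)\<close> moves \<open>d\<close>; for equal entries
  \<open>d\<close> is zero.\<close>

lemma mixes_to_transfer:
  fixes p :: "nat \<Rightarrow> real"
  assumes jk: "j < n" "k < n" "j \<noteq> k" and d: "0 \<le> d" "d \<le> p j - p k"
  shows "mixes_to n p (p(j := p j - d, k := p k + d))"
proof (cases "p j = p k")
  case True
  then have "d = 0" using d by simp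
  then show ?thesis by (intro mixes_to_permute[of id]) auto
next
  case False
  define t where "t = d / (p j - p k)"
  have t: "0 \<le> t" "t \<le> 1" "d = t * (p j - p k)" using d False by (auto simp: t_def)
  let ?f = "Transposition.transpose j k"
  let ?M = "\<lambda>a b. (1 - t) * (if b = a then 1 else 0) + t * (if b = ?f a then 1 else 0)"
  have f: "bij_betw ?f {..<n} {..<n}"
    using jk by (intro bij_betwI[where g = ?f]) (auto simp: transpose_def)
  then have f': "?f i < n" if "i < n" for i using that by (auto simp: bij_betw_def)
  have "(\<Sum>a<n. if b = ?f a then 1 else 0) = (1::real)" if "b < n" for b
    using sum.reindex_bij_betw[OF f, of "\<lambda>k. if b = k then 1 else 0 :: real"] that by simp
  then have "doubly_stochastic n ?M"
    using f' t by (auto simp: doubly_stochastic_def sum.distrib simp flip: sum_distrib_left)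
  moreover have "(p(j := p j - d, k := p k + d)) a = (\<Sum>b<n. ?M a b * p b)" if "a < n" for a
  proof -
    have "(\<Sum>b<n. ?M a b * p b) = (1 - t) * (\<Sum>b<n. (if b = a then 1 else 0) * p b)
        + t * (\<Sum>b<n. (if b = ?f a then 1 else 0) * p b)"
      by (simp only: sum_distrib_left sum.distrib[symmetric]) (simp add: algebra_simps)
    also have "\<dots> = (1 - t) * p a + t * p (?f a)"
      using that f' by (simp add: if_distrib[where f = "\<lambda>x. x * _"] cong: if_cong)
    finally show ?thesis using t(3) jk(3) by (auto simp: transpose_def algebra_simps)
  qed
  ultimately show ?thesis by (auto simp: mixes_to_def)
qed

text \<open>Robin Hood transfers: each one makes a further entry of \<open>p\<close> agree with \<open>q\<close>. Only \<open>q\<close> has to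
  be sorted, which spares checking that the transfers keep \<open>p\<close> sorted.\<close>

lemma partial_sums_imp_mixes_to:
  fixes p q :: "nat \<Rightarrow> real"
  assumes "\<And>i j. i \<le> j \<Longrightarrow> j < n \<Longrightarrow> q j \<le> q i"
    and "\<And>m. m \<le> n \<Longrightarrow> (\<Sum>i<m. q i) \<le> (\<Sum>i<m. p i)" and "(\<Sum>i<n. q i) = (\<Sum>i<n. p i)"
  shows "mixes_to n p q"
  using assms(2,3)
proof (induction "card {i. i < n \<and> p i \<noteq> q i}" arbitrary: p rule: less_induct)
  case less
  note dec = assms(1)
  show ?case
  proof (cases "\<forall>i<n. q i \<le> p i")
    case True
    have "p i = q i" if "i < n" for i
    proof (rule ccontr)
      assume "p i \<noteq> q i"
      then have "(\<Sum>i<n. q i) < (\<Sum>i<n. p i)"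
        using True that by (intro sum_strict_mono_ex1) force+
      then show False using less.prems by simp
    qed
    then show ?thesis by (intro mixes_to_permute[of id]) auto
  next
    case False
    \<comment> \<open>The first deficient entry. Before it every entry is balanced or in surplus,
      and the partial sum up to and including \<open>k\<close> forces a strict surplus at some
      earlier \<open>j\<close>.\<close>
    define k where "k = (LEAST i. i < n \<and> p i < q i)"
    have k: "k < n" "p k < q k"
      using LeastI_ex[of "\<lambda>i. i < n \<and> p i < q i"] False by (auto simp: k_def not_le)
    have below: "q i \<le> p i" if "i < k" for i
      using not_less_Least[of i "\<lambda>i. i < n \<and> p i < q i"] that k(1) by (auto simp: k_def)
    have "\<exists>j<k. q j < p j"
    proof (rule ccontr)
      assume "\<not> ?thesis"
      then have "(\<Sum>i<k. p i) = (\<Sum>i<k. q i)" using below by (intro sum.cong) force+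
      then have "(\<Sum>i<Suc k. p i) < (\<Sum>i<Suc k. q i)" using k by simp
      then show False using less.prems(1)[of "Suc k"] k by simp
    qed
    then obtain j where j: "j < k" "q j < p j" by blast
    \<comment> \<open>The largest transfer that overshoots neither target, so that one of the
      entries \<open>j\<close> and \<open>k\<close> reaches \<open>q\<close> and the number of
      disagreements drops.\<close>
    define d where "d = min (p j - q j) (q k - p k)"
    have d: "0 < d" "d \<le> p j - q j" "d \<le> q k - p k" using j k by (auto simp: d_def)
    \<comment> \<open>Sortedness of \<open>q\<close> gives \<open>p k < q k \<le> q j < p j\<close>,
      hence \<open>d \<le> p j - p k\<close>, as a transfer requires.\<close>
    have jk: "q k \<le> q j" using dec j k by simp
    define p' where "p' = p(j := p j - d, k := p k + d)"
    have step: "mixes_to n p p'"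
      unfolding p'_def using j k d jk by (intro mixes_to_transfer) auto
    \<comment> \<open>Only the partial sums that contain \<open>j\<close> but not \<open>k\<close>
      change; on these initial segments \<open>p'\<close> still dominates \<open>q\<close>
      entrywise.\<close>
    have sums: "(\<Sum>i<m. p' i) = (\<Sum>i<m. p i) - (if j < m \<and> m \<le> k then d else 0)" for m
      by (induction m) (use j(1) in \<open>auto simp: p'_def\<close>)
    have "mixes_to n p' q"
    proof (rule less.hyps)
      have "p' j = q j \<or> p' k = q k" using j(1) by (auto simp: p'_def d_def min_def)
      moreover have "{i. i < n \<and> p' i \<noteq> q i} \<subseteq> {i. i < n \<and> p i \<noteq> q i}"
        using j k by (auto simp: p'_def)
      ultimately have "{i. i < n \<and> p' i \<noteq> q i} \<subset> {i. i < n \<and> p i \<noteq> q i}"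
        using j k by force
      then show "card {i. i < n \<and> p' i \<noteq> q i} < card {i. i < n \<and> p i \<noteq> q i}"
        by (intro psubset_card_mono) auto
    next
      fix m assume m: "m \<le> n"
      show "(\<Sum>i<m. q i) \<le> (\<Sum>i<m. p' i)"
      proof (cases "j < m \<and> m \<le> k")
        case True
        have "q i \<le> p' i" if "i < m" for i
          using True below[of i] that d by (auto simp: p'_def)
        then show ?thesis by (intro sum_mono) auto
      next
        case False
        then show ?thesis using less.prems(1)[OF m] sums[of m] by auto
      qed
    next
      show "(\<Sum>i<n. q i) = (\<Sum>i<n. p' i)" using less.prems(2) sums[of n] k by auto
    qed
    then show ?thesis using step mixes_to_trans by blast
  qed
qed

lemma sum_list_take_conv: "m \<le> length xs \<Longrightarrow> sum_list (take m xs) = (\<Sum>i<m. xs ! i :: real)"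
  by (simp add: sum_list_sum_nth min_absorb2 atLeast0LessThan)

lemma majorises_iff_mixes_to:
  assumes "length p = n" "length q = n"
  shows "majorises p q \<longleftrightarrow> mixes_to n ((!) p) ((!) q)"
proof -
  define p' q' where "p' = rev (sort p)" and "q' = rev (sort q)"
  have len: "length p' = n" "length q' = n" using assms by (simp_all add: p'_def q'_def)
  have dec: "xs ! j \<le> xs ! i"
    if "xs = rev (sort ys)" "i \<le> j" "j < length xs" for xs ys :: "real list" and i j
    using that sorted_rev_nth_mono[of xs i j] by simp
  have mset: "mset p' = mset p" "mset q' = mset q" by (simp_all add: p'_def q'_def)
  have sum: "sum_list p = (\<Sum>i<n. p' ! i)" "sum_list q = (\<Sum>i<n. q' ! i)"
    using mset len sum_list_take_conv[of n p'] sum_list_take_conv[of n q'] by (metis sum_mset_sum_list order_refl take_all_iff)+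
  have eq: "mixes_to n ((!) p) ((!) q) \<longleftrightarrow> mixes_to n ((!) p') ((!) q')"
    using mixes_to_rearrange[of p p' n] mixes_to_rearrange[of p' p n]
      mixes_to_rearrange[of q q' n] mixes_to_rearrange[of q' q n] assms len mset
      mixes_to_trans by metis
  have maj: "majorises p q \<longleftrightarrow> (\<forall>k\<in>{1..<n}. (\<Sum>i<k. q' ! i) \<le> (\<Sum>i<k. p' ! i)) \<and>
      (\<Sum>i<n. p' ! i) = (\<Sum>i<n. q' ! i)"
    using assms len by (auto simp: majorises_def sum_list_take_conv sum simp flip: p'_def q'_def)
  show ?thesis
  proof
    assume m: "majorises p q"
    \<comment> \<open>\<open>majorises\<close> compares only \<open>1 \<le> m < n\<close>; the case
      \<open>m = 0\<close> is trivial and \<open>m = n\<close> is the equality of the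
      totals.\<close>
    have "(\<Sum>i<m. q' ! i) \<le> (\<Sum>i<m. p' ! i)" if "m \<le> n" for m
      using m that unfolding maj by (cases "m = 0"; cases "m = n") auto
    then have "mixes_to n ((!) p') ((!) q')"
      using m dec[OF q'_def] len unfolding maj by (intro partial_sums_imp_mixes_to) auto
    then show "mixes_to n ((!) p) ((!) q)" using eq by simp
  next
    assume "mixes_to n ((!) p) ((!) q)"
    then have *: "mixes_to n ((!) p') ((!) q')" using eq by simp
    show "majorises p q"
      unfolding maj using mixes_to_imp_partial_sums[OF *] mixes_to_sum_eq[OF *] dec[OF p'_def] len
      by auto
  qed
qed

section \<open>Invariant points of compact convex sets\<close>

text \<open>The \<open>g j\<close> are a Lagrange basis for the nodes \<open>J\<close>; their bound makes the finitely many values at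
  the nodes control all others.\<close>

lemma finite_interpolation:
  fixes H :: "'i \<Rightarrow> 'x \<Rightarrow> real"
  assumes "finite F" and "\<forall>i\<in>F. \<exists>B. \<forall>x\<in>T. \<bar>H i x\<bar> \<le> B"
  shows "\<exists>J g B. finite J \<and> J \<subseteq> T \<and> (\<forall>j\<in>J. \<forall>x\<in>T. \<bar>g j x\<bar> \<le> B) \<and>
    (\<forall>c. \<forall>x\<in>T. (\<Sum>i\<in>F. c i * H i x) = (\<Sum>j\<in>J. (\<Sum>i\<in>F. c i * H i j) * g j x))"
  using assms
proof (induction F arbitrary: H rule: finite_induct)
  case empty
  then show ?case by (intro exI[of _ "{}"]) auto
next
  case (insert k F)
  show ?case
  proof (cases "\<forall>x\<in>T. H k x = 0")
    case True
    obtain J g B where *: "finite J" "J \<subseteq> T" "\<forall>j\<in>J. \<forall>x\<in>T. \<bar>g j x\<bar> \<le> B"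
      "\<forall>c. \<forall>x\<in>T. (\<Sum>i\<in>F. c i * H i x) = (\<Sum>j\<in>J. (\<Sum>i\<in>F. c i * H i j) * g j x)"
      using insert.IH[of H] insert.prems by auto
    have "(\<Sum>i\<in>insert k F. c i * H i x) = (\<Sum>i\<in>F. c i * H i x)" if "x \<in> T" for c x
      using True that insert.hyps by simp
    then show ?thesis using * by (intro exI[of _ J] exI[of _ g] exI[of _ B]) (auto intro!: sum.cong)
  next
    case False
    then obtain t where t: "t \<in> T" "H k t \<noteq> 0" by blast
    \<comment> \<open>Elimination with pivot \<open>t\<close>: every \<open>H' i\<close> vanishes at
      \<open>t\<close>.\<close>
    define H' where "H' = (\<lambda>i x. H i x - H i t / H k t * H k x)"
    obtain Bk where Bk: "\<And>x. x \<in> T \<Longrightarrow> \<bar>H k x\<bar> \<le> Bk" using insert.prems by auto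
    have "\<exists>B. \<forall>x\<in>T. \<bar>H' i x\<bar> \<le> B" if i: "i \<in> F" for i
    proof -
      obtain B where B: "\<forall>x\<in>T. \<bar>H i x\<bar> \<le> B" using insert.prems i by auto
      have "\<bar>H' i x\<bar> \<le> B + \<bar>H i t / H k t\<bar> * Bk" if "x \<in> T" for x
      proof -
        have "\<bar>H' i x\<bar> \<le> \<bar>H i x\<bar> + \<bar>H i t / H k t * H k x\<bar>" unfolding H'_def by linarith
        also have "\<dots> \<le> B + \<bar>H i t / H k t\<bar> * Bk"
          unfolding abs_mult by (intro add_mono mult_left_mono B[rule_format] Bk that) auto
        finally show ?thesis .
      qed
      then show ?thesis by blast
    qed
    then have "\<forall>i\<in>F. \<exists>B. \<forall>x\<in>T. \<bar>H' i x\<bar> \<le> B" ..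
    from insert.IH[OF this] obtain J g B
      where J: "finite J" "J \<subseteq> T" and B0: "\<forall>j\<in>J. \<forall>x\<in>T. \<bar>g j x\<bar> \<le> B"
        and eq0: "\<forall>c. \<forall>x\<in>T. (\<Sum>i\<in>F. c i * H' i x) = (\<Sum>j\<in>J. (\<Sum>i\<in>F. c i * H' i j) * g j x)"
      by (elim exE conjE)
    note B = B0[rule_format] and eq = eq0[rule_format]
    define J' where "J' = J - {t}"
    \<comment> \<open>\<open>h\<close> collects everything that multiplies \<open>f t\<close> once
      \<open>f x - f t / H k t * H k x\<close>, a combination of the \<open>H' i\<close>, has been
      interpolated at \<open>J'\<close>.\<close>
    define h where "h = (\<lambda>x. H k x / H k t - (\<Sum>j\<in>J'. H k j / H k t * g j x))"
    define g' where "g' = g(t := h)"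
    have J': "finite J'" "t \<notin> J'" "J' \<subseteq> T" using J by (auto simp: J'_def)
    define B' where "B' = max B (Bk / \<bar>H k t\<bar> + (\<Sum>j\<in>J'. \<bar>H k j / H k t\<bar> * B))"
    have "\<bar>h x\<bar> \<le> Bk / \<bar>H k t\<bar> + (\<Sum>j\<in>J'. \<bar>H k j / H k t\<bar> * B)" if "x \<in> T" for x
    proof -
      have "\<bar>h x\<bar> \<le> \<bar>H k x / H k t\<bar> + \<bar>\<Sum>j\<in>J'. H k j / H k t * g j x\<bar>" unfolding h_def by linarith
      also have "\<dots> \<le> \<bar>H k x / H k t\<bar> + (\<Sum>j\<in>J'. \<bar>H k j / H k t * g j x\<bar>)"
        by (intro add_left_mono sum_abs)
      also have "\<dots> \<le> Bk / \<bar>H k t\<bar> + (\<Sum>j\<in>J'. \<bar>H k j / H k t\<bar> * B)"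
        unfolding abs_mult[of _ "g _ x"] abs_divide[of "H k x"]
        by (intro add_mono sum_mono mult_left_mono divide_right_mono Bk B that) (auto simp: J'_def)
      finally show ?thesis .
    qed
    then have bound: "\<bar>g' j x\<bar> \<le> B'" if "j \<in> insert t J'" "x \<in> T" for j x
      using that B[of j x] by (auto simp: g'_def B'_def J'_def max.coboundedI1 max.coboundedI2)
    have interp: "(\<Sum>i\<in>insert k F. c i * H i x) =
        (\<Sum>j\<in>insert t J'. (\<Sum>i\<in>insert k F. c i * H i j) * g' j x)" if x: "x \<in> T" for c x
    proof -
      define f where "f = (\<lambda>x. \<Sum>i\<in>insert k F. c i * H i x)"
      have f': "(\<Sum>i\<in>F. c i * H' i y) = f y - f t / H k t * H k y" for y
      proof -
        have "(\<Sum>i\<in>F. c i * H' i y) = (\<Sum>i\<in>F. c i * H i y - c i * H i t * (H k y / H k t))"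
          by (intro sum.cong refl) (simp add: H'_def right_diff_distrib)
        also have "\<dots> = (\<Sum>i\<in>F. c i * H i y) - (\<Sum>i\<in>F. c i * H i t) * (H k y / H k t)"
          by (simp only: sum_subtractf sum_distrib_right)
        also have "\<dots> = f y - f t * (H k y / H k t)"
          using insert.hyps t(2) by (simp add: f_def distrib_right add_divide_distrib)
        finally show ?thesis by simp
      qed
      have "f x - f t / H k t * H k x = (\<Sum>j\<in>J. (f j - f t / H k t * H k j) * g j x)"
        using eq[OF x, of c] unfolding f' .
      also have "\<dots> = (\<Sum>j\<in>J'. (f j - f t / H k t * H k j) * g j x)"
        unfolding J'_def using J t by (intro sum.mono_neutral_right) auto
      also have "\<dots> = (\<Sum>j\<in>J'. f j * g j x - f t * (H k j / H k t * g j x))"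
        by (intro sum.cong refl) (simp add: left_diff_distrib)
      also have "\<dots> = (\<Sum>j\<in>J'. f j * g j x) - f t * (\<Sum>j\<in>J'. H k j / H k t * g j x)"
        by (simp only: sum_subtractf sum_distrib_left)
      finally have "f x = (\<Sum>j\<in>J'. f j * g j x) + f t * h x"
        unfolding h_def right_diff_distrib by simp
      also have "\<dots> = (\<Sum>j\<in>insert t J'. f j * g' j x)"
      proof -
        have "(\<Sum>j\<in>J'. f j * g j x) = (\<Sum>j\<in>J'. f j * g' j x)"
          using J'(2) by (intro sum.cong refl) (auto simp: g'_def)
        then show ?thesis using J' by (simp add: g'_def)
      qed
      finally show ?thesis by (simp add: f_def)
    qed
    show ?thesis
    proof (intro exI conjI ballI allI)
      show "finite (insert t J')" "insert t J' \<subseteq> T" using J' t(1) by auto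
      show "\<bar>g' j x\<bar> \<le> B'" if "j \<in> insert t J'" "x \<in> T" for j x
        using that by (rule bound)
      show "(\<Sum>i\<in>insert k F. c i * H i x) =
          (\<Sum>j\<in>insert t J'. (\<Sum>i\<in>insert k F. c i * H i j) * g' j x)" if "x \<in> T" for c x
        using that by (rule interp)
    qed
  qed
qed

lemma square_sum_le_card_mult_sum_squares:
  fixes a :: "'i \<Rightarrow> real"
  shows "(\<Sum>j\<in>J. \<bar>a j\<bar>)\<^sup>2 \<le> card J * (\<Sum>j\<in>J. (a j)\<^sup>2)"
  using sum_squared_le_sum_of_squares[of "\<lambda>j. \<bar>a j\<bar>" J] by (simp add: mult.commute)

text \<open>Kakutani's argument: \<open>sup\<^sub>\<phi> \<Sum>\<^sub>j (s (\<phi> j))\<^sup>2\<close> is an invariant function of \<open>s\<close>, and the bound \<open>bnd\<close>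
  makes it uniformly convex, so its minimiser is unique and therefore invariant.\<close>

lemma invariant_point_exists:
  fixes K :: "('x \<Rightarrow> real) set" and G :: "('x \<Rightarrow> 'x) set"
  assumes K: "compact K" "K \<noteq> {}"
    and mid: "\<And>s t. s \<in> K \<Longrightarrow> t \<in> K \<Longrightarrow> (\<lambda>x. (s x + t x) / 2) \<in> K"
    and act: "\<And>s \<phi>. s \<in> K \<Longrightarrow> \<phi> \<in> G \<Longrightarrow> s \<circ> \<phi> \<in> K"
    and comp: "\<And>\<phi> \<psi>. \<phi> \<in> G \<Longrightarrow> \<psi> \<in> G \<Longrightarrow> \<phi> \<circ> \<psi> \<in> G"
    and inv: "\<And>\<phi>. \<phi> \<in> G \<Longrightarrow> \<exists>\<psi>\<in>G. \<forall>s\<in>K. s \<circ> \<phi> \<circ> \<psi> = s"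
    and G: "G \<noteq> {}"
    and bnd: "\<And>s t x. s \<in> K \<Longrightarrow> t \<in> K \<Longrightarrow> \<bar>s x - t x\<bar> \<le> B * (\<Sum>j\<in>J. \<bar>s j - t j\<bar>)"
  shows "\<exists>s\<in>K. \<forall>\<phi>\<in>G. s \<circ> \<phi> = s"
proof -
  define Q where "Q = (\<lambda>s::'x \<Rightarrow> real. \<Sum>j\<in>J. (s j)\<^sup>2)"
  define S where "S = (\<lambda>r. {s\<in>K. \<forall>\<phi>\<in>G. Q (s \<circ> \<phi>) \<le> r})"
  have Qcont: "continuous_on A (\<lambda>s. Q (s \<circ> \<phi>))" for \<phi> :: "'x \<Rightarrow> 'x" and A
    unfolding Q_def o_def
    by (rule continuous_on_sum, rule continuous_on_power,
        rule continuous_on_subset[OF continuous_on_product_coordinates], simp)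
  have closed: "closed {s. Q (s \<circ> \<phi>) \<le> r}" for \<phi> :: "'x \<Rightarrow> 'x" and r
    by (rule closed_Collect_le[OF Qcont continuous_on_const])
  have Qb: "\<exists>r. \<forall>s\<in>K. Q s \<le> r"
    using continuous_attains_sup[OF K Qcont[of K id]] by auto
  define R where "R = {r. S r \<noteq> {}}"
  have "R \<noteq> {}"
  proof -
    obtain r where "\<forall>s\<in>K. Q s \<le> r" using Qb by blast
    then have "S r = K" using act by (auto simp: S_def)
    then show ?thesis using K by (auto simp: R_def)
  qed
  have bdd: "bdd_below R"
  proof (rule bdd_belowI)
    fix r assume "r \<in> R"
    then obtain s where "s \<in> S r" by (auto simp: R_def)
    moreover obtain \<phi> where "\<phi> \<in> G" using G by blast
    ultimately have "Q (s \<circ> \<phi>) \<le> r" by (simp add: S_def)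
    moreover have "0 \<le> Q (s \<circ> \<phi>)" unfolding Q_def by (intro sum_nonneg) simp
    ultimately show "0 \<le> r" by simp
  qed
  define m where "m = Inf R"
  have Smono: "S r \<subseteq> S r'" if "r \<le> r'" for r r'
    using that by (auto simp: S_def intro: order_trans)
  have ne: "S r \<noteq> {}" if mr: "m < r" for r
  proof -
    obtain r' where "r' \<in> R" "r' < r" using cInf_lessD[OF \<open>R \<noteq> {}\<close>] mr unfolding m_def by blast
    then show ?thesis using Smono[of r' r] by (auto simp: R_def)
  qed
  \<comment> \<open>A supremum of continuous functions is only lower semicontinuous. Its sublevel
    sets are closed, though, and the finite intersection property yields a point common to all
    \<open>S (m + 1 / Suc n)\<close>, which is the minimiser.\<close>
  have "K \<inter> (\<Inter>n\<in>(UNIV::nat set). \<Inter>\<phi>\<in>G. {s. Q (s \<circ> \<phi>) \<le> m + 1 / Suc n}) \<noteq> {}"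
  proof (rule compact_imp_fip_image[OF K(1)])
    show "closed (\<Inter>\<phi>\<in>G. {s. Q (s \<circ> \<phi>) \<le> m + 1 / Suc n})" for n
      using closed by (intro closed_INT) auto
  next
    fix I :: "nat set" assume I: "finite I"
    obtain s where s: "s \<in> S (m + 1 / Suc (Max (insert 0 I)))" using ne[of "m + 1 / Suc (Max (insert 0 I))"] by auto
    have "s \<in> K \<inter> (\<Inter>n\<in>I. \<Inter>\<phi>\<in>G. {s. Q (s \<circ> \<phi>) \<le> m + 1 / Suc n})"
    proof (intro IntI INT_I CollectI)
      show "s \<in> K" using s by (simp add: S_def)
      fix n \<phi> assume n: "n \<in> I" "\<phi> \<in> G"
      have "n \<le> Max (insert 0 I)" using n I by simp
      then have "1 / real (Suc (Max (insert 0 I))) \<le> 1 / real (Suc n)" by (simp add: field_simps)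
      then show "Q (s \<circ> \<phi>) \<le> m + 1 / Suc n" using s n by (force simp: S_def)
    qed
    then show "K \<inter> (\<Inter>n\<in>I. \<Inter>\<phi>\<in>G. {s. Q (s \<circ> \<phi>) \<le> m + 1 / Suc n}) \<noteq> {}" by blast
  qed
  then obtain s where s: "s \<in> K" "\<And>\<phi> n. \<phi> \<in> G \<Longrightarrow> Q (s \<circ> \<phi>) \<le> m + 1 / Suc n" by auto
  have sm: "Q (s \<circ> \<phi>) \<le> m" if "\<phi> \<in> G" for \<phi>
  proof (rule field_le_epsilon)
    fix e :: real assume "0 < e"
    then obtain n where "1 / Suc n < e" using nat_approx_posE by blast
    then show "Q (s \<circ> \<phi>) \<le> m + e" using s(2)[OF that, of n] by simp
  qed
  have "s \<circ> \<phi>\<^sub>0 = s" if \<phi>\<^sub>0: "\<phi>\<^sub>0 \<in> G" for \<phi>\<^sub>0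
  proof (rule ccontr)
    assume "s \<circ> \<phi>\<^sub>0 \<noteq> s"
    define t where "t = s \<circ> \<phi>\<^sub>0"
    have tK: "t \<in> K" using act s(1) \<phi>\<^sub>0 by (simp add: t_def)
    obtain x where x: "s x \<noteq> t x" using \<open>s \<circ> \<phi>\<^sub>0 \<noteq> s\<close> by (metis t_def ext)
    define \<delta> where "\<delta> = (s x - t x)\<^sup>2"
    define c where "c = B\<^sup>2 * card J"
    have \<delta>: "0 < \<delta>" using x by (simp add: \<delta>_def)
    \<comment> \<open>The difference of \<open>s\<close> and \<open>t\<close> at \<open>x\<close>
      remains visible at the nodes after any translation \<open>\<phi>\<close>, because
      \<open>\<psi>\<close> moves \<open>x\<close> to a point that \<open>\<phi>\<close> sends back.
      The resulting bound \<open>\<delta> / c\<close> does not depend on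
      \<open>\<phi>\<close>.\<close>
    have sep: "\<delta> \<le> c * (\<Sum>j\<in>J. (s (\<phi> j) - t (\<phi> j))\<^sup>2)" if \<phi>: "\<phi> \<in> G" for \<phi>
    proof -
      obtain \<psi> where \<psi>: "\<psi> \<in> G" "\<forall>s\<in>K. s \<circ> \<phi> \<circ> \<psi> = s" using inv \<phi> by blast
      have "s (\<phi> (\<psi> x)) = s x" "t (\<phi> (\<psi> x)) = t x"
        using \<psi>(2) s(1) tK by (metis comp_apply)+
      then have "\<bar>s x - t x\<bar> \<le> B * (\<Sum>j\<in>J. \<bar>s (\<phi> j) - t (\<phi> j)\<bar>)"
        using bnd[OF act[OF s(1) \<phi>] act[OF tK \<phi>], of "\<psi> x"] by simp
      then have "\<delta> \<le> (B * (\<Sum>j\<in>J. \<bar>s (\<phi> j) - t (\<phi> j)\<bar>))\<^sup>2"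
        unfolding \<delta>_def by (metis abs_ge_zero power2_abs power_mono)
      also have "\<dots> \<le> c * (\<Sum>j\<in>J. (s (\<phi> j) - t (\<phi> j))\<^sup>2)"
        unfolding c_def power_mult_distrib mult.assoc
        by (intro mult_left_mono square_sum_le_card_mult_sum_squares) auto
      finally show ?thesis .
    qed
    have c: "0 < c"
    proof -
      have "0 \<le> c" by (simp add: c_def)
      moreover have "c \<noteq> 0" using sep[OF \<phi>\<^sub>0] \<delta> by auto
      ultimately show ?thesis by simp
    qed
    define u where "u = (\<lambda>x. (s x + t x) / 2)"
    \<comment> \<open>By the parallelogram identity, \<open>Q\<close> at the midpoint falls below
      the average by a quarter of the squared distance. The gap is uniform in \<open>\<phi>\<close>,
      so the midpoint beats the infimum \<open>m\<close>.\<close>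
    have "Q (u \<circ> \<phi>) \<le> m - \<delta> / (4 * c)" if \<phi>: "\<phi> \<in> G" for \<phi>
    proof -
      have "Q (u \<circ> \<phi>) = (\<Sum>j\<in>J. (s (\<phi> j))\<^sup>2 / 2 + (t (\<phi> j))\<^sup>2 / 2 - (s (\<phi> j) - t (\<phi> j))\<^sup>2 / 4)"
        unfolding Q_def u_def o_def by (intro sum.cong refl) (simp add: power2_eq_square field_simps)
      also have "\<dots> = Q (s \<circ> \<phi>) / 2 + Q (t \<circ> \<phi>) / 2 - (\<Sum>j\<in>J. (s (\<phi> j) - t (\<phi> j))\<^sup>2) / 4"
        by (simp add: Q_def sum.distrib sum_subtractf sum_divide_distrib)
      also have "\<dots> \<le> m / 2 + m / 2 - \<delta> / (4 * c)"
      proof -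
        have "\<delta> / (4 * c) \<le> (\<Sum>j\<in>J. (s (\<phi> j) - t (\<phi> j))\<^sup>2) / 4"
          using sep[OF \<phi>] c by (simp add: field_simps)
        then show ?thesis
          using sm[OF \<phi>] sm[OF comp[OF \<phi>\<^sub>0 \<phi>]] by (simp add: t_def o_assoc)
      qed
      finally show ?thesis by simp
    qed
    then have "m - \<delta> / (4 * c) \<in> R"
      using mid[OF s(1) tK] by (auto simp: R_def S_def u_def)
    then have "m \<le> m - \<delta> / (4 * c)" unfolding m_def by (intro cInf_lower bdd)
    then show False using \<delta> c by (simp add: field_simps)
  qed
  then show ?thesis using s(1) by blast
qed

section \<open>Tests and pairings\<close>

context opt_theory
begin

abbreviation "Tr \<equiv> transf \<Theta>"
abbreviation "St \<equiv> states \<Theta>"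
abbreviation "NSt \<equiv> normalised_states \<Theta>"
abbreviation "PSt \<equiv> pure_states \<Theta>"
abbreviation "Eff \<equiv> effects \<Theta>"
abbreviation "disc \<equiv> discard \<Theta>"
abbreviation "Test \<equiv> test \<Theta>"
abbreviation "Ch \<equiv> channel \<Theta>"
abbreviation "Rev \<equiv> reversible \<Theta>"

abbreviation pr :: "'t \<Rightarrow> 't \<Rightarrow> real" ("\<langle>_,/ _\<rangle>") where
  "\<langle>e, \<rho>\<rangle> \<equiv> pairing \<Theta> e \<rho>"

lemma transfI: "Test A B X T \<Longrightarrow> i \<in> X \<Longrightarrow> T i \<in> Tr A B"
  by (auto simp: transf_def)

lemma channel_transf: "Ch A B C \<Longrightarrow> C \<in> Tr A B"
  using transfI[of A B "{0}" "\<lambda>_. C" 0] by (simp add: channel_def)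

lemma ident_transf: "\<one> A \<in> Tr A A"
  by (rule channel_transf[OF ident_channel])

lemma seq_transf:
  assumes "F \<in> Tr A B" "G \<in> Tr B C"
  shows "G \<odot> F \<in> Tr A C"
proof -
  obtain X T i where T: "Test A B X T" "i \<in> X" "F = T i" using assms(1) by (auto simp: transf_def)
  obtain Y R j where R: "Test B C Y R" "j \<in> Y" "G = R j" using assms(2) by (auto simp: transf_def)
  have "prod_encode (i, j) \<in> prod_encode ` (SIGMA i:X. Y)" using T R by auto
  from transfI[OF test_seq[OF T(1), of C "\<lambda>_. Y" "\<lambda>_. R"] this] show ?thesis using R T by simp
qed

lemma par_transf:
  assumes "F \<in> Tr A B" "G \<in> Tr A' B'"
  shows "F \<otimes> G \<in> Tr (A \<boxtimes> A') (B \<boxtimes> B')"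
proof -
  obtain X T i where T: "Test A B X T" "i \<in> X" "F = T i" using assms(1) by (auto simp: transf_def)
  obtain Y R j where R: "Test A' B' Y R" "j \<in> Y" "G = R j" using assms(2) by (auto simp: transf_def)
  have "prod_encode (i, j) \<in> prod_encode ` (X \<times> Y)" using T R by auto
  from transfI[OF test_par[OF T(1) R(1)] this] show ?thesis using R T by simp
qed

lemma pairing_seq:
  assumes "\<rho> \<in> St A" "F \<in> Tr A B" "e \<in> Eff B"
  shows "\<langle>e, F \<odot> \<rho>\<rangle> = \<langle>e \<odot> F, \<rho>\<rangle>"
  using seq_assoc[of \<rho> \<I> A F B e \<I>] assms by (simp add: pairing_def states_def effects_def)

lemma seq_state: "\<rho> \<in> St A \<Longrightarrow> F \<in> Tr A B \<Longrightarrow> F \<odot> \<rho> \<in> St B"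
  unfolding states_def by (rule seq_transf)

lemma seq_effect: "F \<in> Tr A B \<Longrightarrow> e \<in> Eff B \<Longrightarrow> e \<odot> F \<in> Eff A"
  unfolding effects_def by (rule seq_transf)

lemma pairing_range:
  assumes "e \<in> Eff A" "\<rho> \<in> St A"
  shows "0 \<le> \<langle>e, \<rho>\<rangle>" "\<langle>e, \<rho>\<rangle> \<le> 1"
proof -
  have "e \<odot> \<rho> \<in> Tr \<I> \<I>" using assms seq_transf by (auto simp: states_def effects_def)
  then have "prob \<Theta> (e \<odot> \<rho>) \<in> {0..1}" using bij_betwE[OF prob_bij] by blast
  then show "0 \<le> \<langle>e, \<rho>\<rangle>" "\<langle>e, \<rho>\<rangle> \<le> 1" by (simp_all add: pairing_def)
qed

lemma stats_triv:
  assumes "F \<in> Tr A B" "\<rho> \<in> St A" "e \<in> Eff B"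
  shows "stats \<Theta> A B F (\<I>, \<rho>, e) = \<langle>e, F \<odot> \<rho>\<rangle>"
  using assms by (simp add: stats_def sys_unit par_unit)

text \<open>A later transformation is absorbed into the effect, for every reference system at once.
  This carries sums and multiples of transformations through composition with a fixed
  channel.\<close>

lemma stats_seq:
  assumes "F \<in> Tr A B" "G \<in> Tr B C" "e \<in> Eff (C \<boxtimes> S)"
  shows "stats \<Theta> A C (G \<odot> F) (S, \<rho>, e) = stats \<Theta> A B F (S, \<rho>, e \<odot> (G \<otimes> \<one> S))"
proof (cases "\<rho> \<in> St (A \<boxtimes> S)")
  case True
  have G: "G \<otimes> \<one> S \<in> Tr (B \<boxtimes> S) (C \<boxtimes> S)" and F: "F \<otimes> \<one> S \<in> Tr (A \<boxtimes> S) (B \<boxtimes> S)"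
    using assms ident_transf by (auto intro: par_transf)
  have "(G \<odot> F) \<otimes> \<one> S = (G \<otimes> \<one> S) \<odot> (F \<otimes> \<one> S)"
    using interchange[OF assms(1,2) ident_transf ident_transf] seq_ident[OF ident_transf] by simp
  then have "((G \<odot> F) \<otimes> \<one> S) \<odot> \<rho> = (G \<otimes> \<one> S) \<odot> ((F \<otimes> \<one> S) \<odot> \<rho>)"
    using seq_assoc[of \<rho>, OF _ F G] True by (simp add: states_def)
  then show ?thesis
    using True assms pairing_seq[OF seq_state[OF True F] G] seq_effect[OF G] by (simp add: stats_def)
qed (simp add: stats_def)

lemma transf_eq_statsI:
  assumes "F \<in> Tr A B" "F' \<in> Tr A B" "\<And>z. stats \<Theta> A B F z = stats \<Theta> A B F' z"
  shows "F = F'"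
proof (rule transf_eqI[OF assms(1,2)])
  fix S \<rho> assume \<rho>: "\<rho> \<in> St (A \<boxtimes> S)"
  show "(F \<otimes> \<one> S) \<odot> \<rho> = (F' \<otimes> \<one> S) \<odot> \<rho>"
  proof (rule state_eqI)
    fix e assume "e \<in> Eff (B \<boxtimes> S)"
    then show "\<langle>e, (F \<otimes> \<one> S) \<odot> \<rho>\<rangle> = \<langle>e, (F' \<otimes> \<one> S) \<odot> \<rho>\<rangle>"
      using assms(3)[of "(S, \<rho>, e)"] \<rho> by (simp add: stats_def)
  qed (use assms \<rho> in \<open>auto intro!: seq_state par_transf ident_transf\<close>)
qed

lemma is_sum_singleton: "is_sum \<Theta> A B F {i} D \<Longrightarrow> F = D i"
  by (rule transf_eq_statsI) (auto simp: is_sum_def lin_comb_def)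

text \<open>Coarse-graining along an injective map has singleton blocks and so merely renames
  outcomes. It is used to remove the pair encoding that composition puts on the labels.\<close>

lemma test_relabel:
  assumes T: "Test A B X T" and f: "inj_on f X" and T': "\<And>i. i \<in> X \<Longrightarrow> T' (f i) = T i"
  shows "Test A B (f ` X) T'"
proof -
  obtain D where D: "Test A B (f ` X) D" "\<forall>j\<in>f ` X. is_sum \<Theta> A B (D j) {i \<in> X. f i = j} T"
    using coarse_grain[OF T] by blast
  have "T' (f i) = D (f i)" if "i \<in> X" for i
  proof -
    have "{k \<in> X. f k = f i} = {i}" using f that by (auto simp: inj_on_def)
    then have "is_sum \<Theta> A B (D (f i)) {i} T" using D(2) that by fastforce
    then show ?thesis using is_sum_singleton T'[OF that] by metis
  qed
  then show ?thesis using test_cong[OF D(1)] by blast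
qed

lemma test_seq_channel:
  assumes T: "Test A B X T" and G: "Ch B C G"
  shows "Test A C X (\<lambda>i. G \<odot> T i)"
proof -
  have "Test A C ((fst \<circ> prod_decode) ` prod_encode ` (SIGMA i:X. {0})) (\<lambda>i. G \<odot> T i)"
    using G by (intro test_relabel[OF test_seq[OF T, of C "\<lambda>_. {0}" "\<lambda>_ _. G"]])
      (auto simp: channel_def inj_on_def)
  moreover have "(fst \<circ> prod_decode) ` prod_encode ` (SIGMA i:X. {0}) = X" by force
  ultimately show ?thesis by simp
qed

lemma channel_seq_test:
  assumes C: "Ch A B C" and T: "Test B D X T"
  shows "Test A D X (\<lambda>i. T i \<odot> C)"
proof -
  have "Test A D ((snd \<circ> prod_decode) ` prod_encode ` (SIGMA i:{0}. X)) (\<lambda>i. T i \<odot> C)"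
    using C T by (intro test_relabel[OF test_seq[of A B "{0}" "\<lambda>_. C" D "\<lambda>_. X" "\<lambda>_. T"]])
      (auto simp: channel_def inj_on_def)
  moreover have "(snd \<circ> prod_decode) ` prod_encode ` (SIGMA i:{0}. X) = X" by force
  ultimately show ?thesis by simp
qed

lemma channel_seq: "Ch A B F \<Longrightarrow> Ch B C G \<Longrightarrow> Ch A C (G \<odot> F)"
  using test_seq_channel[of A B "{0}" "\<lambda>_. F" C G] by (simp add: channel_def)

lemma test_par_channel:
  assumes T: "Test A B X T" and G: "Ch A' B' G"
  shows "Test (A \<boxtimes> A') (B \<boxtimes> B') X (\<lambda>i. T i \<otimes> G)"
proof -
  have "Test (A \<boxtimes> A') (B \<boxtimes> B') ((fst \<circ> prod_decode) ` prod_encode ` (X \<times> {0})) (\<lambda>i. T i \<otimes> G)"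
    using G by (intro test_relabel[OF test_par[OF T, of A' B' "{0}" "\<lambda>_. G"]])
      (auto simp: channel_def inj_on_def)
  moreover have "(fst \<circ> prod_decode) ` prod_encode ` (X \<times> {0}) = X" by force
  ultimately show ?thesis by simp
qed

lemma channel_par: "Ch A B F \<Longrightarrow> Ch A' B' G \<Longrightarrow> Ch (A \<boxtimes> A') (B \<boxtimes> B') (F \<otimes> G)"
  using test_par_channel[of A B "{0}" "\<lambda>_. F" A' B' G] by (simp add: channel_def)

lemma coarse_grain_channel:
  assumes "Test A B X T" "X \<noteq> {}"
  obtains C where "Ch A B C" "is_sum \<Theta> A B C X T"
proof -
  obtain D where D: "Test A B ((\<lambda>_. 0) ` X) D"
      "\<forall>j\<in>(\<lambda>_. 0) ` X. is_sum \<Theta> A B (D j) {i \<in> X. 0 = j} T"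
    using coarse_grain[OF assms(1), of "\<lambda>_. 0"] by blast
  have "(\<lambda>_. 0 :: nat) ` X = {0}" using assms(2) by auto
  then have "Ch A B (D 0)" "is_sum \<Theta> A B (D 0) X T"
    using D test_cong[of A B "{0}" D "\<lambda>_. D 0"] by (auto simp: channel_def)
  then show ?thesis using that by blast
qed

lemma is_sumD_pairing:
  assumes "is_sum \<Theta> A B F X T" "\<rho> \<in> St A" "e \<in> Eff B"
  shows "\<langle>e, F \<odot> \<rho>\<rangle> = (\<Sum>i\<in>X. \<langle>e, T i \<odot> \<rho>\<rangle>)"
proof -
  have "T i \<in> Tr A B" if "i \<in> X" for i using assms that by (auto simp: is_sum_def lin_comb_def)
  then show ?thesis
    using assms stats_triv[of F A B \<rho> e] by (simp add: is_sum_def lin_comb_def stats_triv)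
qed

lemma triv_channel_iff: "F \<in> Tr \<I> \<I> \<Longrightarrow> Ch \<I> \<I> F \<longleftrightarrow> prob \<Theta> F = 1"
  unfolding channel_def by (subst test_triv) auto

lemma ident_triv_state: "\<one> \<I> \<in> St \<I>" and ident_triv_effect: "\<one> \<I> \<in> Eff \<I>"
  using ident_transf[of \<I>] by (auto simp: states_def effects_def)

lemma pairing_ident_left: "\<rho> \<in> St \<I> \<Longrightarrow> \<langle>\<one> \<I>, \<rho>\<rangle> = prob \<Theta> \<rho>"
  by (simp add: pairing_def states_def seq_ident)

lemma state_seq_ident: "\<rho> \<in> St A \<Longrightarrow> \<rho> \<odot> \<one> \<I> = \<rho>"
  by (auto simp: states_def intro: seq_ident)

lemma pairing_sum_state:
  assumes "is_sum \<Theta> \<I> A s X D" "e \<in> Eff A"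
  shows "\<langle>e, s\<rangle> = (\<Sum>i\<in>X. \<langle>e, D i\<rangle>)"
proof -
  have "s \<in> St A" "\<And>i. i \<in> X \<Longrightarrow> D i \<in> St A"
    using assms by (auto simp: is_sum_def lin_comb_def states_def)
  then show ?thesis
    using is_sumD_pairing[OF assms(1) ident_triv_state assms(2)] by (simp add: state_seq_ident[of _ A])
qed

lemma pairing_sum_effect:
  assumes "is_sum \<Theta> A \<I> a X D" "\<rho> \<in> St A"
  shows "\<langle>a, \<rho>\<rangle> = (\<Sum>i\<in>X. \<langle>D i, \<rho>\<rangle>)"
proof -
  have *: "\<langle>\<one> \<I>, b \<odot> \<rho>\<rangle> = \<langle>b, \<rho>\<rangle>" if "b \<in> Eff A" for b
    using assms(2) that pairing_ident_left[OF seq_state, of \<rho> A b] by (simp add: effects_def pairing_def)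
  have "a \<in> Eff A" "\<And>i. i \<in> X \<Longrightarrow> D i \<in> Eff A"
    using assms by (auto simp: is_sum_def lin_comb_def effects_def)
  then show ?thesis
    using is_sumD_pairing[OF assms(1,2) ident_triv_effect] by (simp add: *)
qed

section \<open>Scalars of the trivial system and rescaled states\<close>

definition num :: "real \<Rightarrow> 't" where
  "num w = inv_into (Tr \<I> \<I>) (prob \<Theta>) w"

lemma num:
  assumes "0 \<le> w" "w \<le> 1"
  shows "num w \<in> Tr \<I> \<I>" "prob \<Theta> (num w) = w"
proof -
  have "w \<in> prob \<Theta> ` Tr \<I> \<I>" using prob_bij assms by (auto simp: bij_betw_def)
  then show "num w \<in> Tr \<I> \<I>" "prob \<Theta> (num w) = w"
    unfolding num_def by (rule inv_into_into, rule f_inv_into_f)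
qed

lemma scaled_state:
  assumes "\<rho> \<in> St A" "0 \<le> w" "w \<le> 1"
  shows "\<rho> \<odot> num w \<in> St A" "e \<in> Eff A \<Longrightarrow> \<langle>e, \<rho> \<odot> num w\<rangle> = w * \<langle>e, \<rho>\<rangle>"
proof -
  note n = num[OF assms(2,3)]
  show "\<rho> \<odot> num w \<in> St A" using assms n seq_transf by (auto simp: states_def)
  assume e: "e \<in> Eff A"
  have t: "e \<odot> \<rho> \<in> Tr \<I> \<I>" using assms e seq_transf by (auto simp: states_def effects_def)
  have "e \<odot> (\<rho> \<odot> num w) = (e \<odot> \<rho>) \<odot> num w"
    using seq_assoc[OF n(1), of \<rho> A e \<I>] assms e by (simp add: states_def effects_def)
  then show "\<langle>e, \<rho> \<odot> num w\<rangle> = w * \<langle>e, \<rho>\<rangle>" using prob_seq[OF t n(1)] n by (simp add: pairing_def)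
qed

lemma state_prep_pairing:
  assumes "a \<in> Eff A" "\<tau> \<in> St A" "\<rho> \<in> St B" "e \<in> Eff B"
  shows "\<langle>e, (\<rho> \<odot> a) \<odot> \<tau>\<rangle> = \<langle>a, \<tau>\<rangle> * \<langle>e, \<rho>\<rangle>"
proof -
  have t: "a \<odot> \<tau> \<in> Tr \<I> \<I>" "e \<odot> \<rho> \<in> Tr \<I> \<I>"
    using assms seq_transf by (auto simp: states_def effects_def)
  have "(\<rho> \<odot> a) \<odot> \<tau> = \<rho> \<odot> (a \<odot> \<tau>)"
    using seq_assoc[of \<tau> \<I> A a \<I> \<rho> B] assms by (simp add: states_def effects_def)
  moreover have "e \<odot> (\<rho> \<odot> (a \<odot> \<tau>)) = (e \<odot> \<rho>) \<odot> (a \<odot> \<tau>)"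
    using seq_assoc[of "a \<odot> \<tau>" \<I> \<I> \<rho> B e \<I>] assms t by (simp add: states_def effects_def)
  ultimately show ?thesis using prob_seq[OF t(2,1)] by (simp add: pairing_def mult.commute)
qed

text \<open>With two trivial systems the hexagon makes \<open>\<gamma> A \<I>\<close> idempotent;
  being invertible as well, it is the identity.\<close>

lemma swap_triv: "\<gamma> A \<I> = \<one> A" "\<gamma> \<I> A = \<one> A"
proof -
  let ?g = "\<gamma> A \<I>"
  have g: "?g \<in> Tr A A" and g': "\<gamma> \<I> A \<in> Tr A A"
    using channel_transf[OF swap_channel[of A \<I>]] channel_transf[OF swap_channel[of \<I> A]]
    by (simp_all add: sys_unit)
  have "?g = ?g \<odot> ?g"
    using swap_hexagon[of A \<I> \<I>] par_unit[OF g] by (simp add: sys_unit)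
  moreover have inv: "\<gamma> \<I> A \<odot> ?g = \<one> A" using swap_inverse[of \<I> A] by (simp add: sys_unit)
  ultimately have "\<one> A = \<gamma> \<I> A \<odot> (?g \<odot> ?g)" by simp
  also have "\<dots> = ?g" using seq_assoc[OF g g g'] inv seq_ident[OF g] by simp
  finally show 1: "\<gamma> A \<I> = \<one> A" by simp
  show "\<gamma> \<I> A = \<one> A" using inv seq_ident[OF g'] by (simp add: 1)
qed

subsection \<open>Conditioning one half of a bipartite state\<close>

text \<open>The unnormalised state of one half when an effect occurs on the other. With the
  discarding effect this is the marginal.\<close>

definition cond_right :: "'s \<Rightarrow> 't \<Rightarrow> 't \<Rightarrow> 't" where
  "cond_right A b \<Psi> = (\<one> A \<otimes> b) \<odot> \<Psi>"

definition cond_left :: "'s \<Rightarrow> 't \<Rightarrow> 't \<Rightarrow> 't" where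
  "cond_left B a \<Psi> = (a \<otimes> \<one> B) \<odot> \<Psi>"

lemma cond_right_state:
  assumes "\<Psi> \<in> St (A \<boxtimes> B)" "b \<in> Eff B"
  shows "cond_right A b \<Psi> \<in> St A"
proof -
  have "\<one> A \<otimes> b \<in> Tr (A \<boxtimes> B) (A \<boxtimes> \<I>)"
    using assms ident_transf by (intro par_transf) (auto simp: effects_def)
  then show ?thesis using seq_state[OF assms(1)] by (simp add: cond_right_def sys_unit)
qed

lemma cond_left_state:
  assumes "\<Psi> \<in> St (A \<boxtimes> B)" "a \<in> Eff A"
  shows "cond_left B a \<Psi> \<in> St B"
proof -
  have "a \<otimes> \<one> B \<in> Tr (A \<boxtimes> B) (\<I> \<boxtimes> B)"
    using assms ident_transf by (intro par_transf) (auto simp: effects_def)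
  then show ?thesis using seq_state[OF assms(1)] by (simp add: cond_left_def sys_unit)
qed

lemma par_effect:
  assumes "a \<in> Eff A" "b \<in> Eff B"
  shows "a \<otimes> b \<in> Eff (A \<boxtimes> B)"
  using par_transf[of a A \<I> b B \<I>] assms by (simp add: effects_def sys_unit)

lemma pairing_cond_right:
  assumes "\<Psi> \<in> St (A \<boxtimes> B)" "a \<in> Eff A" "b \<in> Eff B"
  shows "\<langle>a, cond_right A b \<Psi>\<rangle> = \<langle>a \<otimes> b, \<Psi>\<rangle>"
proof -
  have a: "a \<in> Tr A \<I>" and b: "b \<in> Tr B \<I>" using assms by (auto simp: effects_def)
  have "a \<odot> (\<one> A \<otimes> b) = a \<otimes> b"
    using interchange[OF ident_transf a b ident_transf] seq_ident(1)[OF a] seq_ident(2)[OF b] par_unit(1)[OF a]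
    by simp
  moreover have "\<one> A \<otimes> b \<in> Tr (A \<boxtimes> B) A"
    using par_transf[OF ident_transf b, of A] by (simp add: sys_unit)
  ultimately show ?thesis
    using pairing_seq[OF assms(1) _ assms(2)] by (simp add: cond_right_def)
qed

lemma pairing_cond_left:
  assumes "\<Psi> \<in> St (A \<boxtimes> B)" "a \<in> Eff A" "b \<in> Eff B"
  shows "\<langle>b, cond_left B a \<Psi>\<rangle> = \<langle>a \<otimes> b, \<Psi>\<rangle>"
proof -
  have a: "a \<in> Tr A \<I>" and b: "b \<in> Tr B \<I>" using assms by (auto simp: effects_def)
  have "b \<odot> (a \<otimes> \<one> B) = a \<otimes> b"
    using interchange[OF a ident_transf ident_transf b] seq_ident(2)[OF a] seq_ident(1)[OF b] par_unit(2)[OF b]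
    by simp
  moreover have "a \<otimes> \<one> B \<in> Tr (A \<boxtimes> B) B"
    using par_transf[OF a ident_transf, of B] by (simp add: sys_unit)
  ultimately show ?thesis
    using pairing_seq[OF assms(1) _ assms(3)] by (simp add: cond_left_def)
qed

text \<open>Both sides are the joint probability of \<open>a\<close> and \<open>b\<close>. Through
  this symmetry, probabilities move between a system and its purifying system.\<close>

lemma cond_swap:
  assumes "\<Psi> \<in> St (A \<boxtimes> B)" "a \<in> Eff A" "b \<in> Eff B"
  shows "\<langle>b, cond_left B a \<Psi>\<rangle> = \<langle>a, cond_right A b \<Psi>\<rangle>"
  using pairing_cond_left[OF assms] pairing_cond_right[OF assms] by simp

lemma swap_state: "\<Psi> \<in> St (A \<boxtimes> B) \<Longrightarrow> \<gamma> A B \<odot> \<Psi> \<in> St (B \<boxtimes> A)"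
  by (rule seq_state[OF _ channel_transf[OF swap_channel]])

lemma cond_right_swap:
  assumes "\<Psi> \<in> St (A \<boxtimes> B)" "a \<in> Eff A"
  shows "cond_right B a (\<gamma> A B \<odot> \<Psi>) = cond_left B a \<Psi>"
proof -
  have a: "a \<in> Tr A \<I>" using assms by (simp add: effects_def)
  have t: "a \<otimes> \<one> B \<in> Tr (A \<boxtimes> B) B" "\<one> B \<otimes> a \<in> Tr (B \<boxtimes> A) B"
    using par_transf[OF a ident_transf, of B] par_transf[OF ident_transf a, of B] by (simp_all add: sys_unit)
  have "(\<one> B \<otimes> a) \<odot> \<gamma> A B = a \<otimes> \<one> B"
    using swap_natural[OF a ident_transf[of B]] seq_ident(2)[OF t(1)] by (simp add: swap_triv)
  then show ?thesis
    using seq_assoc[of \<Psi> \<I> "A \<boxtimes> B" "\<gamma> A B", OF _ channel_transf[OF swap_channel] t(2)] assms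
    by (simp add: cond_right_def cond_left_def states_def)
qed

lemma cond_left_swap:
  assumes "\<Psi> \<in> St (A \<boxtimes> B)" "b \<in> Eff B"
  shows "cond_left A b (\<gamma> A B \<odot> \<Psi>) = cond_right A b \<Psi>"
proof -
  have b: "b \<in> Tr B \<I>" using assms by (simp add: effects_def)
  have t: "\<one> A \<otimes> b \<in> Tr (A \<boxtimes> B) A" "b \<otimes> \<one> A \<in> Tr (B \<boxtimes> A) A"
    using par_transf[OF b ident_transf, of A] par_transf[OF ident_transf b, of A] by (simp_all add: sys_unit)
  have "(b \<otimes> \<one> A) \<odot> \<gamma> A B = \<one> A \<otimes> b"
    using swap_natural[OF ident_transf[of A] b] seq_ident(2)[OF t(1)] by (simp add: swap_triv)
  then show ?thesis
    using seq_assoc[of \<Psi> \<I> "A \<boxtimes> B" "\<gamma> A B", OF _ channel_transf[OF swap_channel] t(2)] assms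
    by (simp add: cond_right_def cond_left_def states_def)
qed

lemma cond_right_local:
  assumes "\<Psi> \<in> St (A \<boxtimes> B)" "b \<in> Eff B" "F \<in> Tr A C"
  shows "cond_right C b ((F \<otimes> \<one> B) \<odot> \<Psi>) = F \<odot> cond_right A b \<Psi>"
proof -
  have b: "b \<in> Tr B \<I>" using assms by (simp add: effects_def)
  have t: "\<one> A \<otimes> b \<in> Tr (A \<boxtimes> B) A" "\<one> C \<otimes> b \<in> Tr (C \<boxtimes> B) C"
    "F \<otimes> \<one> B \<in> Tr (A \<boxtimes> B) (C \<boxtimes> B)"
    using par_transf[OF ident_transf b, of A] par_transf[OF ident_transf b, of C]
      par_transf[OF assms(3) ident_transf, of B] by (simp_all add: sys_unit)
  have "(\<one> C \<otimes> b) \<odot> (F \<otimes> \<one> B) = F \<otimes> b"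
    using interchange[OF assms(3) ident_transf ident_transf b] seq_ident(2)[OF assms(3)] seq_ident(1)[OF b]
    by simp
  moreover have "F \<odot> (\<one> A \<otimes> b) = F \<otimes> b"
    using interchange[OF ident_transf assms(3) b ident_transf] seq_ident(1)[OF assms(3)] seq_ident(2)[OF b]
      par_unit(1)[OF assms(3)] by simp
  ultimately show ?thesis
    using seq_assoc[of \<Psi> \<I> "A \<boxtimes> B", OF _ t(3,2)] seq_assoc[of \<Psi> \<I> "A \<boxtimes> B", OF _ t(1) assms(3)] assms(1)
    by (simp add: cond_right_def states_def)
qed

lemma cond_right_remote:
  assumes "\<Psi> \<in> St (A \<boxtimes> B)" "c \<in> Eff C" "F \<in> Tr B C"
  shows "cond_right A c ((\<one> A \<otimes> F) \<odot> \<Psi>) = cond_right A (c \<odot> F) \<Psi>"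
proof -
  have c: "c \<in> Tr C \<I>" using assms by (simp add: effects_def)
  have t: "\<one> A \<otimes> F \<in> Tr (A \<boxtimes> B) (A \<boxtimes> C)" "\<one> A \<otimes> c \<in> Tr (A \<boxtimes> C) A"
    using par_transf[OF ident_transf assms(3), of A] par_transf[OF ident_transf c, of A] by (simp_all add: sys_unit)
  have "(\<one> A \<otimes> c) \<odot> (\<one> A \<otimes> F) = \<one> A \<otimes> (c \<odot> F)"
    using interchange[OF ident_transf ident_transf assms(3) c] seq_ident(1)[OF ident_transf] by simp
  then show ?thesis
    using seq_assoc[of \<Psi> \<I> "A \<boxtimes> B", OF _ t] assms(1) by (simp add: cond_right_def states_def)
qed

lemma seq_par_state:
  assumes "\<rho> \<in> St A" "\<sigma> \<in> St B" "F \<in> Tr A C" "G \<in> Tr B D"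
  shows "(F \<otimes> G) \<odot> (\<rho> \<otimes> \<sigma>) = (F \<odot> \<rho>) \<otimes> (G \<odot> \<sigma>)"
  using interchange[of \<rho> \<I> A F C \<sigma> \<I> B G D] assms by (simp add: states_def)

end

section \<open>Causality: normalisation, ensembles and purity\<close>

context causal_opt
begin

section \<open>Discarding and the normalisation of tests, effects and states\<close>

lemma discard_channel: "Ch A \<I> (disc A)"
  unfolding discard_def by (rule theI') (rule causality)

lemma discard_unique: "Ch A \<I> e \<Longrightarrow> e = disc A"
  using causality[of A] discard_channel[of A] by auto

lemma discard_effect: "disc A \<in> Eff A"
  unfolding effects_def by (rule channel_transf[OF discard_channel])

lemma discard_seq_channel: "Ch A B C \<Longrightarrow> disc B \<odot> C = disc A"
  by (rule discard_unique) (rule channel_seq[OF _ discard_channel])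

lemma discard_par: "disc A \<otimes> disc B = disc (A \<boxtimes> B)"
  using channel_par[OF discard_channel[of A] discard_channel[of B]] by (auto simp: sys_unit intro: discard_unique)

text \<open>Preceded by a preparation and followed by discarding, an empty test would become a
  probability distribution without outcomes, whose total is 0 and not 1.\<close>

lemma no_empty_test:
  assumes "\<rho> \<in> St A" shows "\<not> Test A B {} T"
proof
  assume T: "Test A B {} T"
  obtain X R i where R: "Test \<I> A X R" using assms by (auto simp: states_def transf_def)
  have "Test \<I> \<I> (prod_encode ` (SIGMA i:X. {})) (\<lambda>n. case prod_decode n of (i, j) \<Rightarrow> (disc B \<odot> T j) \<odot> R i)"
    by (rule test_seq[OF R]) (rule test_seq_channel[OF T discard_channel])
  then have "Test \<I> \<I> {} (\<lambda>n. case prod_decode n of (i, j) \<Rightarrow> (disc B \<odot> T j) \<odot> R i)" by simp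
  then show False by (subst (asm) test_triv) auto
qed

lemma test_sum_effect:
  assumes "Test A \<I> X a" "\<rho> \<in> St A"
  shows "(\<Sum>i\<in>X. \<langle>a i, \<rho>\<rangle>) = \<langle>disc A, \<rho>\<rangle>"
proof -
  have "X \<noteq> {}" using no_empty_test[OF assms(2)] assms(1) by auto
  then obtain C where C: "Ch A \<I> C" "is_sum \<Theta> A \<I> C X a" using coarse_grain_channel[OF assms(1)] by blast
  then show ?thesis using pairing_sum_effect[OF C(2) assms(2)] discard_unique[OF C(1)] by simp
qed

lemma effect_le_discard:
  assumes "e \<in> Eff A" "\<rho> \<in> St A"
  shows "\<langle>e, \<rho>\<rangle> \<le> \<langle>disc A, \<rho>\<rangle>"
proof -
  obtain X a i where a: "Test A \<I> X a" "i \<in> X" "e = a i" using assms by (auto simp: effects_def transf_def)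
  have "\<langle>a i, \<rho>\<rangle> \<le> (\<Sum>i\<in>X. \<langle>a i, \<rho>\<rangle>)"
    using a assms(2) test_finite[OF a(1)] transfI[OF a(1)] pairing_range(1)[of _ A \<rho>]
    by (intro member_le_sum) (auto simp: effects_def)
  then show ?thesis using test_sum_effect[OF a(1) assms(2)] a(3) by simp
qed

lemma effect_complement:
  assumes "e \<in> Eff A"
  obtains e' where "e' \<in> Eff A"
    "\<And>\<rho>. \<rho> \<in> St A \<Longrightarrow> \<langle>e, \<rho>\<rangle> + \<langle>e', \<rho>\<rangle> = \<langle>disc A, \<rho>\<rangle>"
proof -
  obtain X a i where a: "Test A \<I> X a" "i \<in> X" "e = a i" using assms by (auto simp: effects_def transf_def)
  let ?f = "\<lambda>j. if j = i then 0 else 1 :: nat"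
  obtain D where D: "Test A \<I> (?f ` X) D" "\<forall>j\<in>?f ` X. is_sum \<Theta> A \<I> (D j) {k \<in> X. ?f k = j} a"
    using coarse_grain[OF a(1)] by blast
  show ?thesis
  proof (cases "X = {i}")
    \<comment> \<open>There is no second block to coarse-grain here; the complement is the zero
      effect.\<close>
    case True
    have z: "num 0 \<odot> e \<in> Eff A"
      using assms num(1)[of 0] seq_transf by (auto simp: effects_def)
    moreover have "\<langle>num 0 \<odot> e, \<rho>\<rangle> = 0" if "\<rho> \<in> St A" for \<rho>
    proof -
      have "e \<odot> \<rho> \<in> Tr \<I> \<I>" using assms that seq_transf by (auto simp: effects_def states_def)
      moreover have "(num 0 \<odot> e) \<odot> \<rho> = num 0 \<odot> (e \<odot> \<rho>)"
        using seq_assoc[of \<rho> \<I> A e \<I> "num 0" \<I>] that assms num(1)[of 0] by (simp add: effects_def states_def)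
      ultimately show ?thesis using num[of 0] prob_seq[of "num 0" "e \<odot> \<rho>"] by (simp add: pairing_def)
    qed
    moreover have "\<langle>e, \<rho>\<rangle> = \<langle>disc A, \<rho>\<rangle>" if "\<rho> \<in> St A" for \<rho>
      using test_sum_effect[OF a(1) that] True a(3) by simp
    ultimately show ?thesis using that by simp
  next
    case False
    then have 1: "1 \<in> ?f ` X" using a(2) by force
    have X: "{k \<in> X. ?f k = 1} = X - {i}" by auto
    have s: "is_sum \<Theta> A \<I> (D 1) (X - {i}) a" using D(2)[rule_format, OF 1] unfolding X .
    have "\<langle>e, \<rho>\<rangle> + \<langle>D 1, \<rho>\<rangle> = \<langle>disc A, \<rho>\<rangle>" if "\<rho> \<in> St A" for \<rho>
      using pairing_sum_effect[OF s that] test_sum_effect[OF a(1) that] a test_finite[OF a(1)]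
        sum.remove[of X i "\<lambda>i. \<langle>a i, \<rho>\<rangle>"] by simp
    then show ?thesis using that[of "D 1"] transfI[OF D(1) 1] by (simp add: effects_def)
  qed
qed

lemma state_zero:
  assumes "s \<in> St A" "\<langle>disc A, s\<rangle> = 0" "e \<in> Eff A"
  shows "\<langle>e, s\<rangle> = 0"
  using effect_le_discard[OF assms(3,1)] pairing_range(1)[OF assms(3,1)] assms(2) by simp

lemma test_sum_state:
  assumes T: "Test \<I> A X D"
  shows "(\<Sum>i\<in>X. \<langle>disc A, D i\<rangle>) = 1"
proof -
  have "X \<noteq> {}" using no_empty_test[OF ident_triv_state] T by auto
  then obtain C where C: "Ch \<I> A C" "is_sum \<Theta> \<I> A C X D" using coarse_grain_channel[OF T] by blast
  have "Ch \<I> \<I> (disc A \<odot> C)" by (rule channel_seq[OF C(1) discard_channel])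
  then have "\<langle>disc A, C\<rangle> = 1" using triv_channel_iff channel_transf by (auto simp: pairing_def)
  then show ?thesis using pairing_sum_state[OF C(2) discard_effect] by simp
qed

lemma normalised_state: "\<rho> \<in> NSt A \<Longrightarrow> \<rho> \<in> St A"
  and normalised_discard: "\<rho> \<in> NSt A \<Longrightarrow> \<langle>disc A, \<rho>\<rangle> = 1"
  by (simp_all add: normalised_states_def)

text \<open>A normalised state is given only as one outcome of some preparation test. The other
  outcomes then have total probability zero and vanish, so the coarse-graining of the whole test is
  the state itself.\<close>

lemma normalised_iff_channel: "\<rho> \<in> NSt A \<longleftrightarrow> Ch \<I> A \<rho>"
proof
  assume "Ch \<I> A \<rho>"
  then show "\<rho> \<in> NSt A"
    using test_sum_state[of A "{0}" "\<lambda>_. \<rho>"] channel_transf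
    by (auto simp: channel_def normalised_states_def states_def)
next
  assume \<rho>: "\<rho> \<in> NSt A"
  then obtain X T i where T: "Test \<I> A X T" "i \<in> X" "\<rho> = T i"
    by (auto simp: normalised_states_def states_def transf_def)
  obtain C where C: "Ch \<I> A C" "is_sum \<Theta> \<I> A C X T" using coarse_grain_channel[OF T(1)] T(2) by blast
  have st: "T j \<in> St A" if "j \<in> X" for j using transfI[OF T(1) that] by (simp add: states_def)
  have fin: "finite X" by (rule test_finite[OF T(1)])
  have "(\<Sum>j\<in>X - {i}. \<langle>disc A, T j\<rangle>) = 0"
    using test_sum_state[OF T(1)] normalised_discard[OF \<rho>] T fin by (simp add: sum.remove)
  then have z: "\<langle>disc A, T j\<rangle> = 0" if "j \<in> X" "j \<noteq> i" for j
    using that fin st discard_effect by (subst (asm) sum_nonneg_eq_0_iff) (auto intro: pairing_range)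
  have "C = \<rho>"
  proof (rule state_eqI)
    show "C \<in> St A" using channel_transf[OF C(1)] by (simp add: states_def)
    show "\<rho> \<in> St A" by (rule normalised_state[OF \<rho>])
    fix e assume e: "e \<in> Eff A"
    have "(\<Sum>j\<in>X - {i}. \<langle>e, T j\<rangle>) = 0" using z st e by (intro sum.neutral) (auto intro: state_zero)
    then show "\<langle>e, C\<rangle> = \<langle>e, \<rho>\<rangle>" using pairing_sum_state[OF C(2) e] T fin by (simp add: sum.remove)
  qed
  then show "Ch \<I> A \<rho>" using C by simp
qed

lemma channel_normalised:
  "Ch A B C \<Longrightarrow> \<rho> \<in> NSt A \<Longrightarrow> C \<odot> \<rho> \<in> NSt B"
  unfolding normalised_iff_channel by (rule channel_seq)

lemma normaliseE:
  assumes "s \<in> St A" "\<langle>disc A, s\<rangle> \<noteq> 0"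
  obtains \<rho> where "\<rho> \<in> NSt A"
    "\<And>e. e \<in> Eff A \<Longrightarrow> \<langle>e, s\<rangle> = \<langle>disc A, s\<rangle> * \<langle>e, \<rho>\<rangle>"
proof -
  obtain \<rho> r where \<rho>: "\<rho> \<in> NSt A" "lin_comb \<Theta> \<I> A s {()} (\<lambda>_. r) (\<lambda>_. \<rho>)"
    using normalisable[OF assms(1)] assms discard_effect unfolding is_multiple_def by metis
  have *: "\<langle>e, s\<rangle> = r * \<langle>e, \<rho>\<rangle>" if "e \<in> Eff A" for e
  proof -
    have "stats \<Theta> \<I> A s (\<I>, \<one> \<I>, e) = r * stats \<Theta> \<I> A \<rho> (\<I>, \<one> \<I>, e)"
      using \<rho>(2) by (simp add: lin_comb_def)
    then show ?thesis
      using stats_triv[of s \<I> A "\<one> \<I>" e] stats_triv[of \<rho> \<I> A "\<one> \<I>" e] that assms(1) normalised_state[OF \<rho>(1)]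
        ident_triv_state state_seq_ident by (simp add: states_def)
  qed
  then have "r = \<langle>disc A, s\<rangle>" using normalised_discard[OF \<rho>(1)] discard_effect by simp
  then show ?thesis using that \<rho>(1) * by blast
qed

text \<open>Draw the index \<open>i\<close> with probability \<open>w i\<close>, then prepare the
  normalised version of \<open>D i\<close> conditionally. Where \<open>w i = 0\<close> any
  normalised state serves; one exists because some weight is not zero.\<close>

lemma ensemble_test:
  assumes X: "finite X" and D: "\<And>i. i \<in> X \<Longrightarrow> D i \<in> St A"
    and sum: "(\<Sum>i\<in>X. \<langle>disc A, D i\<rangle>) = 1"
  shows "Test \<I> A X D"
proof -
  define w where "w = (\<lambda>i. \<langle>disc A, D i\<rangle>)"
  have w: "0 \<le> w i" "w i \<le> 1" if "i \<in> X" for i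
    using pairing_range[OF discard_effect D[OF that]] by (simp_all add: w_def)
  obtain k where k: "k \<in> X" "w k \<noteq> 0" using sum unfolding w_def by (metis sum.neutral zero_neq_one)
  obtain \<rho>\<^sub>0 where \<rho>\<^sub>0: "\<rho>\<^sub>0 \<in> NSt A" using normaliseE[OF D[OF k(1)]] k(2) by (auto simp: w_def)
  have "\<exists>\<rho>. \<rho> \<in> NSt A \<and> D i = \<rho> \<odot> num (w i)" if "i \<in> X" for i
  proof -
    obtain \<rho> where \<rho>: "\<rho> \<in> NSt A" "\<And>e. e \<in> Eff A \<Longrightarrow> \<langle>e, D i\<rangle> = w i * \<langle>e, \<rho>\<rangle>"
    proof (cases "w i = 0")
      case True
      then show ?thesis using that[OF \<rho>\<^sub>0] state_zero[OF D[OF \<open>i \<in> X\<close>]] by (simp add: w_def)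
    next
      case False
      then show ?thesis using normaliseE[OF D[OF \<open>i \<in> X\<close>]] that by (metis w_def)
    qed
    have "D i = \<rho> \<odot> num (w i)"
      using \<rho> D[OF \<open>i \<in> X\<close>] scaled_state[OF normalised_state[OF \<rho>(1)] w[OF \<open>i \<in> X\<close>]] by (intro state_eqI) auto
    then show ?thesis using \<rho>(1) by blast
  qed
  then obtain R where R: "\<And>i. i \<in> X \<Longrightarrow> R i \<in> NSt A" "\<And>i. i \<in> X \<Longrightarrow> D i = R i \<odot> num (w i)"
    by metis
  have "Test \<I> \<I> X (\<lambda>i. num (w i))"
    using X w num sum by (subst test_triv) (auto simp: w_def)
  then have t: "Test \<I> A (prod_encode ` (SIGMA i:X. {0})) (\<lambda>n. case prod_decode n of (i, j) \<Rightarrow> R i \<odot> num (w i))"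
    using R(1) by (intro test_seq) (auto simp: normalised_iff_channel channel_def)
  have "Test \<I> A ((fst \<circ> prod_decode) ` prod_encode ` (SIGMA i:X. {0})) D"
    by (rule test_relabel[OF t]) (auto simp: inj_on_def R(2))
  moreover have "(fst \<circ> prod_decode) ` prod_encode ` (SIGMA i:X. {0}) = X" by force
  ultimately show ?thesis by simp
qed

section \<open>Mixtures, measure-and-prepare channels and merged ensembles\<close>

lemma mixture:
  fixes X :: "nat set"
  assumes X: "finite X" and D: "\<And>i. i \<in> X \<Longrightarrow> D i \<in> NSt A"
    and w: "\<And>i. i \<in> X \<Longrightarrow> 0 \<le> w i" "(\<Sum>i\<in>X. w i) = 1"
  obtains \<rho> where "\<rho> \<in> NSt A" "\<And>e. e \<in> Eff A \<Longrightarrow> \<langle>e, \<rho>\<rangle> = (\<Sum>i\<in>X. w i * \<langle>e, D i\<rangle>)"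
proof -
  have w1: "w i \<le> 1" if "i \<in> X" for i using w that member_le_sum[of i X w] X by auto
  note S = scaled_state[OF normalised_state[OF D] w(1) w1]
  have "Test \<I> A X (\<lambda>i. D i \<odot> num (w i))"
    using S w D by (intro ensemble_test X) (auto simp: discard_effect normalised_discard)
  moreover have "X \<noteq> {}" using w by auto
  ultimately obtain C where C: "Ch \<I> A C" "is_sum \<Theta> \<I> A C X (\<lambda>i. D i \<odot> num (w i))"
    using coarse_grain_channel by blast
  show ?thesis
  proof (rule that[of C])
    show "C \<in> NSt A" using C(1) by (simp add: normalised_iff_channel)
    show "\<langle>e, C\<rangle> = (\<Sum>i\<in>X. w i * \<langle>e, D i\<rangle>)" if "e \<in> Eff A" for e
      using pairing_sum_state[OF C(2) that] S that by simp
  qed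
qed

lemma measure_prepare:
  assumes a: "Test A \<I> X a" "X \<noteq> {}" and R: "\<And>i. i \<in> X \<Longrightarrow> R i \<in> NSt B"
  obtains C where "Ch A B C"
    "\<And>\<tau> e. \<tau> \<in> St A \<Longrightarrow> e \<in> Eff B \<Longrightarrow> \<langle>e, C \<odot> \<tau>\<rangle> = (\<Sum>i\<in>X. \<langle>a i, \<tau>\<rangle> * \<langle>e, R i\<rangle>)"
proof -
  have t: "Test A B (prod_encode ` (SIGMA i:X. {0})) (\<lambda>n. case prod_decode n of (i, j) \<Rightarrow> R i \<odot> a i)"
    using R(1) by (intro test_seq[OF a(1)]) (auto simp: normalised_iff_channel channel_def)
  have "Test A B ((fst \<circ> prod_decode) ` prod_encode ` (SIGMA i:X. {0})) (\<lambda>i. R i \<odot> a i)"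
    by (rule test_relabel[OF t]) (auto simp: inj_on_def)
  moreover have "(fst \<circ> prod_decode) ` prod_encode ` (SIGMA i:X. {0}) = X" by force
  ultimately have "Test A B X (\<lambda>i. R i \<odot> a i)" by simp
  then obtain C where C: "Ch A B C" "is_sum \<Theta> A B C X (\<lambda>i. R i \<odot> a i)"
    using coarse_grain_channel a(2) by blast
  show ?thesis
  proof (rule that[OF C(1)])
    fix \<tau> e assume \<tau>: "\<tau> \<in> St A" and e: "e \<in> Eff B"
    have "\<langle>e, (R i \<odot> a i) \<odot> \<tau>\<rangle> = \<langle>a i, \<tau>\<rangle> * \<langle>e, R i\<rangle>" if "i \<in> X" for i
      by (rule state_prep_pairing[OF _ \<tau> normalised_state[OF R[OF that]] e])
        (use transfI[OF a(1) that] in \<open>simp add: effects_def\<close>)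
    then show "\<langle>e, C \<odot> \<tau>\<rangle> = (\<Sum>i\<in>X. \<langle>a i, \<tau>\<rangle> * \<langle>e, R i\<rangle>)"
      using is_sumD_pairing[OF C(2) \<tau> e] by simp
  qed
qed

lemma subensemble:
  assumes "Test \<I> A X D" "Y \<subseteq> X"
  obtains s where "s \<in> St A" "\<And>e. e \<in> Eff A \<Longrightarrow> \<langle>e, s\<rangle> = (\<Sum>i\<in>Y. \<langle>e, D i\<rangle>)"
proof (cases "Y = {}")
  case True
  obtain i where "i \<in> X" using no_empty_test[OF ident_triv_state] assms by fastforce
  then have i: "D i \<in> St A" using transfI[OF assms(1)] by (simp add: states_def)
  show ?thesis using that[of "D i \<odot> num 0"] scaled_state[OF i, of 0] True by simp
next
  case False
  let ?f = "\<lambda>j. if j \<in> Y then 0 else 1 :: nat"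
  obtain C where C: "Test \<I> A (?f ` X) C" "\<forall>j\<in>?f ` X. is_sum \<Theta> \<I> A (C j) {k \<in> X. ?f k = j} D"
    using coarse_grain[OF assms(1)] by blast
  have 0: "0 \<in> ?f ` X" using False assms(2) by force
  have Y: "{k \<in> X. ?f k = 0} = Y" using assms(2) by auto
  have s: "is_sum \<Theta> \<I> A (C 0) Y D" using C(2)[rule_format, OF 0] unfolding Y .
  then show ?thesis
    using that[of "C 0"] transfI[OF C(1) 0] pairing_sum_state[OF s] by (simp add: states_def)
qed

section \<open>Linear relations and purity of states, tested on effects alone\<close>

lemma lin_comb_statesD:
  assumes "lin_comb \<Theta> \<I> A \<rho> X c D" "e \<in> Eff A"
  shows "\<langle>e, \<rho>\<rangle> = (\<Sum>i\<in>X. c i * \<langle>e, D i\<rangle>)"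
proof -
  have *: "stats \<Theta> \<I> A s (\<I>, \<one> \<I>, e) = \<langle>e, s\<rangle>" if "s \<in> Tr \<I> A" for s
    using stats_triv[OF that ident_triv_state assms(2)] that by (simp add: seq_ident)
  have D: "D i \<in> Tr \<I> A" if "i \<in> X" for i using assms that by (auto simp: lin_comb_def)
  have \<rho>: "\<rho> \<in> Tr \<I> A" using assms(1) by (simp add: lin_comb_def)
  have "stats \<Theta> \<I> A \<rho> (\<I>, \<one> \<I>, e) = (\<Sum>i\<in>X. c i * stats \<Theta> \<I> A (D i) (\<I>, \<one> \<I>, e))"
    using assms(1) by (simp add: lin_comb_def)
  then show ?thesis by (simp add: * D \<rho>)
qed

text \<open>For a state, the input on the reference system is just a state of \<open>S\<close>,
  which can be absorbed into the effect. Linear relations between states therefore need checking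
  only on effects of \<open>A\<close>.\<close>

lemma stats_state:
  assumes "\<rho> \<in> St A" "\<sigma> \<in> St S" "e \<in> Eff (A \<boxtimes> S)"
  shows "stats \<Theta> \<I> A \<rho> (S, \<sigma>, e) = \<langle>e \<odot> (\<one> A \<otimes> \<sigma>), \<rho>\<rangle>"
proof -
  have r: "\<rho> \<in> Tr \<I> A" and s: "\<sigma> \<in> Tr \<I> S" using assms by (auto simp: states_def)
  have "(\<rho> \<otimes> \<one> S) \<odot> \<sigma> = \<rho> \<otimes> \<sigma>"
    using interchange[OF ident_transf r s ident_transf] seq_ident r s par_unit(2)[OF s] by simp
  moreover have "(\<one> A \<otimes> \<sigma>) \<odot> \<rho> = \<rho> \<otimes> \<sigma>"
    using interchange[OF r ident_transf ident_transf s] seq_ident r s par_unit(1)[OF r] by simp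
  moreover have t: "\<one> A \<otimes> \<sigma> \<in> Tr A (A \<boxtimes> S)"
    using par_transf[OF ident_transf s, of A] by (simp add: sys_unit)
  ultimately show ?thesis
    using pairing_seq[OF assms(1) t assms(3)] assms by (simp add: stats_def sys_unit)
qed

lemma lin_comb_statesI:
  assumes "\<rho> \<in> St A" "finite X" "\<And>i. i \<in> X \<Longrightarrow> D i \<in> St A"
    and eq: "\<And>e. e \<in> Eff A \<Longrightarrow> \<langle>e, \<rho>\<rangle> = (\<Sum>i\<in>X. c i * \<langle>e, D i\<rangle>)"
  shows "lin_comb \<Theta> \<I> A \<rho> X c D"
proof -
  have "stats \<Theta> \<I> A \<rho> (S, \<sigma>, e) = (\<Sum>i\<in>X. c i * stats \<Theta> \<I> A (D i) (S, \<sigma>, e))" for S \<sigma> e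
  proof (cases "\<sigma> \<in> St S \<and> e \<in> Eff (A \<boxtimes> S)")
    case True
    then have "\<one> A \<otimes> \<sigma> \<in> Tr A (A \<boxtimes> S)"
      using par_transf[OF ident_transf[of A], of \<sigma> \<I> S] by (simp add: sys_unit states_def)
    then have "e \<odot> (\<one> A \<otimes> \<sigma>) \<in> Eff A" using True seq_effect by blast
    then show ?thesis using True assms by (simp add: stats_state)
  next
    case False
    then show ?thesis by (auto simp: stats_def sys_unit)
  qed
  then show ?thesis using assms by (auto simp: lin_comb_def states_def)
qed

text \<open>Purity speaks of outcomes of a test, while two summands of a subnormalised state need
  not form one. A third outcome carrying the missing probability completes them.\<close>

lemma pure_state_split:
  assumes "pure \<Theta> \<I> A s" and s12: "s\<^sub>1 \<in> St A" "s\<^sub>2 \<in> St A"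
    and eq: "\<And>e. e \<in> Eff A \<Longrightarrow> \<langle>e, s\<rangle> = \<langle>e, s\<^sub>1\<rangle> + \<langle>e, s\<^sub>2\<rangle>"
  obtains r where "\<And>e. e \<in> Eff A \<Longrightarrow> \<langle>e, s\<^sub>1\<rangle> = r * \<langle>e, s\<rangle>"
proof (cases "\<langle>disc A, s\<rangle> = 0")
  case True
  have "\<langle>disc A, s\<^sub>1\<rangle> = 0"
    using True eq[OF discard_effect] pairing_range[OF discard_effect s12(1)]
      pairing_range[OF discard_effect s12(2)] by simp
  then show ?thesis using that[of 0] state_zero[OF s12(1)] by simp
next
  case False
  have s: "s \<in> St A" using assms(1) by (simp add: pure_def states_def)
  obtain \<rho> where \<rho>: "\<rho> \<in> NSt A" using normaliseE[OF s False] by blast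
  define w where "w = 1 - \<langle>disc A, s\<rangle>"
  have w: "0 \<le> w" "w \<le> 1" using pairing_range[OF discard_effect s] by (auto simp: w_def)
  define D where "D = (\<lambda>i::nat. if i = 0 then s\<^sub>1 else if i = 1 then s\<^sub>2 else \<rho> \<odot> num w)"
  have D: "D i \<in> St A" for i using s12 scaled_state(1)[OF normalised_state[OF \<rho>] w] by (simp add: D_def)
  have t: "Test \<I> A {0,1,2} D"
    using D eq[OF discard_effect] scaled_state(2)[OF normalised_state[OF \<rho>] w discard_effect] normalised_discard[OF \<rho>]
    by (intro ensemble_test) (auto simp: D_def w_def)
  have "is_sum \<Theta> \<I> A s {0,1} D"
    unfolding is_sum_def using s D eq by (intro lin_comb_statesI) (auto simp: D_def)
  moreover have "{0,1} \<subseteq> {0,1,2::nat}" by auto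
  ultimately have "is_multiple \<Theta> \<I> A (D 0) s"
    using assms(1) t unfolding pure_def by blast
  then obtain r where "lin_comb \<Theta> \<I> A s\<^sub>1 {()} (\<lambda>_. r) (\<lambda>_. s)" by (auto simp: is_multiple_def D_def)
  from lin_comb_statesD[OF this] show ?thesis using that[of r] by simp
qed

text \<open>Splittings into two suffice: the remaining outcomes of a decomposition can be merged
  into one state.\<close>

lemma pure_stateI:
  assumes s: "s \<in> St A"
    and split: "\<And>s\<^sub>1 s\<^sub>2. s\<^sub>1 \<in> St A \<Longrightarrow> s\<^sub>2 \<in> St A \<Longrightarrow>
      (\<And>e. e \<in> Eff A \<Longrightarrow> \<langle>e, s\<rangle> = \<langle>e, s\<^sub>1\<rangle> + \<langle>e, s\<^sub>2\<rangle>) \<Longrightarrow>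
      \<exists>r. \<forall>e\<in>Eff A. \<langle>e, s\<^sub>1\<rangle> = r * \<langle>e, s\<rangle>"
  shows "pure \<Theta> \<I> A s"
  unfolding pure_def
proof (intro conjI allI impI ballI; (elim conjE)?)
  show "s \<in> Tr \<I> A" using s by (simp add: states_def)
  fix X D Y i
  assume Y: "Y \<subseteq> X" and D: "Test \<I> A X D" and sum: "is_sum \<Theta> \<I> A s Y D" and i: "i \<in> Y"
  have Di: "D i \<in> St A" using transfI[OF D] Y i by (auto simp: states_def)
  have fin: "finite Y" using test_finite[OF D] Y finite_subset by blast
  have "Y - {i} \<subseteq> X" using Y by auto
  then obtain s' where s': "s' \<in> St A" "\<And>e. e \<in> Eff A \<Longrightarrow> \<langle>e, s'\<rangle> = (\<Sum>i\<in>Y - {i}. \<langle>e, D i\<rangle>)"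
    using subensemble[OF D] by blast
  have "\<langle>e, s\<rangle> = \<langle>e, D i\<rangle> + \<langle>e, s'\<rangle>" if "e \<in> Eff A" for e
    using pairing_sum_state[OF sum that] s'(2)[OF that] fin i by (simp add: sum.remove)
  from split[OF Di s'(1) this] obtain r where "\<forall>e\<in>Eff A. \<langle>e, D i\<rangle> = r * \<langle>e, s\<rangle>" by blast
  then show "is_multiple \<Theta> \<I> A (D i) s"
    unfolding is_multiple_def using Di s by (intro exI[of _ r] lin_comb_statesI) auto
qed

text \<open>Scaling a splitting of \<open>\<rho>\<close> by \<open>r\<close> gives a splitting of
  \<open>s\<close>.\<close>

lemma pure_state_rescale:
  assumes "pure \<Theta> \<I> A s" and \<rho>: "\<rho> \<in> St A" and r: "0 < r" "r \<le> 1"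
    and eq: "\<And>e. e \<in> Eff A \<Longrightarrow> \<langle>e, s\<rangle> = r * \<langle>e, \<rho>\<rangle>"
  shows "pure \<Theta> \<I> A \<rho>"
proof (rule pure_stateI[OF \<rho>])
  fix s\<^sub>1 s\<^sub>2 assume s: "s\<^sub>1 \<in> St A" "s\<^sub>2 \<in> St A"
    and sum: "\<And>e. e \<in> Eff A \<Longrightarrow> \<langle>e, \<rho>\<rangle> = \<langle>e, s\<^sub>1\<rangle> + \<langle>e, s\<^sub>2\<rangle>"
  have r0: "0 \<le> r" using r by simp
  note S1 = scaled_state[OF s(1) r0 r(2)] and S2 = scaled_state[OF s(2) r0 r(2)]
  obtain k where k: "\<And>e. e \<in> Eff A \<Longrightarrow> \<langle>e, s\<^sub>1 \<odot> num r\<rangle> = k * \<langle>e, s\<rangle>"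
    using pure_state_split[OF assms(1) S1(1) S2(1)] S1(2) S2(2) eq sum
    by (metis distrib_left)
  have "\<langle>e, s\<^sub>1\<rangle> = k * \<langle>e, \<rho>\<rangle>" if "e \<in> Eff A" for e
    using k[OF that] S1(2)[OF that] eq[OF that] r by simp
  then show "\<exists>k. \<forall>e\<in>Eff A. \<langle>e, s\<^sub>1\<rangle> = k * \<langle>e, \<rho>\<rangle>" by blast
qed

section \<open>Marginals of bipartite states and their conditional components\<close>

lemma cond_right_discard:
  assumes "\<Psi> \<in> NSt (A \<boxtimes> B)"
  shows "cond_right A (disc B) \<Psi> \<in> NSt A"
  using assms cond_right_state[OF _ discard_effect] pairing_cond_right[OF _ discard_effect discard_effect]
  by (simp add: normalised_states_def discard_par)

lemma cond_left_discard:
  assumes "\<Psi> \<in> NSt (A \<boxtimes> B)"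
  shows "cond_left B (disc A) \<Psi> \<in> NSt B"
  using assms cond_left_state[OF _ discard_effect] pairing_cond_left[OF _ discard_effect discard_effect]
  by (simp add: normalised_states_def discard_par)

lemma par_normalised:
  assumes "\<rho> \<in> NSt A" "\<sigma> \<in> NSt B"
  shows "\<rho> \<otimes> \<sigma> \<in> NSt (A \<boxtimes> B)"
  using channel_par[of \<I> A \<rho> \<I> B \<sigma>] assms by (simp add: normalised_iff_channel sys_unit)

lemma discard_seq_normalised: "\<rho> \<in> NSt A \<Longrightarrow> disc A \<odot> \<rho> = \<one> \<I>"
  using discard_seq_channel[of \<I> A \<rho>] discard_unique[OF ident_channel] by (simp add: normalised_iff_channel)

lemma marginal_par:
  assumes "\<rho> \<in> NSt A" "\<sigma> \<in> NSt B"
  shows "cond_right A (disc B) (\<rho> \<otimes> \<sigma>) = \<rho>" "cond_left B (disc A) (\<rho> \<otimes> \<sigma>) = \<sigma>"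
proof -
  have t: "\<rho> \<in> Tr \<I> A" "\<sigma> \<in> Tr \<I> B" using assms by (auto simp: normalised_states_def states_def)
  note s = normalised_state[OF assms(1)] normalised_state[OF assms(2)]
  note d = channel_transf[OF discard_channel]
  show "cond_right A (disc B) (\<rho> \<otimes> \<sigma>) = \<rho>"
    using seq_par_state[OF s ident_transf d] t assms
    by (simp add: cond_right_def discard_seq_normalised seq_ident par_unit)
  show "cond_left B (disc A) (\<rho> \<otimes> \<sigma>) = \<sigma>"
    using seq_par_state[OF s d ident_transf] t assms
    by (simp add: cond_left_def discard_seq_normalised seq_ident par_unit)
qed

lemma marginal_conv: "marginal \<Theta> A B \<Psi> = cond_right A (disc B) \<Psi>"
  by (simp add: marginal_def cond_right_def)

text \<open>The remainder is what the complementary effect prepares. Hence every conditional state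
  is a component of the marginal.\<close>

lemma cond_right_complement:
  assumes "\<Psi> \<in> St (A \<boxtimes> B)" "b \<in> Eff B"
  obtains R where "R \<in> St A"
    "\<And>e. e \<in> Eff A \<Longrightarrow> \<langle>e, cond_right A (disc B) \<Psi>\<rangle> = \<langle>e, cond_right A b \<Psi>\<rangle> + \<langle>e, R\<rangle>"
proof -
  obtain b' where b': "b' \<in> Eff B"
    "\<And>\<rho>. \<rho> \<in> St B \<Longrightarrow> \<langle>b, \<rho>\<rangle> + \<langle>b', \<rho>\<rangle> = \<langle>disc B, \<rho>\<rangle>"
    using effect_complement[OF assms(2)] by blast
  show ?thesis
  proof (rule that[of "cond_right A b' \<Psi>"])
    show "cond_right A b' \<Psi> \<in> St A" by (rule cond_right_state[OF assms(1) b'(1)])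
    fix e assume e: "e \<in> Eff A"
    show "\<langle>e, cond_right A (disc B) \<Psi>\<rangle> = \<langle>e, cond_right A b \<Psi>\<rangle> + \<langle>e, cond_right A b' \<Psi>\<rangle>"
      using b'(2)[OF cond_left_state[OF assms(1) e]] cond_swap[OF assms(1) e] assms(2) b'(1) discard_effect
      by simp
  qed
qed

lemma cond_left_complement:
  assumes "\<Psi> \<in> St (A \<boxtimes> B)" "a \<in> Eff A"
  obtains R where "R \<in> St B"
    "\<And>e. e \<in> Eff B \<Longrightarrow> \<langle>e, cond_left B (disc A) \<Psi>\<rangle> = \<langle>e, cond_left B a \<Psi>\<rangle> + \<langle>e, R\<rangle>"
  using cond_right_complement[OF swap_state[OF assms(1)] assms(2)] cond_right_swap[OF assms(1)] assms(2) discard_effect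
  by metis

section \<open>Fiducial effects and compactness\<close>

text \<open>Interpolate with the roles exchanged: the finitely many states spanning all others are
  the functions, and effects are the points. The nodes \<open>J\<close> then determine a state, with
  \<open>B\<close> as Lipschitz constant.\<close>

lemma fiducial_effects:
  obtains J B where "finite J" "J \<subseteq> Eff A"
    "\<And>\<sigma> \<tau> e. \<sigma> \<in> St A \<Longrightarrow> \<tau> \<in> St A \<Longrightarrow> e \<in> Eff A \<Longrightarrow>
      \<bar>\<langle>e, \<sigma>\<rangle> - \<langle>e, \<tau>\<rangle>\<bar> \<le> B * (\<Sum>j\<in>J. \<bar>\<langle>j, \<sigma>\<rangle> - \<langle>j, \<tau>\<rangle>\<bar>)"
proof -
  obtain F where F: "F \<subseteq> Tr \<I> A" "finite F"
    "\<And>C. C \<in> Tr \<I> A \<Longrightarrow> \<exists>c. lin_comb \<Theta> \<I> A C F c (\<lambda>D. D)"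
    using finite_dim[of \<I> A] by blast
  have "\<exists>B. \<forall>e\<in>Eff A. \<bar>\<langle>e, D\<rangle>\<bar> \<le> B" if "D \<in> F" for D
    using pairing_range[of _ A D] F(1) that by (intro exI[of _ 1]) (auto simp: states_def)
  then have "\<forall>D\<in>F. \<exists>B. \<forall>e\<in>Eff A. \<bar>\<langle>e, D\<rangle>\<bar> \<le> B" ..
  from finite_interpolation[OF F(2) this] obtain J g B where J: "finite J" "J \<subseteq> Eff A"
    and B: "\<forall>j\<in>J. \<forall>e\<in>Eff A. \<bar>g j e\<bar> \<le> B"
    and g: "\<forall>c. \<forall>e\<in>Eff A. (\<Sum>D\<in>F. c D * \<langle>e, D\<rangle>) = (\<Sum>j\<in>J. (\<Sum>D\<in>F. c D * \<langle>j, D\<rangle>) * g j e)"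
    by (elim exE conjE)
  have expand: "\<langle>e, \<sigma>\<rangle> = (\<Sum>j\<in>J. \<langle>j, \<sigma>\<rangle> * g j e)" if \<sigma>: "\<sigma> \<in> St A" and e: "e \<in> Eff A" for \<sigma> e
  proof -
    obtain c where c: "lin_comb \<Theta> \<I> A \<sigma> F c (\<lambda>D. D)" using F(3) \<sigma> by (auto simp: states_def)
    have "\<langle>e, \<sigma>\<rangle> = (\<Sum>j\<in>J. (\<Sum>D\<in>F. c D * \<langle>j, D\<rangle>) * g j e)"
      using lin_comb_statesD[OF c e] g[rule_format, OF e, of c] by (rule trans)
    also have "\<dots> = (\<Sum>j\<in>J. \<langle>j, \<sigma>\<rangle> * g j e)"
      using lin_comb_statesD[OF c] J(2) by (intro sum.cong refl) (auto simp: subset_iff)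
    finally show ?thesis .
  qed
  show ?thesis
  proof (rule that[OF J])
    fix \<sigma> \<tau> e assume *: "\<sigma> \<in> St A" "\<tau> \<in> St A" "e \<in> Eff A"
    have "\<langle>e, \<sigma>\<rangle> - \<langle>e, \<tau>\<rangle> = (\<Sum>j\<in>J. (\<langle>j, \<sigma>\<rangle> - \<langle>j, \<tau>\<rangle>) * g j e)"
      unfolding expand[OF *(1,3)] expand[OF *(2,3)] by (simp add: sum_subtractf left_diff_distrib)
    also have "\<bar>\<dots>\<bar> \<le> (\<Sum>j\<in>J. \<bar>(\<langle>j, \<sigma>\<rangle> - \<langle>j, \<tau>\<rangle>) * g j e\<bar>)" by (rule sum_abs)
    also have "\<dots> \<le> (\<Sum>j\<in>J. B * \<bar>\<langle>j, \<sigma>\<rangle> - \<langle>j, \<tau>\<rangle>\<bar>)"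
    proof (rule sum_mono)
      fix j assume "j \<in> J"
      then have "\<bar>g j e\<bar> \<le> B" using B *(3) by blast
      then show "\<bar>(\<langle>j, \<sigma>\<rangle> - \<langle>j, \<tau>\<rangle>) * g j e\<bar> \<le> B * \<bar>\<langle>j, \<sigma>\<rangle> - \<langle>j, \<tau>\<rangle>\<bar>"
        using mult_right_mono[of "\<bar>g j e\<bar>" B "\<bar>\<langle>j, \<sigma>\<rangle> - \<langle>j, \<tau>\<rangle>\<bar>"] by (simp add: abs_mult mult.commute)
    qed
    finally show "\<bar>\<langle>e, \<sigma>\<rangle> - \<langle>e, \<tau>\<rangle>\<bar> \<le> B * (\<Sum>j\<in>J. \<bar>\<langle>j, \<sigma>\<rangle> - \<langle>j, \<tau>\<rangle>\<bar>)"
      by (simp add: sum_distrib_left)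
  qed
qed

text \<open>States as points of a function space with the product topology. The value zero outside
  the effects makes the function depend on operational data only.\<close>

definition state_fun :: "'a \<Rightarrow> 'b \<Rightarrow> 'b \<Rightarrow> real" where
  "state_fun A \<sigma> = (\<lambda>e. if e \<in> Eff A then \<langle>e, \<sigma>\<rangle> else 0)"

text \<open>All statistics lie in a cube, which is compact by Tychonoff's theorem. Transformations
  form a closed subset by axiom, and normalisation is a closed condition on one coordinate.\<close>

lemma compact_normalised_states: "compact (state_fun A ` NSt A)"
proof -
  let ?S = "stats \<Theta> \<I> A ` Tr \<I> A"
  let ?pt = "\<lambda>e. (\<I>, \<one> \<I>, e)"
  have pt: "stats \<Theta> \<I> A s (?pt e) = \<langle>e, s\<rangle>" if "s \<in> St A" "e \<in> Eff A" for s e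
    using stats_triv[of s \<I> A, OF _ ident_triv_state that(2)] that(1) state_seq_ident
    by (simp add: states_def)
  have coord: "continuous_on UNIV (\<lambda>z::'a \<times> 'b \<times> 'b \<Rightarrow> real. z i)" for i
    by (rule continuous_on_product_coordinates)
  have "compact (PiE UNIV (\<lambda>_. {0..1}) :: ('a \<times> 'b \<times> 'b \<Rightarrow> real) set)"
    using compactin_PiE[of "\<lambda>_. euclidean" UNIV "\<lambda>_. {0..1::real}"]
    by (simp add: euclidean_product_topology)
  moreover have "?S \<subseteq> PiE UNIV (\<lambda>_. {0..1})"
  proof (clarsimp simp: PiE_UNIV_domain Pi_iff)
    fix s S \<rho> e assume s: "s \<in> Tr \<I> A"
    show "0 \<le> stats \<Theta> \<I> A s (S, \<rho>, e) \<and> stats \<Theta> \<I> A s (S, \<rho>, e) \<le> 1"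
      using pairing_range[OF _ seq_state[OF _ par_transf[OF s ident_transf]]]
      by (auto simp: stats_def)
  qed
  ultimately have "compact (PiE UNIV (\<lambda>_. {0..1}) \<inter> ?S)"
    using transf_closed by (intro compact_Int_closed) auto
  then have "compact ?S" using \<open>?S \<subseteq> _\<close> by (simp add: Int_absorb1)
  moreover have "closed {z :: 'a \<times> 'b \<times> 'b \<Rightarrow> real. z (?pt (disc A)) = 1}"
    by (rule closed_Collect_eq[OF coord continuous_on_const])
  ultimately have c: "compact (?S \<inter> {z. z (?pt (disc A)) = 1})"
    by (rule compact_Int_closed)
  have N: "?S \<inter> {z. z (?pt (disc A)) = 1} = stats \<Theta> \<I> A ` NSt A"
    using pt[OF _ discard_effect] by (auto simp: normalised_states_def states_def)
  \<comment> \<open>Keep only the coordinates with trivial reference system and trivial input. This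
    map is continuous, so compactness passes to functions on effects.\<close>
  let ?f = "\<lambda>z::'a \<times> 'b \<times> 'b \<Rightarrow> real. \<lambda>e. if e \<in> Eff A then z (?pt e) else 0"
  have "continuous_on UNIV ?f"
  proof (rule continuous_on_coordinatewise_then_product)
    fix e show "continuous_on UNIV (\<lambda>z. ?f z e)"
      by (cases "e \<in> Eff A") (simp_all add: coord)
  qed
  then have "compact (?f ` stats \<Theta> \<I> A ` NSt A)"
    using c unfolding N by (intro compact_continuous_image) (auto intro: continuous_on_subset)
  moreover have "?f ` stats \<Theta> \<I> A ` NSt A = state_fun A ` NSt A"
    unfolding image_image using pt normalised_state by (intro image_cong refl) (auto simp: state_fun_def)
  ultimately show ?thesis by simp
qed

section \<open>Reversible channels and a state invariant under them\<close>

lemma reversible_channel: "Rev A B U \<Longrightarrow> Ch A B U"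
  by (simp add: reversible_def)

lemma reversible_seq:
  assumes "Rev A B U" "Rev B C V"
  shows "Rev A C (V \<odot> U)"
proof -
  obtain U' where U': "Ch B A U'" "U' \<odot> U = \<one> A" "U \<odot> U' = \<one> B" using assms by (auto simp: reversible_def)
  obtain V' where V': "Ch C B V'" "V' \<odot> V = \<one> B" "V \<odot> V' = \<one> C" using assms by (auto simp: reversible_def)
  have ch: "Ch A B U" "Ch B C V" using assms by (auto simp: reversible_def)
  note t = channel_transf[OF ch(1)] channel_transf[OF ch(2)] channel_transf[OF U'(1)] channel_transf[OF V'(1)]
  have "(U' \<odot> V') \<odot> (V \<odot> U) = U' \<odot> (V' \<odot> (V \<odot> U))"
    by (rule seq_assoc[OF seq_transf[OF t(1,2)] t(4,3)])
  also have "\<dots> = \<one> A" using seq_assoc[OF t(1,2,4)] V'(2) U'(2) seq_ident(2)[OF t(1)] by simp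
  finally have 1: "(U' \<odot> V') \<odot> (V \<odot> U) = \<one> A" .
  have "(V \<odot> U) \<odot> (U' \<odot> V') = V \<odot> (U \<odot> (U' \<odot> V'))"
    by (rule seq_assoc[OF seq_transf[OF t(4,3)] t(1,2)])
  also have "\<dots> = \<one> C" using seq_assoc[OF t(4,3,1)] V'(3) U'(3) seq_ident(2)[OF t(4)] by simp
  finally have "(V \<odot> U) \<odot> (U' \<odot> V') = \<one> C" .
  with 1 show ?thesis
    using channel_seq[OF ch] channel_seq[OF V'(1) U'(1)] unfolding reversible_def by blast
qed

lemma reversible_inverse:
  assumes "Rev A B U"
  obtains V where "Rev B A V" "V \<odot> U = \<one> A" "U \<odot> V = \<one> B"
  using assms unfolding reversible_def by blast

lemma reversible_ident: "Rev A A (\<one> A)"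
  unfolding reversible_def using ident_channel seq_ident[OF ident_transf] by metis

lemma midpoint:
  assumes "\<sigma> \<in> NSt A" "\<tau> \<in> NSt A"
  obtains \<mu> where "\<mu> \<in> NSt A"
    "\<And>e. e \<in> Eff A \<Longrightarrow> \<langle>e, \<mu>\<rangle> = (\<langle>e, \<sigma>\<rangle> + \<langle>e, \<tau>\<rangle>) / 2"
proof (rule mixture[of "{0,1}" "\<lambda>i. if i = 0 then \<sigma> else \<tau>" A "\<lambda>_. 1/2"])
  show "(if i = 0 then \<sigma> else \<tau>) \<in> NSt A" for i :: nat using assms by simp
  fix \<rho> assume *: "\<rho> \<in> NSt A"
    "\<And>e. e \<in> Eff A \<Longrightarrow> \<langle>e, \<rho>\<rangle> = (\<Sum>i\<in>{0,1::nat}. 1/2 * \<langle>e, if i = 0 then \<sigma> else \<tau>\<rangle>)"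
  show thesis by (rule that[OF *(1)]) (simp add: *(2) add_divide_distrib)
qed simp_all

lemma reversible_swap: "Rev (A \<boxtimes> B) (B \<boxtimes> A) (\<gamma> A B)"
  unfolding reversible_def using swap_channel swap_inverse by blast

text \<open>On the functions \<open>state_fun A \<sigma>\<close> a reversible channel acts by
  precomposition with a map of effects, which is the form of action in
  \<open>invariant_point_exists\<close>.\<close>

lemma invariant_state_exists:
  assumes "NSt A \<noteq> {}"
  shows "\<exists>\<chi>\<in>NSt A. \<forall>U. Rev A A U \<longrightarrow> U \<odot> \<chi> = \<chi>"
proof -
  \<comment> \<open>Outside the effects, where every \<open>state_fun A \<sigma>\<close> vanishes,
    the map is the identity. Composition is reversed:
    \<open>act U \<circ> act V = act (V \<odot> U)\<close>.\<close>
  define act where "act = (\<lambda>U e. if e \<in> Eff A then e \<odot> U else e)"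
  define G where "G = act ` {U. Rev A A U}"
  let ?K = "state_fun A ` NSt A"
  have act_fun: "state_fun A \<sigma> \<circ> act U = state_fun A (U \<odot> \<sigma>)"
    if "\<sigma> \<in> St A" "Ch A A U" for \<sigma> U
    using pairing_seq[OF that(1) channel_transf[OF that(2)]] seq_effect[OF channel_transf[OF that(2)]]
    by (auto simp: state_fun_def act_def)
  obtain J B where J: "finite J" "J \<subseteq> Eff A"
    and bnd: "\<And>\<sigma> \<tau> e. \<sigma> \<in> St A \<Longrightarrow> \<tau> \<in> St A \<Longrightarrow> e \<in> Eff A \<Longrightarrow>
      \<bar>\<langle>e, \<sigma>\<rangle> - \<langle>e, \<tau>\<rangle>\<bar> \<le> B * (\<Sum>j\<in>J. \<bar>\<langle>j, \<sigma>\<rangle> - \<langle>j, \<tau>\<rangle>\<bar>)"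
    using fiducial_effects[of A] by blast
  have "\<exists>s\<in>?K. \<forall>\<phi>\<in>G. s \<circ> \<phi> = s"
  proof (rule invariant_point_exists)
    show "compact ?K" by (rule compact_normalised_states)
    show "?K \<noteq> {}" using assms by simp
    show "G \<noteq> {}" using reversible_ident by (auto simp: G_def)
  next
    fix s t assume "s \<in> ?K" "t \<in> ?K"
    then obtain \<sigma> \<tau> where *: "\<sigma> \<in> NSt A" "\<tau> \<in> NSt A"
      "s = state_fun A \<sigma>" "t = state_fun A \<tau>" by blast
    obtain \<mu> where \<mu>: "\<mu> \<in> NSt A"
      "\<And>e. e \<in> Eff A \<Longrightarrow> \<langle>e, \<mu>\<rangle> = (\<langle>e, \<sigma>\<rangle> + \<langle>e, \<tau>\<rangle>) / 2"
      using midpoint[OF *(1,2)] by blast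
    have "(\<lambda>e. (s e + t e) / 2) = state_fun A \<mu>"
      using \<mu>(2) by (auto simp: * state_fun_def)
    then show "(\<lambda>e. (s e + t e) / 2) \<in> ?K" using \<mu>(1) by blast
    \<comment> \<open>\<open>B\<close> may be negative, but outside the effects the left side is
      zero, so the bound has to be non-negative there.\<close>
    show "\<bar>s e - t e\<bar> \<le> max B 0 * (\<Sum>j\<in>J. \<bar>s j - t j\<bar>)" for e
    proof (cases "e \<in> Eff A")
      case True
      have "(\<Sum>j\<in>J. \<bar>s j - t j\<bar>) = (\<Sum>j\<in>J. \<bar>\<langle>j, \<sigma>\<rangle> - \<langle>j, \<tau>\<rangle>\<bar>)"
        using J(2) by (intro sum.cong refl) (auto simp: * state_fun_def)
      moreover have "B * (\<Sum>j\<in>J. \<bar>\<langle>j, \<sigma>\<rangle> - \<langle>j, \<tau>\<rangle>\<bar>) \<le> max B 0 * (\<Sum>j\<in>J. \<bar>\<langle>j, \<sigma>\<rangle> - \<langle>j, \<tau>\<rangle>\<bar>)"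
        by (intro mult_right_mono sum_nonneg) auto
      moreover have "\<bar>s e - t e\<bar> = \<bar>\<langle>e, \<sigma>\<rangle> - \<langle>e, \<tau>\<rangle>\<bar>" using True by (simp add: * state_fun_def)
      ultimately show ?thesis using bnd[OF normalised_state[OF *(1)] normalised_state[OF *(2)] True] by simp
    next
      case False
      have "0 \<le> max B 0 * (\<Sum>j\<in>J. \<bar>s j - t j\<bar>)" by (intro mult_nonneg_nonneg sum_nonneg) auto
      then show ?thesis using False by (simp add: * state_fun_def)
    qed
  next
    fix s \<phi> assume "s \<in> ?K" "\<phi> \<in> G"
    then obtain \<sigma> U where *: "\<sigma> \<in> NSt A" "s = state_fun A \<sigma>"
      "Rev A A U" "\<phi> = act U" by (auto simp: G_def)
    then show "s \<circ> \<phi> \<in> ?K"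
      using act_fun[OF normalised_state[OF *(1)] reversible_channel[OF *(3)]]
        channel_normalised[OF reversible_channel[OF *(3)] *(1)] by simp
  next
    fix \<phi> \<psi> assume "\<phi> \<in> G" "\<psi> \<in> G"
    then obtain U V where *: "Rev A A U" "\<phi> = act U" "Rev A A V" "\<psi> = act V"
      by (auto simp: G_def)
    have t: "U \<in> Tr A A" "V \<in> Tr A A" using * by (auto intro: channel_transf reversible_channel)
    have "\<phi> \<circ> \<psi> = act (V \<odot> U)"
    proof
      fix e show "(\<phi> \<circ> \<psi>) e = act (V \<odot> U) e"
        using seq_assoc[OF t, of e \<I>] seq_effect[OF t(2), of e] by (simp add: * act_def effects_def)
    qed
    then show "\<phi> \<circ> \<psi> \<in> G" using reversible_seq[OF *(1,3)] by (simp add: G_def)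
  next
    fix \<phi> assume "\<phi> \<in> G"
    then obtain U where *: "Rev A A U" "\<phi> = act U" by (auto simp: G_def)
    obtain V where V: "Rev A A V" "V \<odot> U = \<one> A" using reversible_inverse[OF *(1)] by blast
    have "s \<circ> \<phi> \<circ> act V = s" if s: "s \<in> ?K" for s
    proof -
      obtain \<sigma> where \<sigma>: "\<sigma> \<in> NSt A" "s = state_fun A \<sigma>" using s by blast
      have "s \<circ> \<phi> \<circ> act V = state_fun A (V \<odot> (U \<odot> \<sigma>))"
        using act_fun[OF normalised_state[OF \<sigma>(1)] reversible_channel[OF *(1)]]
          act_fun[OF normalised_state[OF channel_normalised[OF reversible_channel[OF *(1)] \<sigma>(1)]] reversible_channel[OF V(1)]]
        by (simp add: \<sigma> *)
      moreover have "V \<odot> (U \<odot> \<sigma>) = \<sigma>"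
        using seq_assoc[of \<sigma> \<I> A U A V A] V channel_transf[OF reversible_channel] * normalised_state[OF \<sigma>(1)]
          seq_ident(2)[of \<sigma> \<I> A] by (simp add: states_def)
      ultimately show ?thesis by (simp add: \<sigma>)
    qed
    then show "\<exists>\<psi>\<in>G. \<forall>s\<in>?K. s \<circ> \<phi> \<circ> \<psi> = s" using V(1) by (auto simp: G_def)
  qed
  then obtain \<chi> where \<chi>: "\<chi> \<in> NSt A" "\<And>\<phi>. \<phi> \<in> G \<Longrightarrow> state_fun A \<chi> \<circ> \<phi> = state_fun A \<chi>" by blast
  have "U \<odot> \<chi> = \<chi>" if U: "Rev A A U" for U
  proof (rule state_eqI)
    note ch = reversible_channel[OF U]
    show "U \<odot> \<chi> \<in> St A" "\<chi> \<in> St A"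
      using normalised_state[OF \<chi>(1)] normalised_state[OF channel_normalised[OF ch \<chi>(1)]] by auto
    fix e assume e: "e \<in> Eff A"
    have "state_fun A (U \<odot> \<chi>) = state_fun A \<chi>"
      using act_fun[OF normalised_state[OF \<chi>(1)] ch] \<chi>(2)[of "act U"] U by (simp add: G_def)
    then show "\<langle>e, U \<odot> \<chi>\<rangle> = \<langle>e, \<chi>\<rangle>" using e by (metis state_fun_def)
  qed
  then show ?thesis using \<chi>(1) by blast
qed

end

section \<open>Consequences of purification\<close>

context sharp_theory_with_purification
begin

section \<open>Purity of identities and of reversible channels; transitivity on pure states\<close>

lemma pure_transf: "pure \<Theta> A B F \<Longrightarrow> F \<in> Tr A B"
  by (simp add: pure_def)

lemma pure_effect: "pure \<Theta> A \<I> a \<Longrightarrow> a \<in> Eff A"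
  by (simp add: pure_def effects_def)

lemma pure_states_normalised: "\<alpha> \<in> PSt A \<Longrightarrow> \<alpha> \<in> NSt A"
  and pure_states_pure: "\<alpha> \<in> PSt A \<Longrightarrow> pure \<Theta> \<I> A \<alpha>"
  by (simp_all add: pure_states_def)

lemma pure_states_state: "\<alpha> \<in> PSt A \<Longrightarrow> \<alpha> \<in> St A"
  by (simp add: pure_states_def normalised_states_def)

text \<open>An effect never exceeds the discarding effect, so a state detected with certainty is
  normalised.\<close>

lemma sharp_pure_effect:
  obtains a \<rho> where "pure \<Theta> A \<I> a" "\<rho> \<in> NSt A" "\<langle>a, \<rho>\<rangle> = 1"
proof -
  obtain a s where a: "pure \<Theta> A \<I> a" "s \<in> St A" "\<langle>a, s\<rangle> = 1" using pure_sharpness by blast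
  have "\<langle>disc A, s\<rangle> = 1"
    using effect_le_discard[OF pure_effect[OF a(1)] a(2)] pairing_range(2)[OF discard_effect a(2)] a(3) by simp
  then show ?thesis using that a by (simp add: normalised_states_def)
qed

lemma normalised_states_nonempty: "NSt A \<noteq> {}"
  using sharp_pure_effect[of A] by blast

lemma purify:
  assumes "\<rho> \<in> NSt A"
  obtains B \<Psi> where "\<Psi> \<in> PSt (A \<boxtimes> B)" "cond_right A (disc B) \<Psi> = \<rho>"
  using purification[OF assms] unfolding marginal_conv by blast

text \<open>No information without disturbance: on a purification, each term of a decomposition of the
  identity acts as a multiple of the identity.\<close>

lemma ident_split_local:
  assumes D: "Test A A X D" and Y: "Y \<subseteq> X" "i \<in> Y" and sum: "is_sum \<Theta> A A (\<one> A) Y D"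
    and \<rho>: "\<rho> \<in> NSt (A \<boxtimes> S)"
  obtains r where "\<And>e. e \<in> Eff (A \<boxtimes> S) \<Longrightarrow> \<langle>e, (D i \<otimes> \<one> S) \<odot> \<rho>\<rangle> = r * \<langle>e, \<rho>\<rangle>"
proof -
  obtain T \<Psi> where \<Psi>: "\<Psi> \<in> PSt ((A \<boxtimes> S) \<boxtimes> T)" "cond_right (A \<boxtimes> S) (disc T) \<Psi> = \<rho>"
    using purify[OF \<rho>] by blast
  \<comment> \<open>\<open>S\<close> and the purifying system \<open>T\<close> together serve as the
    reference system of \<open>A\<close>.\<close>
  let ?W = "S \<boxtimes> T"
  have W: "(A \<boxtimes> S) \<boxtimes> T = A \<boxtimes> ?W" by (rule sys_assoc)
  have \<Psi>W: "\<Psi> \<in> PSt (A \<boxtimes> ?W)" using \<Psi>(1) by (simp add: W)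
  note \<Psi>s = pure_states_state[OF \<Psi>W]
  have Dt: "D j \<in> Tr A A" if "j \<in> X" for j using transfI[OF D that] .
  have Ds: "(D j \<otimes> \<one> ?W) \<odot> \<Psi> \<in> St (A \<boxtimes> ?W)" if "j \<in> X" for j
    by (rule seq_state[OF \<Psi>s par_transf[OF Dt[OF that] ident_transf]])
  have t: "Test \<I> (A \<boxtimes> ?W) X (\<lambda>j. (D j \<otimes> \<one> ?W) \<odot> \<Psi>)"
    using channel_seq_test[OF _ test_par_channel[OF D ident_channel]] pure_states_normalised[OF \<Psi>W]
    by (simp add: normalised_iff_channel)
  have "is_sum \<Theta> \<I> (A \<boxtimes> ?W) \<Psi> Y (\<lambda>j. (D j \<otimes> \<one> ?W) \<odot> \<Psi>)"
    unfolding is_sum_def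
  proof (rule lin_comb_statesI)
    show "\<Psi> \<in> St (A \<boxtimes> ?W)" by (rule \<Psi>s)
    show "finite Y" using test_finite[OF D] Y(1) finite_subset by blast
    show "(D j \<otimes> \<one> ?W) \<odot> \<Psi> \<in> St (A \<boxtimes> ?W)" if "j \<in> Y" for j using Ds that Y by blast
    fix e assume e: "e \<in> Eff (A \<boxtimes> ?W)"
    have "stats \<Theta> A A (\<one> A) (?W, \<Psi>, e) = (\<Sum>j\<in>Y. 1 * stats \<Theta> A A (D j) (?W, \<Psi>, e))"
      using sum by (simp add: is_sum_def lin_comb_def)
    moreover have "\<one> (A \<boxtimes> ?W) \<odot> \<Psi> = \<Psi>" using \<Psi>s by (auto simp: states_def intro: seq_ident)
    ultimately show "\<langle>e, \<Psi>\<rangle> = (\<Sum>j\<in>Y. 1 * \<langle>e, (D j \<otimes> \<one> ?W) \<odot> \<Psi>\<rangle>)"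
      using e \<Psi>s by (simp add: stats_def par_ident)
  qed
  then have "is_multiple \<Theta> \<I> (A \<boxtimes> ?W) ((D i \<otimes> \<one> ?W) \<odot> \<Psi>) \<Psi>"
    using pure_states_pure[OF \<Psi>W] t Y unfolding pure_def by blast
  then obtain r where "lin_comb \<Theta> \<I> (A \<boxtimes> ?W) ((D i \<otimes> \<one> ?W) \<odot> \<Psi>) {()} (\<lambda>_. r) (\<lambda>_. \<Psi>)"
    by (auto simp: is_multiple_def)
  from lin_comb_statesD[OF this]
  have r: "\<langle>e, (D i \<otimes> \<one> ?W) \<odot> \<Psi>\<rangle> = r * \<langle>e, \<Psi>\<rangle>" if "e \<in> Eff (A \<boxtimes> ?W)" for e
    using that by simp
  have i: "i \<in> X" using Y by blast
  have DS: "D i \<otimes> \<one> S \<in> Tr (A \<boxtimes> S) (A \<boxtimes> S)" by (rule par_transf[OF Dt[OF i] ident_transf])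
  have assoc: "(D i \<otimes> \<one> S) \<otimes> \<one> T = D i \<otimes> \<one> ?W"
    using par_assoc[OF Dt[OF i] ident_transf ident_transf] by (simp add: par_ident)
  have \<Psi>AST: "\<Psi> \<in> St ((A \<boxtimes> S) \<boxtimes> T)" using \<Psi>s by (simp add: W)
  show ?thesis
  proof (rule that[of r])
    fix e assume e: "e \<in> Eff (A \<boxtimes> S)"
    have eu: "e \<otimes> disc T \<in> Eff (A \<boxtimes> ?W)" using par_effect[OF e discard_effect[of T]] unfolding W .
    have "(D i \<otimes> \<one> S) \<odot> \<rho> = cond_right (A \<boxtimes> S) (disc T) ((D i \<otimes> \<one> ?W) \<odot> \<Psi>)"
      using cond_right_local[OF \<Psi>AST discard_effect DS] by (simp add: \<Psi>(2) assoc)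
    moreover have "(D i \<otimes> \<one> ?W) \<odot> \<Psi> \<in> St ((A \<boxtimes> S) \<boxtimes> T)" using Ds[OF i] by (simp add: W)
    ultimately have "\<langle>e, (D i \<otimes> \<one> S) \<odot> \<rho>\<rangle> = \<langle>e \<otimes> disc T, (D i \<otimes> \<one> ?W) \<odot> \<Psi>\<rangle>"
      using pairing_cond_right[OF _ e discard_effect] by simp
    also have "\<dots> = r * \<langle>e, \<rho>\<rangle>"
      using r[OF eu] pairing_cond_right[OF \<Psi>AST e discard_effect] \<Psi>(2) by simp
    finally show "\<langle>e, (D i \<otimes> \<one> S) \<odot> \<rho>\<rangle> = r * \<langle>e, \<rho>\<rangle>" .
  qed
qed

text \<open>The factors from \<open>ident_split_local\<close> may still depend on the state;
  linearity makes them agree. Purity of identities lets Purity Preservation be applied to an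
  operation on one half of a composite.\<close>

lemma ident_pure: "pure \<Theta> A A (\<one> A)"
  unfolding pure_def
proof (intro conjI allI impI ballI; (elim conjE)?)
  show "\<one> A \<in> Tr A A" by (rule ident_transf)
  fix X D Y i
  assume Y: "Y \<subseteq> X" and D: "Test A A X D" and sum: "is_sum \<Theta> A A (\<one> A) Y D" and i: "i \<in> Y"
  note split = ident_split_local[OF D Y i sum]
  have Dt: "D i \<in> Tr A A" using transfI[OF D] Y i by blast
  define f where "f = (\<lambda>\<tau>. \<langle>disc A, D i \<odot> \<tau>\<rangle>)"
  have loc: "\<langle>e, D i \<odot> \<tau>\<rangle> = f \<tau> * \<langle>e, \<tau>\<rangle>" if \<tau>: "\<tau> \<in> NSt A" and e: "e \<in> Eff A" for \<tau> e
  proof -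
    obtain r where "\<And>e. e \<in> Eff (A \<boxtimes> \<I>) \<Longrightarrow> \<langle>e, (D i \<otimes> \<one> \<I>) \<odot> \<tau>\<rangle> = r * \<langle>e, \<tau>\<rangle>"
      using split[of \<tau> \<I>] \<tau> by (auto simp: sys_unit)
    then have r: "\<langle>e, D i \<odot> \<tau>\<rangle> = r * \<langle>e, \<tau>\<rangle>" if "e \<in> Eff A" for e
      using that par_unit(1)[OF Dt] by (simp add: sys_unit)
    then have "f \<tau> = r" using discard_effect normalised_discard[OF \<tau>] by (simp add: f_def)
    then show ?thesis using r e by simp
  qed
  \<comment> \<open>Applied to the midpoint of the two states, linearity gives \<open>(f \<tau> - f
    \<tau>') * (\<langle>e, \<tau>\<rangle> - \<langle>e, \<tau>'\<rangle>) = 0\<close> for all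
    effects, so different factors would force equal states.\<close>
  have const: "f \<tau> = f \<tau>'" if \<tau>: "\<tau> \<in> NSt A" "\<tau>' \<in> NSt A" for \<tau> \<tau>'
  proof (rule ccontr)
    assume neq: "f \<tau> \<noteq> f \<tau>'"
    obtain \<mu> where \<mu>: "\<mu> \<in> NSt A"
      "\<And>e. e \<in> Eff A \<Longrightarrow> \<langle>e, \<mu>\<rangle> = (\<langle>e, \<tau>\<rangle> + \<langle>e, \<tau>'\<rangle>) / 2"
      using midpoint[OF \<tau>] by blast
    have mix: "f \<mu> * (\<langle>e, \<tau>\<rangle> + \<langle>e, \<tau>'\<rangle>) = f \<tau> * \<langle>e, \<tau>\<rangle> + f \<tau>' * \<langle>e, \<tau>'\<rangle>" if e: "e \<in> Eff A" for e
    proof -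
      have "\<langle>e, D i \<odot> \<mu>\<rangle> = (\<langle>e, D i \<odot> \<tau>\<rangle> + \<langle>e, D i \<odot> \<tau>'\<rangle>) / 2"
        using \<mu>(2)[OF seq_effect[OF Dt e]] pairing_seq[OF _ Dt e] normalised_state \<mu>(1) \<tau> by simp
      then show ?thesis using loc[OF \<mu>(1) e] loc[OF \<tau>(1) e] loc[OF \<tau>(2) e] \<mu>(2)[OF e] by simp
    qed
    have "2 * f \<mu> = f \<tau> + f \<tau>'"
      using mix[OF discard_effect] normalised_discard \<tau> by simp
    then have f\<mu>: "f \<mu> = (f \<tau> + f \<tau>') / 2" by simp
    have "\<tau> = \<tau>'"
    proof (rule state_eqI)
      show "\<tau> \<in> St A" "\<tau>' \<in> St A" using \<tau> by (auto intro: normalised_state)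
      fix e assume "e \<in> Eff A"
      from mix[OF this] have "(f \<tau> - f \<tau>') * (\<langle>e, \<tau>\<rangle> - \<langle>e, \<tau>'\<rangle>) = 0"
        unfolding f\<mu> by (simp add: field_simps)
      then show "\<langle>e, \<tau>\<rangle> = \<langle>e, \<tau>'\<rangle>" using neq by simp
    qed
    then show False using neq by simp
  qed
  obtain \<tau>\<^sub>0 where \<tau>\<^sub>0: "\<tau>\<^sub>0 \<in> NSt A" using normalised_states_nonempty by blast
  \<comment> \<open>Discarding both output systems shows that the factor on a composite is the
    factor of the marginal on \<open>A\<close>, hence the constant.\<close>
  have loc2: "\<langle>e, (D i \<otimes> \<one> S) \<odot> \<rho>\<rangle> = f \<tau>\<^sub>0 * \<langle>e, \<rho>\<rangle>"
    if \<rho>: "\<rho> \<in> NSt (A \<boxtimes> S)" and e: "e \<in> Eff (A \<boxtimes> S)" for S \<rho> e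
  proof -
    obtain r where r: "\<And>e. e \<in> Eff (A \<boxtimes> S) \<Longrightarrow> \<langle>e, (D i \<otimes> \<one> S) \<odot> \<rho>\<rangle> = r * \<langle>e, \<rho>\<rangle>"
      using split[OF \<rho>] by blast
    have \<rho>s: "\<rho> \<in> St (A \<boxtimes> S)" by (rule normalised_state[OF \<rho>])
    have D\<rho>: "(D i \<otimes> \<one> S) \<odot> \<rho> \<in> St (A \<boxtimes> S)" by (rule seq_state[OF \<rho>s par_transf[OF Dt ident_transf]])
    have "r = \<langle>disc A \<otimes> disc S, (D i \<otimes> \<one> S) \<odot> \<rho>\<rangle>"
      using r[OF discard_effect] normalised_discard[OF \<rho>] by (simp add: discard_par)
    also have "\<dots> = f (cond_right A (disc S) \<rho>)"
      using pairing_cond_right[OF D\<rho> discard_effect discard_effect]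
        cond_right_local[OF \<rho>s discard_effect Dt] by (simp add: f_def)
    also have "\<dots> = f \<tau>\<^sub>0" by (rule const[OF cond_right_discard[OF \<rho>] \<tau>\<^sub>0])
    finally show ?thesis using r e by simp
  qed
  have "stats \<Theta> A A (D i) (S, \<rho>, e) = f \<tau>\<^sub>0 * stats \<Theta> A A (\<one> A) (S, \<rho>, e)" for S \<rho> e
  proof (cases "\<rho> \<in> St (A \<boxtimes> S) \<and> e \<in> Eff (A \<boxtimes> S)")
    case True
    then have \<rho>: "\<rho> \<in> St (A \<boxtimes> S)" and e: "e \<in> Eff (A \<boxtimes> S)" by auto
    have DS: "D i \<otimes> \<one> S \<in> Tr (A \<boxtimes> S) (A \<boxtimes> S)" by (rule par_transf[OF Dt ident_transf])
    have "\<one> (A \<boxtimes> S) \<odot> \<rho> = \<rho>" using \<rho> by (auto simp: states_def intro: seq_ident)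
    moreover have "\<langle>e, (D i \<otimes> \<one> S) \<odot> \<rho>\<rangle> = f \<tau>\<^sub>0 * \<langle>e, \<rho>\<rangle>"
    proof (cases "\<langle>disc (A \<boxtimes> S), \<rho>\<rangle> = 0")
      case True
      then show ?thesis
        using state_zero[OF \<rho> True] pairing_seq[OF \<rho> DS e] seq_effect[OF DS e] e by simp
    next
      case False
      then obtain \<rho>' where \<rho>': "\<rho>' \<in> NSt (A \<boxtimes> S)"
        "\<And>e. e \<in> Eff (A \<boxtimes> S) \<Longrightarrow> \<langle>e, \<rho>\<rangle> = \<langle>disc (A \<boxtimes> S), \<rho>\<rangle> * \<langle>e, \<rho>'\<rangle>"
        using normaliseE[OF \<rho>] by blast
      show ?thesis
        using \<rho>'(2)[OF e] \<rho>'(2)[OF seq_effect[OF DS e]] loc2[OF \<rho>'(1) e] pairing_seq[OF \<rho> DS e]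
          pairing_seq[OF normalised_state[OF \<rho>'(1)] DS e] by simp
    qed
    ultimately show ?thesis using True by (simp add: stats_def par_ident)
  next
    case False
    then show ?thesis by (auto simp: stats_def)
  qed
  then show "is_multiple \<Theta> A A (D i) (\<one> A)"
    unfolding is_multiple_def lin_comb_def using Dt ident_transf by (intro exI[of _ "f \<tau>\<^sub>0"]) auto
qed

text \<open>Followed by the inverse of \<open>U\<close>, a decomposition of \<open>U\<close> becomes
  one of the identity; applying \<open>U\<close> again carries the proportionality back.\<close>

lemma reversible_pure:
  assumes U: "Rev A B U"
  shows "pure \<Theta> A B U"
  unfolding pure_def
proof (intro conjI allI impI ballI; (elim conjE)?)
  have Ut: "U \<in> Tr A B" by (rule channel_transf[OF reversible_channel[OF U]])
  show "U \<in> Tr A B" by (rule Ut)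
  fix X D Y i
  assume Y: "Y \<subseteq> X" and D: "Test A B X D" and sum: "is_sum \<Theta> A B U Y D" and i: "i \<in> Y"
  obtain V where V: "Ch B A V" "V \<odot> U = \<one> A" "U \<odot> V = \<one> B" using U by (auto simp: reversible_def)
  note Vt = channel_transf[OF V(1)]
  have Dt: "D j \<in> Tr A B" if "j \<in> X" for j by (rule transfI[OF D that])
  have t: "Test A A X (\<lambda>j. V \<odot> D j)" by (rule test_seq_channel[OF D V(1)])
  have "stats \<Theta> A A (\<one> A) (S, \<rho>, e) = (\<Sum>j\<in>Y. stats \<Theta> A A (V \<odot> D j) (S, \<rho>, e))" for S \<rho> e
  proof (cases "e \<in> Eff (A \<boxtimes> S)")
    case True
    have "stats \<Theta> A A (\<one> A) (S, \<rho>, e) = stats \<Theta> A B U (S, \<rho>, e \<odot> (V \<otimes> \<one> S))"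
      using stats_seq[OF Ut Vt True] V(2) by simp
    also have "\<dots> = (\<Sum>j\<in>Y. stats \<Theta> A B (D j) (S, \<rho>, e \<odot> (V \<otimes> \<one> S)))"
      using sum by (simp add: is_sum_def lin_comb_def)
    also have "\<dots> = (\<Sum>j\<in>Y. stats \<Theta> A A (V \<odot> D j) (S, \<rho>, e))"
      using Y by (intro sum.cong refl) (use stats_seq[OF Dt Vt True] in auto)
    finally show ?thesis .
  next
    case False
    then show ?thesis by (simp add: stats_def)
  qed
  then have "is_sum \<Theta> A A (\<one> A) Y (\<lambda>j. V \<odot> D j)"
    using Y test_finite[OF D] finite_subset ident_transf transfI[OF t]
    by (auto simp: is_sum_def lin_comb_def)
  then have "is_multiple \<Theta> A A (V \<odot> D i) (\<one> A)"
    using ident_pure[of A] t Y i unfolding pure_def by blast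
  then obtain r where r: "\<And>z. stats \<Theta> A A (V \<odot> D i) z = r * stats \<Theta> A A (\<one> A) z"
    by (auto simp: is_multiple_def lin_comb_def)
  have i': "i \<in> X" using Y i by blast
  have DU: "U \<odot> (V \<odot> D i) = D i"
    using seq_assoc[OF Dt[OF i'] Vt Ut] V(3) seq_ident(2)[OF Dt[OF i']] by simp
  have "stats \<Theta> A B (D i) (S, \<rho>, e) = r * stats \<Theta> A B U (S, \<rho>, e)" for S \<rho> e
  proof (cases "e \<in> Eff (B \<boxtimes> S)")
    case True
    show ?thesis
      using stats_seq[OF seq_transf[OF Dt[OF i'] Vt] Ut True, of \<rho>] stats_seq[OF ident_transf[of A] Ut True, of \<rho>]
        r DU seq_ident(1)[OF Ut] by simp
  next
    case False
    then show ?thesis by (simp add: stats_def)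
  qed
  then show "is_multiple \<Theta> A B (D i) U"
    unfolding is_multiple_def lin_comb_def using Dt[OF i'] Ut by (intro exI[of _ r]) auto
qed

lemma reversible_pure_states:
  "Rev A B U \<Longrightarrow> \<alpha> \<in> PSt A \<Longrightarrow> U \<odot> \<alpha> \<in> PSt B"
  using purity_seq[OF pure_states_pure reversible_pure] channel_normalised[OF reversible_channel pure_states_normalised]
  by (simp add: pure_states_def)

lemma cond_left_pure:
  assumes "pure \<Theta> \<I> (A \<boxtimes> B) \<Psi>" "pure \<Theta> A \<I> a"
  shows "pure \<Theta> \<I> B (cond_left B a \<Psi>)"
  using purity_seq[OF assms(1) purity_par[OF assms(2) ident_pure[of B]]] by (simp add: cond_left_def sys_unit)

lemma cond_right_pure:
  assumes "pure \<Theta> \<I> (A \<boxtimes> B) \<Psi>" "pure \<Theta> B \<I> b"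
  shows "pure \<Theta> \<I> A (cond_right A b \<Psi>)"
  using purity_seq[OF assms(1) purity_par[OF ident_pure[of A] assms(2)]] by (simp add: cond_right_def sys_unit)

lemma par_pure_states:
  "\<alpha> \<in> PSt A \<Longrightarrow> \<beta> \<in> PSt B \<Longrightarrow> \<alpha> \<otimes> \<beta> \<in> PSt (A \<boxtimes> B)"
  using purity_par[of \<I> A \<alpha> \<I> B \<beta>] par_normalised[of \<alpha> A \<beta> B] by (simp add: pure_states_def sys_unit)

text \<open>Seen on \<open>\<I> \<boxtimes> A\<close>, both states purify
  \<open>\<one> \<I>\<close>, and uniqueness of purification supplies the reversible
  channel.\<close>

lemma pure_states_transitive:
  assumes "\<alpha> \<in> PSt A" "\<beta> \<in> PSt A"
  obtains U where "Rev A A U" "\<beta> = U \<odot> \<alpha>"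
proof -
  have m: "marginal \<Theta> \<I> A \<psi> = \<one> \<I>" if "\<psi> \<in> PSt A" for \<psi>
    using discard_seq_normalised[OF pure_states_normalised[OF that]]
      par_unit(2)[OF channel_transf[OF discard_channel[of A]]] by (simp add: marginal_def)
  have "\<alpha> \<in> PSt (\<I> \<boxtimes> A)" "\<beta> \<in> PSt (\<I> \<boxtimes> A)" using assms by (simp_all add: sys_unit)
  then obtain U where U: "Rev A A U" "\<beta> = (\<one> \<I> \<otimes> U) \<odot> \<alpha>"
    using purification_unique m[OF assms(1)] m[OF assms(2)] by metis
  then have "\<beta> = U \<odot> \<alpha>" using par_unit(2)[OF channel_transf[OF reversible_channel[OF U(1)]]] by simp
  then show ?thesis using that U by blast
qed

section \<open>Pure effects occurring with certainty\<close>

text \<open>The complement of a certain effect prepares a component of norm zero, so conditioning on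
  the effect changes nothing on the other side.\<close>

lemma certain_effect_cond:
  assumes \<Psi>: "\<Psi> \<in> NSt (A \<boxtimes> B)" and a: "a \<in> Eff A"
    and 1: "\<langle>a, cond_right A (disc B) \<Psi>\<rangle> = 1"
  shows "cond_left B a \<Psi> = cond_left B (disc A) \<Psi>"
proof (rule state_eqI)
  note \<Psi>s = normalised_state[OF \<Psi>]
  show "cond_left B a \<Psi> \<in> St B" by (rule cond_left_state[OF \<Psi>s a])
  show "cond_left B (disc A) \<Psi> \<in> St B" by (rule cond_left_state[OF \<Psi>s discard_effect])
  obtain R where R: "R \<in> St B"
    "\<And>e. e \<in> Eff B \<Longrightarrow> \<langle>e, cond_left B (disc A) \<Psi>\<rangle> = \<langle>e, cond_left B a \<Psi>\<rangle> + \<langle>e, R\<rangle>"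
    using cond_left_complement[OF \<Psi>s a] by blast
  have "\<langle>disc B, R\<rangle> = 0"
    using R(2)[OF discard_effect] normalised_discard[OF cond_left_discard[OF \<Psi>]]
      cond_swap[OF \<Psi>s a discard_effect] 1 by simp
  then show "\<langle>e, cond_left B a \<Psi>\<rangle> = \<langle>e, cond_left B (disc A) \<Psi>\<rangle>" if "e \<in> Eff B" for e
    using R(2)[OF that] state_zero[OF R(1) _ that] by simp
qed

text \<open>The marginal on \<open>B\<close> is also what the pure effect \<open>a\<close> prepares
  from a pure state, and this is pure by Purity Preservation.\<close>

lemma certain_effect_marginal_pure:
  assumes \<Psi>: "\<Psi> \<in> PSt (A \<boxtimes> B)" and a: "pure \<Theta> A \<I> a"
    and 1: "\<langle>a, cond_right A (disc B) \<Psi>\<rangle> = 1"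
  shows "cond_left B (disc A) \<Psi> \<in> PSt B"
  using cond_left_pure[OF pure_states_pure[OF \<Psi>] a] cond_left_discard[OF pure_states_normalised[OF \<Psi>]]
    certain_effect_cond[OF pure_states_normalised[OF \<Psi>] pure_effect[OF a] 1] by (simp add: pure_states_def)

text \<open>A pure state with a pure marginal is a product, because the product of the marginal with any
  pure state is a second purification.\<close>

lemma marginal_pure:
  assumes \<Psi>: "\<Psi> \<in> PSt (A \<boxtimes> B)" and \<alpha>: "\<alpha> \<in> PSt A"
    and \<beta>: "cond_left B (disc A) \<Psi> \<in> PSt B"
  shows "cond_right A (disc B) \<Psi> \<in> PSt A"
proof -
  let ?\<beta> = "cond_left B (disc A) \<Psi>"
  note \<Psi>s = pure_states_state[OF \<Psi>]
  have 1: "\<gamma> A B \<odot> \<Psi> \<in> PSt (B \<boxtimes> A)" by (rule reversible_pure_states[OF reversible_swap \<Psi>])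
  have 2: "?\<beta> \<otimes> \<alpha> \<in> PSt (B \<boxtimes> A)" by (rule par_pure_states[OF \<beta> \<alpha>])
  have "marginal \<Theta> B A (?\<beta> \<otimes> \<alpha>) = marginal \<Theta> B A (\<gamma> A B \<odot> \<Psi>)"
    using marginal_par(1)[OF pure_states_normalised[OF \<beta>] pure_states_normalised[OF \<alpha>]]
      cond_right_swap[OF \<Psi>s discard_effect] by (simp add: marginal_conv)
  then obtain U where U: "Rev A A U" "\<gamma> A B \<odot> \<Psi> = (\<one> B \<otimes> U) \<odot> (?\<beta> \<otimes> \<alpha>)"
    using purification_unique[OF 2 1] by blast
  have "\<one> B \<odot> ?\<beta> = ?\<beta>" using pure_states_state[OF \<beta>] by (auto simp: states_def intro: seq_ident)
  then have "\<gamma> A B \<odot> \<Psi> = ?\<beta> \<otimes> (U \<odot> \<alpha>)"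
    using U(2) seq_par_state[OF pure_states_state[OF \<beta>] pure_states_state[OF \<alpha>] ident_transf
      channel_transf[OF reversible_channel[OF U(1)]]] by simp
  then have "cond_right A (disc B) \<Psi> = U \<odot> \<alpha>"
    using cond_left_swap[OF \<Psi>s discard_effect]
      marginal_par(2)[OF pure_states_normalised[OF \<beta>] pure_states_normalised[OF reversible_pure_states[OF U(1) \<alpha>]]]
    by simp
  then show ?thesis using reversible_pure_states[OF U(1) \<alpha>] by simp
qed

text \<open>The state \<open>\<alpha>\<close> only witnesses that \<open>A\<close> has a pure state,
  which \<open>marginal_pure\<close> needs to form a product. \<open>pure_states_nonempty\<close>
  uses this version for a system where a witness is at hand, and then provides one for every
  system.\<close>

lemma certain_state_pure_if:
  assumes "\<alpha> \<in> PSt A" and a: "pure \<Theta> A \<I> a" and \<rho>: "\<rho> \<in> NSt A" "\<langle>a, \<rho>\<rangle> = 1"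
  shows "\<rho> \<in> PSt A"
proof -
  obtain B \<Psi> where \<Psi>: "\<Psi> \<in> PSt (A \<boxtimes> B)" "cond_right A (disc B) \<Psi> = \<rho>"
    using purify[OF \<rho>(1)] by blast
  then show ?thesis
    using marginal_pure[OF \<Psi>(1) assms(1)] certain_effect_marginal_pure[OF \<Psi>(1) a] \<rho>(2) by simp
qed

text \<open>Purification yields pure states of composites only. If \<open>\<Psi>\<close> purifies a
  state on which \<open>a\<close> is certain, its other marginal \<open>?\<beta>\<close> is pure. A
  pure effect certain on \<open>?\<beta>\<close>, obtained by rotating a sharp one, then prepares a
  pure state of \<open>A\<close> with probability 1.\<close>

lemma pure_states_nonempty: "PSt A \<noteq> {}"
proof -
  obtain a \<rho> where a: "pure \<Theta> A \<I> a" "\<rho> \<in> NSt A" "\<langle>a, \<rho>\<rangle> = 1"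
    using sharp_pure_effect by blast
  obtain B \<Psi> where \<Psi>: "\<Psi> \<in> PSt (A \<boxtimes> B)" "cond_right A (disc B) \<Psi> = \<rho>"
    using purify[OF a(2)] by blast
  let ?\<beta> = "cond_left B (disc A) \<Psi>"
  have \<beta>: "?\<beta> \<in> PSt B" using certain_effect_marginal_pure[OF \<Psi>(1) a(1)] a(3) \<Psi>(2) by simp
  obtain b \<tau> where b: "pure \<Theta> B \<I> b" "\<tau> \<in> NSt B" "\<langle>b, \<tau>\<rangle> = 1"
    using sharp_pure_effect by blast
  have "\<tau> \<in> PSt B" by (rule certain_state_pure_if[OF \<beta> b])
  then obtain U where U: "Rev B B U" "\<tau> = U \<odot> ?\<beta>" using pure_states_transitive[OF \<beta>] by blast
  have bU: "pure \<Theta> B \<I> (b \<odot> U)" by (rule purity_seq[OF reversible_pure[OF U(1)] b(1)])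
  have "\<langle>b \<odot> U, ?\<beta>\<rangle> = 1"
    using pairing_seq[OF pure_states_state[OF \<beta>] channel_transf[OF reversible_channel[OF U(1)]] pure_effect[OF b(1)]]
      U(2) b(3) by simp
  then have "\<langle>disc A, cond_right A (b \<odot> U) \<Psi>\<rangle> = 1"
    using cond_swap[OF pure_states_state[OF \<Psi>(1)] discard_effect pure_effect[OF bU]] by simp
  then have "cond_right A (b \<odot> U) \<Psi> \<in> PSt A"
    using cond_right_pure[OF pure_states_pure[OF \<Psi>(1)] bU]
      cond_right_state[OF pure_states_state[OF \<Psi>(1)] pure_effect[OF bU]]
    by (simp add: pure_states_def normalised_states_def)
  then show ?thesis by blast
qed

lemma certain_state_pure:
  assumes "pure \<Theta> A \<I> a" "\<rho> \<in> NSt A" "\<langle>a, \<rho>\<rangle> = 1"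
  shows "\<rho> \<in> PSt A"
  using pure_states_nonempty certain_state_pure_if[OF _ assms] by blast

text \<open>The effect is certain on the midpoint of the two states too. The midpoint is therefore
  pure, and its half \<open>\<rho>\<close> is proportional to it, hence equal to it by
  normalisation.\<close>

lemma certain_state_unique:
  assumes a: "pure \<Theta> A \<I> a" and \<rho>: "\<rho> \<in> NSt A" "\<langle>a, \<rho>\<rangle> = 1"
    and \<sigma>: "\<sigma> \<in> NSt A" "\<langle>a, \<sigma>\<rangle> = 1"
  shows "\<rho> = \<sigma>"
proof -
  obtain \<mu> where \<mu>: "\<mu> \<in> NSt A"
    "\<And>e. e \<in> Eff A \<Longrightarrow> \<langle>e, \<mu>\<rangle> = (\<langle>e, \<rho>\<rangle> + \<langle>e, \<sigma>\<rangle>) / 2"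
    using midpoint[OF \<rho>(1) \<sigma>(1)] by blast
  have "\<langle>a, \<mu>\<rangle> = 1" using \<mu>(2)[OF pure_effect[OF a]] \<rho> \<sigma> by simp
  then have pure: "pure \<Theta> \<I> A \<mu>" using certain_state_pure[OF a \<mu>(1)] pure_states_pure by blast
  have half: "0 \<le> (1/2::real)" "(1/2::real) \<le> 1" by auto
  note S = scaled_state[OF normalised_state[OF \<rho>(1)] half] scaled_state[OF normalised_state[OF \<sigma>(1)] half]
  obtain r where r: "\<And>e. e \<in> Eff A \<Longrightarrow> \<langle>e, \<rho> \<odot> num (1/2)\<rangle> = r * \<langle>e, \<mu>\<rangle>"
    using pure_state_split[OF pure S(1,3)] S(2,4) \<mu>(2) by (metis (no_types, lifting) add_divide_distrib mult_1 times_divide_eq_left)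
  have "r = 1/2" using r[OF discard_effect] S(2)[OF discard_effect] normalised_discard \<rho>(1) \<mu>(1) by simp
  then have eq: "\<langle>e, \<rho>\<rangle> = \<langle>e, \<mu>\<rangle>" if "e \<in> Eff A" for e using r[OF that] S(2)[OF that] by simp
  show ?thesis
  proof (rule state_eqI)
    show "\<rho> \<in> St A" "\<sigma> \<in> St A" using \<rho> \<sigma> by (auto intro: normalised_state)
    show "\<langle>e, \<rho>\<rangle> = \<langle>e, \<sigma>\<rangle>" if "e \<in> Eff A" for e using eq[OF that] \<mu>(2)[OF that] by simp
  qed
qed

text \<open>Some sharp effect is certain on some pure state; a reversible channel carrying
  \<open>\<alpha>\<close> to that state pulls the effect back.\<close>

lemma dual_effect_exists:
  assumes "\<alpha> \<in> PSt A"
  obtains a where "pure \<Theta> A \<I> a" "\<langle>a, \<alpha>\<rangle> = 1"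
proof -
  obtain a \<rho> where a: "pure \<Theta> A \<I> a" "\<rho> \<in> NSt A" "\<langle>a, \<rho>\<rangle> = 1"
    using sharp_pure_effect by blast
  obtain U where U: "Rev A A U" "\<rho> = U \<odot> \<alpha>"
    using pure_states_transitive[OF assms certain_state_pure[OF a]] by blast
  show ?thesis
  proof (rule that[of "a \<odot> U"])
    show "pure \<Theta> A \<I> (a \<odot> U)" by (rule purity_seq[OF reversible_pure[OF U(1)] a(1)])
    show "\<langle>a \<odot> U, \<alpha>\<rangle> = 1"
      using pairing_seq[OF pure_states_state[OF assms] channel_transf[OF reversible_channel[OF U(1)]] pure_effect[OF a(1)]]
        U(2) a(3) by simp
  qed
qed

text \<open>The effects dual to pure states: each is certain on exactly one normalised state, and
  that state is pure.\<close>

definition sharp_effects :: "'a \<Rightarrow> 'b set" where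
  "sharp_effects A = {a. pure \<Theta> A \<I> a \<and> (\<exists>\<rho>\<in>NSt A. \<langle>a, \<rho>\<rangle> = 1)}"

lemma sharp_effectE:
  assumes "a \<in> sharp_effects A"
  obtains \<alpha> where "\<alpha> \<in> PSt A" "\<langle>a, \<alpha>\<rangle> = 1"
  using assms certain_state_pure unfolding sharp_effects_def by blast

lemma sharp_effects_pure: "a \<in> sharp_effects A \<Longrightarrow> pure \<Theta> A \<I> a"
  by (simp add: sharp_effects_def)

lemma sharp_effects_effect: "a \<in> sharp_effects A \<Longrightarrow> a \<in> Eff A"
  by (rule pure_effect[OF sharp_effects_pure])

lemma dual_sharp_effect:
  assumes "\<alpha> \<in> PSt A"
  obtains a where "a \<in> sharp_effects A" "\<langle>a, \<alpha>\<rangle> = 1"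
  using dual_effect_exists[OF assms] pure_states_normalised[OF assms] unfolding sharp_effects_def by blast

lemma normalise_pureE:
  assumes s: "pure \<Theta> \<I> A s" and pos: "\<langle>disc A, s\<rangle> \<noteq> 0"
  obtains \<alpha> where "\<alpha> \<in> PSt A"
    "\<And>e. e \<in> Eff A \<Longrightarrow> \<langle>e, s\<rangle> = \<langle>disc A, s\<rangle> * \<langle>e, \<alpha>\<rangle>"
proof -
  have st: "s \<in> St A" using pure_transf[OF s] by (simp add: states_def)
  obtain \<alpha> where \<alpha>: "\<alpha> \<in> NSt A"
    "\<And>e. e \<in> Eff A \<Longrightarrow> \<langle>e, s\<rangle> = \<langle>disc A, s\<rangle> * \<langle>e, \<alpha>\<rangle>"
    using normaliseE[OF st pos] by blast
  have "pure \<Theta> \<I> A \<alpha>"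
    using pure_state_rescale[OF s normalised_state[OF \<alpha>(1)] _ _ \<alpha>(2)] pos pairing_range[OF discard_effect st] by simp
  then show ?thesis using that \<alpha> by (simp add: pure_states_def)
qed

text \<open>The states on which all sharp effects vanish form a face of the compact convex set of normalised
  states. A point of the face maximising a strictly convex function would be pure, hence detected by its dual.\<close>

lemma some_sharp_effect_positive:
  assumes \<rho>: "\<rho> \<in> NSt A"
  shows "\<exists>a\<in>sharp_effects A. 0 < \<langle>a, \<rho>\<rangle>"
proof (rule ccontr)
  assume "\<not> ?thesis"
  then have \<rho>0: "\<langle>a, \<rho>\<rangle> = 0" if "a \<in> sharp_effects A" for a
    using that pairing_range(1)[OF sharp_effects_effect normalised_state[OF \<rho>]] by force
  obtain J B where J: "finite J" "J \<subseteq> Eff A"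
    and bnd: "\<And>\<sigma> \<tau> e. \<sigma> \<in> St A \<Longrightarrow> \<tau> \<in> St A \<Longrightarrow> e \<in> Eff A \<Longrightarrow>
      \<bar>\<langle>e, \<sigma>\<rangle> - \<langle>e, \<tau>\<rangle>\<bar> \<le> B * (\<Sum>j\<in>J. \<bar>\<langle>j, \<sigma>\<rangle> - \<langle>j, \<tau>\<rangle>\<bar>)"
    using fiducial_effects[of A] by blast
  define Face where "Face = {\<sigma> \<in> NSt A. \<forall>a\<in>sharp_effects A. \<langle>a, \<sigma>\<rangle> = 0}"
  define Q where "Q = (\<lambda>z::'b \<Rightarrow> real. \<Sum>j\<in>J. (z j)\<^sup>2)"
  have "state_fun A ` Face = state_fun A ` NSt A \<inter> (\<Inter>a\<in>sharp_effects A. {z. z a = 0})"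
    using sharp_effects_effect[of _ A] by (auto simp: Face_def state_fun_def)
  moreover have "closed (\<Inter>a\<in>sharp_effects A. {z :: 'b \<Rightarrow> real. z a = 0})"
    by (intro closed_INT ballI closed_Collect_eq continuous_on_product_coordinates continuous_on_const)
  ultimately have "compact (state_fun A ` Face)"
    using compact_Int_closed[OF compact_normalised_states] by simp
  moreover have "state_fun A ` Face \<noteq> {}" using \<rho> \<rho>0 by (auto simp: Face_def)
  moreover have "continuous_on (state_fun A ` Face) Q"
    unfolding Q_def by (rule continuous_on_sum, rule continuous_on_power,
        rule continuous_on_subset[OF continuous_on_product_coordinates], simp)
  ultimately obtain \<tau> where \<tau>: "\<tau> \<in> Face" and max: "\<And>\<sigma>. \<sigma> \<in> Face \<Longrightarrow> Q (state_fun A \<sigma>) \<le> Q (state_fun A \<tau>)"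
    using continuous_attains_sup[of "state_fun A ` Face" Q] by auto
  have Qeq: "Q (state_fun A \<sigma>) = (\<Sum>j\<in>J. \<langle>j, \<sigma>\<rangle>\<^sup>2)" for \<sigma>
    unfolding Q_def using J(2) by (intro sum.cong refl) (auto simp: state_fun_def)
  have \<tau>N: "\<tau> \<in> NSt A" and \<tau>0: "\<And>a. a \<in> sharp_effects A \<Longrightarrow> \<langle>a, \<tau>\<rangle> = 0"
    using \<tau> by (auto simp: Face_def)
  have "pure \<Theta> \<I> A \<tau>"
  proof (rule pure_stateI[OF normalised_state[OF \<tau>N]])
    fix s t assume s: "s \<in> St A" and t: "t \<in> St A"
      and sum: "\<And>e. e \<in> Eff A \<Longrightarrow> \<langle>e, \<tau>\<rangle> = \<langle>e, s\<rangle> + \<langle>e, t\<rangle>"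
    define w where "w = \<langle>disc A, s\<rangle>"
    have wt: "\<langle>disc A, t\<rangle> = 1 - w" using sum[OF discard_effect] normalised_discard[OF \<tau>N] by (simp add: w_def)
    consider "w = 0" | "w = 1" | "0 < w" "w < 1"
      using pairing_range[OF discard_effect s] by (fastforce simp: w_def)
    then show "\<exists>r. \<forall>e\<in>Eff A. \<langle>e, s\<rangle> = r * \<langle>e, \<tau>\<rangle>"
    proof cases
      case 1
      then show ?thesis using state_zero[OF s] by (intro exI[of _ 0]) (simp add: w_def)
    next
      case 2
      then show ?thesis using state_zero[OF t] wt sum by (intro exI[of _ 1]) simp
    next
      case 3
      have "\<langle>disc A, s\<rangle> \<noteq> 0" using 3 by (simp add: w_def)
      then obtain \<sigma>\<^sub>1 where \<sigma>\<^sub>1: "\<sigma>\<^sub>1 \<in> NSt A" "\<And>e. e \<in> Eff A \<Longrightarrow> \<langle>e, s\<rangle> = w * \<langle>e, \<sigma>\<^sub>1\<rangle>"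
        using normaliseE[OF s] unfolding w_def by blast
      have "\<langle>disc A, t\<rangle> \<noteq> 0" using 3 wt by simp
      then obtain \<sigma>\<^sub>2 where \<sigma>\<^sub>2: "\<sigma>\<^sub>2 \<in> NSt A" "\<And>e. e \<in> Eff A \<Longrightarrow> \<langle>e, t\<rangle> = (1 - w) * \<langle>e, \<sigma>\<^sub>2\<rangle>"
        using normaliseE[OF t] unfolding wt by blast
      have comb: "\<langle>e, \<tau>\<rangle> = w * \<langle>e, \<sigma>\<^sub>1\<rangle> + (1 - w) * \<langle>e, \<sigma>\<^sub>2\<rangle>" if "e \<in> Eff A" for e
        using sum[OF that] \<sigma>\<^sub>1(2)[OF that] \<sigma>\<^sub>2(2)[OF that] by simp
      have "\<langle>a, \<sigma>\<^sub>1\<rangle> = 0 \<and> \<langle>a, \<sigma>\<^sub>2\<rangle> = 0" if a: "a \<in> sharp_effects A" for a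
      proof -
        note ae = sharp_effects_effect[OF a]
        have "0 \<le> w * \<langle>a, \<sigma>\<^sub>1\<rangle>" "0 \<le> (1 - w) * \<langle>a, \<sigma>\<^sub>2\<rangle>"
          using 3 pairing_range(1)[OF ae normalised_state] \<sigma>\<^sub>1(1) \<sigma>\<^sub>2(1) by simp_all
        then have "w * \<langle>a, \<sigma>\<^sub>1\<rangle> = 0" "(1 - w) * \<langle>a, \<sigma>\<^sub>2\<rangle> = 0" using comb[OF ae] \<tau>0[OF a] by linarith+
        then show ?thesis using 3 by simp
      qed
      then have F: "\<sigma>\<^sub>1 \<in> Face" "\<sigma>\<^sub>2 \<in> Face" using \<sigma>\<^sub>1(1) \<sigma>\<^sub>2(1) by (auto simp: Face_def)
      \<comment> \<open>Convexity of the square with its exact defect. At a maximiser of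
        \<open>Q\<close> on the face the defect must vanish, and agreement on the fiducial effects
        then makes both components equal.\<close>
      have "(\<Sum>j\<in>J. \<langle>j, \<tau>\<rangle>\<^sup>2) = (\<Sum>j\<in>J. w * \<langle>j, \<sigma>\<^sub>1\<rangle>\<^sup>2 + (1 - w) * \<langle>j, \<sigma>\<^sub>2\<rangle>\<^sup>2 - w * (1 - w) * (\<langle>j, \<sigma>\<^sub>1\<rangle> - \<langle>j, \<sigma>\<^sub>2\<rangle>)\<^sup>2)"
      proof (intro sum.cong refl)
        fix j assume "j \<in> J"
        then have "j \<in> Eff A" using J(2) by blast
        then show "\<langle>j, \<tau>\<rangle>\<^sup>2 = w * \<langle>j, \<sigma>\<^sub>1\<rangle>\<^sup>2 + (1 - w) * \<langle>j, \<sigma>\<^sub>2\<rangle>\<^sup>2 - w * (1 - w) * (\<langle>j, \<sigma>\<^sub>1\<rangle> - \<langle>j, \<sigma>\<^sub>2\<rangle>)\<^sup>2"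
          unfolding comb[OF \<open>j \<in> Eff A\<close>] power2_eq_square by (simp add: algebra_simps)
      qed
      also have "\<dots> = w * Q (state_fun A \<sigma>\<^sub>1) + (1 - w) * Q (state_fun A \<sigma>\<^sub>2) - w * (1 - w) * (\<Sum>j\<in>J. (\<langle>j, \<sigma>\<^sub>1\<rangle> - \<langle>j, \<sigma>\<^sub>2\<rangle>)\<^sup>2)"
        unfolding Qeq by (simp only: sum.distrib sum_subtractf sum_distrib_left)
      also have "\<dots> \<le> w * Q (state_fun A \<tau>) + (1 - w) * Q (state_fun A \<tau>) - w * (1 - w) * (\<Sum>j\<in>J. (\<langle>j, \<sigma>\<^sub>1\<rangle> - \<langle>j, \<sigma>\<^sub>2\<rangle>)\<^sup>2)"
        using 3 max F by (intro diff_right_mono add_mono mult_left_mono) auto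
      finally have "w * (1 - w) * (\<Sum>j\<in>J. (\<langle>j, \<sigma>\<^sub>1\<rangle> - \<langle>j, \<sigma>\<^sub>2\<rangle>)\<^sup>2) \<le> 0" by (simp add: Qeq algebra_simps)
      moreover have "0 < w * (1 - w)" using 3 by simp
      ultimately have "(\<Sum>j\<in>J. (\<langle>j, \<sigma>\<^sub>1\<rangle> - \<langle>j, \<sigma>\<^sub>2\<rangle>)\<^sup>2) \<le> 0" by (meson mult_pos_pos not_less)
      moreover have "0 \<le> (\<Sum>j\<in>J. (\<langle>j, \<sigma>\<^sub>1\<rangle> - \<langle>j, \<sigma>\<^sub>2\<rangle>)\<^sup>2)" by (intro sum_nonneg) simp
      ultimately have "(\<Sum>j\<in>J. (\<langle>j, \<sigma>\<^sub>1\<rangle> - \<langle>j, \<sigma>\<^sub>2\<rangle>)\<^sup>2) = 0" by simp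
      then have "\<forall>j\<in>J. (\<langle>j, \<sigma>\<^sub>1\<rangle> - \<langle>j, \<sigma>\<^sub>2\<rangle>)\<^sup>2 = 0" using J(1) by (subst (asm) sum_nonneg_eq_0_iff) auto
      then have "(\<Sum>j\<in>J. \<bar>\<langle>j, \<sigma>\<^sub>1\<rangle> - \<langle>j, \<sigma>\<^sub>2\<rangle>\<bar>) = 0" by (intro sum.neutral) simp
      then have eq: "\<langle>e, \<sigma>\<^sub>1\<rangle> = \<langle>e, \<sigma>\<^sub>2\<rangle>" if "e \<in> Eff A" for e
        using bnd[OF normalised_state[OF \<sigma>\<^sub>1(1)] normalised_state[OF \<sigma>\<^sub>2(1)] that] by simp
      have "\<langle>e, s\<rangle> = w * \<langle>e, \<tau>\<rangle>" if "e \<in> Eff A" for e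
        using \<sigma>\<^sub>1(2)[OF that] comb[OF that] eq[OF that] by (simp add: left_diff_distrib)
      then show ?thesis by blast
    qed
  qed
  then have "\<tau> \<in> PSt A" using \<tau>N by (simp add: pure_states_def)
  then obtain a where "a \<in> sharp_effects A" "\<langle>a, \<tau>\<rangle> = 1" using dual_sharp_effect by blast
  then show False using \<tau>0 by simp
qed

text \<open>On the purifying system \<open>a\<close> prepares a pure state \<open>\<beta>\<close>,
  and the dual \<open>b\<close> of \<open>\<beta>\<close> prepares in turn a pure component of
  \<open>\<rho>\<close>. Since \<open>b\<close> is certain once \<open>a\<close> has occurred, that
  component has all the probability of \<open>a\<close>, and \<open>a\<close> vanishes on the
  remainder.\<close>

lemma pure_component:
  assumes a: "pure \<Theta> A \<I> a" and \<rho>: "\<rho> \<in> NSt A" and pos: "0 < \<langle>a, \<rho>\<rangle>"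
  obtains \<alpha> R w where "\<alpha> \<in> PSt A" "R \<in> St A" "0 < w" "\<langle>a, \<rho>\<rangle> = w * \<langle>a, \<alpha>\<rangle>"
    "\<And>e. e \<in> Eff A \<Longrightarrow> \<langle>e, \<rho>\<rangle> = w * \<langle>e, \<alpha>\<rangle> + \<langle>e, R\<rangle>"
proof -
  obtain B \<Psi> where \<Psi>: "\<Psi> \<in> PSt (A \<boxtimes> B)" "cond_right A (disc B) \<Psi> = \<rho>"
    using purify[OF \<rho>] by blast
  note \<Psi>s = pure_states_state[OF \<Psi>(1)] and ae = pure_effect[OF a]
  define s where "s = cond_left B a \<Psi>"
  have s1: "\<langle>disc B, s\<rangle> = \<langle>a, \<rho>\<rangle>"
    using cond_swap[OF \<Psi>s ae discard_effect] \<Psi>(2) by (simp add: s_def)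
  obtain \<beta> where \<beta>: "\<beta> \<in> PSt B" "\<And>e. e \<in> Eff B \<Longrightarrow> \<langle>e, s\<rangle> = \<langle>a, \<rho>\<rangle> * \<langle>e, \<beta>\<rangle>"
    using normalise_pureE[OF cond_left_pure[OF pure_states_pure[OF \<Psi>(1)] a]] s1 pos
    unfolding s_def by (metis less_irrefl)
  obtain b where b: "b \<in> sharp_effects B" "\<langle>b, \<beta>\<rangle> = 1" using dual_sharp_effect[OF \<beta>(1)] by blast
  note be = sharp_effects_effect[OF b(1)]
  define t where "t = cond_right A b \<Psi>"
  have ts: "t \<in> St A" unfolding t_def by (rule cond_right_state[OF \<Psi>s be])
  have at: "\<langle>a, t\<rangle> = \<langle>a, \<rho>\<rangle>"
    using cond_swap[OF \<Psi>s ae be] \<beta>(2)[OF be] b(2) by (simp add: t_def s_def)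
  then have t1: "\<langle>disc A, t\<rangle> > 0" using effect_le_discard[OF ae ts] pos by simp
  obtain \<alpha> where \<alpha>: "\<alpha> \<in> PSt A" "\<And>e. e \<in> Eff A \<Longrightarrow> \<langle>e, t\<rangle> = \<langle>disc A, t\<rangle> * \<langle>e, \<alpha>\<rangle>"
    using normalise_pureE[OF cond_right_pure[OF pure_states_pure[OF \<Psi>(1)] sharp_effects_pure[OF b(1)]]] t1
    unfolding t_def by (metis less_irrefl)
  obtain R where R: "R \<in> St A" "\<And>e. e \<in> Eff A \<Longrightarrow> \<langle>e, \<rho>\<rangle> = \<langle>e, t\<rangle> + \<langle>e, R\<rangle>"
    using cond_right_complement[OF \<Psi>s be] unfolding \<Psi>(2) t_def by blast
  show ?thesis
  proof (rule that[OF \<alpha>(1) R(1) t1])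
    show "\<langle>a, \<rho>\<rangle> = \<langle>disc A, t\<rangle> * \<langle>a, \<alpha>\<rangle>" using at \<alpha>(2)[OF ae] by simp
    show "\<langle>e, \<rho>\<rangle> = \<langle>disc A, t\<rangle> * \<langle>e, \<alpha>\<rangle> + \<langle>e, R\<rangle>" if "e \<in> Eff A" for e
      using R(2)[OF that] \<alpha>(2)[OF that] by simp
  qed
qed

text \<open>Let \<open>\<beta>\<close> be the pure component from \<open>pure_component\<close>, of
  weight \<open>r * w\<close> in \<open>E\<close>, so
  \<open>q = r * w * \<langle>a, \<beta>\<rangle>\<close>. The dual effect of \<open>\<beta>\<close>
  has probability at least \<open>r * w\<close> and, by maximality, at most \<open>q\<close>. Hence
  \<open>a\<close> is certain on \<open>\<beta>\<close>, and
  \<open>\<beta> = \<alpha>\<close>.\<close>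

lemma maximal_weight_component:
  assumes E: "E \<in> St A" and a: "a \<in> sharp_effects A" and \<alpha>: "\<alpha> \<in> NSt A" "\<langle>a, \<alpha>\<rangle> = 1"
    and q: "\<langle>a, E\<rangle> = q" "0 < q" and le: "\<And>b. b \<in> sharp_effects A \<Longrightarrow> \<langle>b, E\<rangle> \<le> q"
  obtains R where "R \<in> St A" "\<And>e. e \<in> Eff A \<Longrightarrow> \<langle>e, E\<rangle> = q * \<langle>e, \<alpha>\<rangle> + \<langle>e, R\<rangle>"
proof -
  note ae = sharp_effects_effect[OF a]
  define r where "r = \<langle>disc A, E\<rangle>"
  have r: "0 < r" "r \<le> 1" using effect_le_discard[OF ae E] pairing_range(2)[OF discard_effect E] q by (auto simp: r_def)
  then obtain \<rho> where \<rho>: "\<rho> \<in> NSt A" "\<And>e. e \<in> Eff A \<Longrightarrow> \<langle>e, E\<rangle> = r * \<langle>e, \<rho>\<rangle>"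
    using normaliseE[OF E] unfolding r_def by (metis less_irrefl)
  have "r * \<langle>a, \<rho>\<rangle> = q" using \<rho>(2)[OF ae] q by simp
  then have "0 < r * \<langle>a, \<rho>\<rangle>" using q by simp
  then have pos: "0 < \<langle>a, \<rho>\<rangle>" using r by (simp add: zero_less_mult_iff)
  obtain \<beta> w R where \<beta>: "\<beta> \<in> PSt A" "R \<in> St A" "0 < w" "\<langle>a, \<rho>\<rangle> = w * \<langle>a, \<beta>\<rangle>"
    "\<And>e. e \<in> Eff A \<Longrightarrow> \<langle>e, \<rho>\<rangle> = w * \<langle>e, \<beta>\<rangle> + \<langle>e, R\<rangle>"
    using pure_component[OF sharp_effects_pure[OF a] \<rho>(1) pos] by blast
  have rw: "q = r * w * \<langle>a, \<beta>\<rangle>" using \<open>r * \<langle>a, \<rho>\<rangle> = q\<close> \<beta>(4) by simp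
  obtain b where b: "b \<in> sharp_effects A" "\<langle>b, \<beta>\<rangle> = 1" using dual_sharp_effect[OF \<beta>(1)] by blast
  note be = sharp_effects_effect[OF b(1)]
  have "r * w \<le> \<langle>b, E\<rangle>"
    using \<rho>(2)[OF be] \<beta>(5)[OF be] b(2) pairing_range(1)[OF be \<beta>(2)] r by simp
  then have "r * w \<le> r * w * \<langle>a, \<beta>\<rangle>" using le[OF b(1)] rw by simp
  moreover have rw0: "0 < r * w" using r \<beta>(3) by simp
  ultimately have "1 \<le> \<langle>a, \<beta>\<rangle>" by (metis mult.right_neutral mult_le_cancel_left_pos)
  then have a1: "\<langle>a, \<beta>\<rangle> = 1" using pairing_range(2)[OF ae pure_states_state[OF \<beta>(1)]] by simp
  then have "\<beta> = \<alpha>"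
    using certain_state_unique[OF sharp_effects_pure[OF a] pure_states_normalised[OF \<beta>(1)] _ \<alpha>] by simp
  moreover have "q = r * w" using rw a1 by simp
  moreover have r0: "0 \<le> r" using r by simp
  ultimately show ?thesis
    using that[OF scaled_state(1)[OF \<beta>(2) r0 r(2)]] scaled_state(2)[OF \<beta>(2) r0 r(2)] \<rho>(2) \<beta>(5)
    by (simp add: distrib_left)
qed

subsection \<open>Steering\<close>

lemma cond_right_par:
  assumes "\<Psi> \<in> St ((A \<boxtimes> B) \<boxtimes> C)" "b \<in> Eff B" "c \<in> Eff C"
  shows "cond_right A (b \<otimes> c) \<Psi> = cond_right A b (cond_right (A \<boxtimes> B) c \<Psi>)"
proof (rule state_eqI)
  have \<Psi>: "\<Psi> \<in> St (A \<boxtimes> (B \<boxtimes> C))" using assms(1) by (simp add: sys_assoc)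
  note bc = par_effect[OF assms(2,3)] and \<Psi>c = cond_right_state[OF assms(1,3)]
  show "cond_right A (b \<otimes> c) \<Psi> \<in> St A" by (rule cond_right_state[OF \<Psi> bc])
  show "cond_right A b (cond_right (A \<boxtimes> B) c \<Psi>) \<in> St A" by (rule cond_right_state[OF \<Psi>c assms(2)])
  fix a assume a: "a \<in> Eff A"
  have "(a \<otimes> b) \<otimes> c = a \<otimes> (b \<otimes> c)" using par_assoc[of a A \<I> b B \<I> c C \<I>] a assms by (simp add: effects_def)
  then show "\<langle>a, cond_right A (b \<otimes> c) \<Psi>\<rangle> = \<langle>a, cond_right A b (cond_right (A \<boxtimes> B) c \<Psi>)\<rangle>"
    using pairing_cond_right[OF \<Psi> a bc] pairing_cond_right[OF \<Psi>c a assms(2)]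
      pairing_cond_right[OF assms(1) par_effect[OF a assms(2)] assms(3)] by simp
qed

lemma remote_seq:
  assumes "\<Psi> \<in> St (A \<boxtimes> B)" "F \<in> Tr B C" "G \<in> Tr C D"
  shows "(\<one> A \<otimes> G) \<odot> ((\<one> A \<otimes> F) \<odot> \<Psi>) = (\<one> A \<otimes> (G \<odot> F)) \<odot> \<Psi>"
proof -
  have "(\<one> A \<otimes> G) \<odot> (\<one> A \<otimes> F) = \<one> A \<otimes> (G \<odot> F)"
    using interchange[OF ident_transf ident_transf assms(2,3)] seq_ident(1)[OF ident_transf] by simp
  then show ?thesis
    using seq_assoc[of \<Psi> \<I> "A \<boxtimes> B", OF _ par_transf[OF ident_transf assms(2)] par_transf[OF ident_transf assms(3)]] assms(1)
    by (simp add: states_def)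
qed

text \<open>Uniqueness of purification compares states with the same purifying system. Pad both
  states with a pure state to reach the common system \<open>A \<boxtimes> T\<close>. The channel
  adjoins the padding, applies the reversible channel and discards \<open>A\<close>.\<close>

lemma purifications_connected:
  assumes \<Phi>: "\<Phi> \<in> PSt (B \<boxtimes> A)" and \<Psi>: "\<Psi> \<in> PSt (B \<boxtimes> T)"
    and marg: "cond_right B (disc A) \<Phi> = cond_right B (disc T) \<Psi>"
  obtains C where "Ch A T C" "(\<one> B \<otimes> C) \<odot> \<Phi> = \<Psi>"
proof -
  obtain \<eta> where \<eta>: "\<eta> \<in> PSt T" using pure_states_nonempty by blast
  obtain \<zeta> where \<zeta>: "\<zeta> \<in> PSt A" using pure_states_nonempty by blast
  note \<Phi>s = pure_states_state[OF \<Phi>] and \<Psi>s = pure_states_state[OF \<Psi>]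
  note \<eta>t = pure_transf[OF pure_states_pure[OF \<eta>]] and \<Phi>t = pure_transf[OF pure_states_pure[OF \<Phi>]]
  note ut = channel_transf[OF discard_channel[of A]]
  let ?P = "\<Phi> \<otimes> \<eta>" and ?Q = "(\<one> B \<otimes> \<gamma> T A) \<odot> (\<Psi> \<otimes> \<zeta>)"
  have P: "?P \<in> PSt (B \<boxtimes> (A \<boxtimes> T))" using par_pure_states[OF \<Phi> \<eta>] by (simp add: sys_assoc)
  have \<Psi>\<zeta>: "\<Psi> \<otimes> \<zeta> \<in> PSt (B \<boxtimes> (T \<boxtimes> A))" using par_pure_states[OF \<Psi> \<zeta>] by (simp add: sys_assoc)
  have Q: "?Q \<in> PSt (B \<boxtimes> (A \<boxtimes> T))"
    using purity_seq[OF pure_states_pure[OF \<Psi>\<zeta>] purity_par[OF ident_pure reversible_pure[OF reversible_swap]]]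
      channel_normalised[OF channel_par[OF ident_channel swap_channel] pure_states_normalised[OF \<Psi>\<zeta>]]
    by (simp add: pure_states_def)
  have "cond_right B (disc (A \<boxtimes> T)) ?P = cond_right B (disc A) \<Phi>"
    using cond_right_par[OF pure_states_state[OF par_pure_states[OF \<Phi> \<eta>]] discard_effect discard_effect]
      marginal_par(1)[OF pure_states_normalised[OF \<Phi>] pure_states_normalised[OF \<eta>]]
    by (simp add: discard_par)
  moreover have "cond_right B (disc (A \<boxtimes> T)) ?Q = cond_right B (disc T) \<Psi>"
    using cond_right_remote[OF pure_states_state[OF \<Psi>\<zeta>] discard_effect channel_transf[OF swap_channel[of T A]]]
      cond_right_par[OF pure_states_state[OF par_pure_states[OF \<Psi> \<zeta>]] discard_effect discard_effect]
      marginal_par(1)[OF pure_states_normalised[OF \<Psi>] pure_states_normalised[OF \<zeta>]]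
      discard_seq_channel[OF swap_channel[of T A]]
    by (simp add: discard_par)
  ultimately have "marginal \<Theta> B (A \<boxtimes> T) ?P = marginal \<Theta> B (A \<boxtimes> T) ?Q"
    using marg by (simp add: marginal_conv)
  then obtain U where U: "Rev (A \<boxtimes> T) (A \<boxtimes> T) U" "?Q = (\<one> B \<otimes> U) \<odot> ?P"
    using purification_unique[OF P Q] by blast
  note Ut = channel_transf[OF reversible_channel[OF U(1)]]
  define E where "E = \<one> A \<otimes> \<eta>"
  define G where "G = disc A \<otimes> \<one> T"
  have Ec: "Ch A (A \<boxtimes> T) E"
    using channel_par[OF ident_channel[of A], of \<I> T \<eta>] pure_states_normalised[OF \<eta>]
    by (simp add: E_def sys_unit normalised_iff_channel)
  have Gc: "Ch (A \<boxtimes> T) T G"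
    using channel_par[OF discard_channel[of A] ident_channel[of T]] by (simp add: G_def sys_unit)
  note Et = channel_transf[OF Ec] and Gt = channel_transf[OF Gc]
  have "(\<one> B \<otimes> E) \<odot> \<Phi> = ?P"
  proof -
    have "\<one> B \<otimes> E = \<one> (B \<boxtimes> A) \<otimes> \<eta>"
      using par_assoc[OF ident_transf ident_transf \<eta>t, of B A] by (simp add: E_def par_ident)
    moreover have "(\<one> (B \<boxtimes> A) \<otimes> \<eta>) \<odot> \<Phi> = ?P"
      using interchange[OF \<Phi>t ident_transf ident_transf \<eta>t] seq_ident \<Phi>t \<eta>t par_unit(1)[OF \<Phi>t] by simp
    ultimately show ?thesis by simp
  qed
  moreover have "(\<one> B \<otimes> G) \<odot> ?Q = \<Psi>"
  proof -
    have t: "\<one> T \<otimes> disc A \<in> Tr (T \<boxtimes> A) T"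
      using par_transf[OF ident_transf ut, of T] by (simp add: sys_unit)
    have "G \<odot> \<gamma> T A = \<one> T \<otimes> disc A"
      using swap_natural[OF ident_transf[of T] ut] seq_ident(2)[OF t] by (simp add: swap_triv G_def)
    then have "(\<one> B \<otimes> G) \<odot> ?Q = (\<one> B \<otimes> (\<one> T \<otimes> disc A)) \<odot> (\<Psi> \<otimes> \<zeta>)"
      using remote_seq[OF pure_states_state[OF \<Psi>\<zeta>] channel_transf[OF swap_channel] Gt] by simp
    also have "\<dots> = cond_right (B \<boxtimes> T) (disc A) (\<Psi> \<otimes> \<zeta>)"
      using par_assoc[OF ident_transf ident_transf ut, of B T] by (simp add: cond_right_def par_ident)
    also have "\<dots> = \<Psi>"
      by (rule marginal_par(1)[OF pure_states_normalised[OF \<Psi>] pure_states_normalised[OF \<zeta>]])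
    finally show ?thesis .
  qed
  ultimately have "(\<one> B \<otimes> (G \<odot> (U \<odot> E))) \<odot> \<Phi> = \<Psi>"
    using remote_seq[OF \<Phi>s seq_transf[OF Et Ut] Gt] remote_seq[OF \<Phi>s Et Ut] U(2) by simp
  then show ?thesis
    using that channel_seq[OF channel_seq[OF Ec reversible_channel[OF U(1)]] Gc] by blast
qed

text \<open>Dilate the ensemble to a state \<open>\<Delta>\<close> of \<open>B \<boxtimes> S\<close>
  followed by a measurement of \<open>S\<close>, and purify \<open>\<Delta>\<close>. The result has
  the same marginal on \<open>B\<close> as \<open>\<Phi>\<close>, so a channel on \<open>A\<close>
  produces it from \<open>\<Phi>\<close>; the measurement is pulled back along that channel.\<close>

lemma steering:
  assumes \<Phi>: "\<Phi> \<in> PSt (A \<boxtimes> B)" and D: "Test \<I> B X D"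
    and sum: "\<And>f. f \<in> Eff B \<Longrightarrow> \<langle>f, cond_left B (disc A) \<Phi>\<rangle> = (\<Sum>k\<in>X. \<langle>f, D k\<rangle>)"
  obtains c where "Test A \<I> X c" "\<And>k. k \<in> X \<Longrightarrow> cond_left B (c k) \<Phi> = D k"
proof -
  note \<Phi>s = pure_states_state[OF \<Phi>]
  define \<Phi>' where "\<Phi>' = \<gamma> A B \<odot> \<Phi>"
  have \<Phi>': "\<Phi>' \<in> PSt (B \<boxtimes> A)" unfolding \<Phi>'_def by (rule reversible_pure_states[OF reversible_swap \<Phi>])
  obtain S \<Delta> e where \<Delta>: "Ch \<I> (B \<boxtimes> S) \<Delta>" and e: "Test S \<I> X e"
    and De: "\<And>k. k \<in> X \<Longrightarrow> D k = cond_right B (e k) \<Delta>"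
    using test_dilation[OF D] unfolding cond_right_def by blast
  have \<Delta>N: "\<Delta> \<in> NSt (B \<boxtimes> S)" using \<Delta> by (simp add: normalised_iff_channel)
  note \<Delta>s = normalised_state[OF \<Delta>N]
  have ee: "e k \<in> Eff S" if "k \<in> X" for k using transfI[OF e that] by (simp add: effects_def)
  obtain S' \<Psi> where \<Psi>: "\<Psi> \<in> PSt ((B \<boxtimes> S) \<boxtimes> S')" "cond_right (B \<boxtimes> S) (disc S') \<Psi> = \<Delta>"
    using purify[OF \<Delta>N] by blast
  have \<Psi>': "\<Psi> \<in> PSt (B \<boxtimes> (S \<boxtimes> S'))" using \<Psi>(1) by (simp add: sys_assoc)
  note cr = cond_right_par[OF pure_states_state[OF \<Psi>(1)] _ discard_effect]
  have "cond_right B (disc A) \<Phi>' = cond_right B (disc (S \<boxtimes> S')) \<Psi>"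
  proof (rule state_eqI)
    show "cond_right B (disc A) \<Phi>' \<in> St B"
      by (rule cond_right_state[OF pure_states_state[OF \<Phi>'] discard_effect])
    show "cond_right B (disc (S \<boxtimes> S')) \<Psi> \<in> St B"
      by (rule cond_right_state[OF pure_states_state[OF \<Psi>'] discard_effect])
    fix f assume f: "f \<in> Eff B"
    have "\<langle>f, cond_right B (disc A) \<Phi>'\<rangle> = (\<Sum>k\<in>X. \<langle>f, D k\<rangle>)"
      using sum[OF f] cond_right_swap[OF \<Phi>s discard_effect] by (simp add: \<Phi>'_def)
    also have "\<dots> = (\<Sum>k\<in>X. \<langle>e k, cond_left S f \<Delta>\<rangle>)"
      using De cond_swap[OF \<Delta>s f ee] by (intro sum.cong refl) simp
    also have "\<dots> = \<langle>disc S, cond_left S f \<Delta>\<rangle>"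
      by (rule test_sum_effect[OF e cond_left_state[OF \<Delta>s f]])
    also have "\<dots> = \<langle>f, cond_right B (disc S) \<Delta>\<rangle>" by (rule cond_swap[OF \<Delta>s f discard_effect])
    also have "cond_right B (disc S) \<Delta> = cond_right B (disc (S \<boxtimes> S')) \<Psi>"
      using cr[OF discard_effect] \<Psi>(2) by (simp add: discard_par)
    finally show "\<langle>f, cond_right B (disc A) \<Phi>'\<rangle> = \<langle>f, cond_right B (disc (S \<boxtimes> S')) \<Psi>\<rangle>" .
  qed
  then obtain C where C: "Ch A (S \<boxtimes> S') C" "(\<one> B \<otimes> C) \<odot> \<Phi>' = \<Psi>"
    using purifications_connected[OF \<Phi>' \<Psi>'] by blast
  have t: "Test (S \<boxtimes> S') \<I> X (\<lambda>k. e k \<otimes> disc S')"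
    using test_par_channel[OF e discard_channel[of S']] by (simp add: sys_unit)
  show ?thesis
  proof (rule that[of "\<lambda>k. (e k \<otimes> disc S') \<odot> C"])
    show "Test A \<I> X (\<lambda>k. (e k \<otimes> disc S') \<odot> C)" by (rule channel_seq_test[OF C(1) t])
    fix k assume k: "k \<in> X"
    have ek: "e k \<otimes> disc S' \<in> Eff (S \<boxtimes> S')" by (rule par_effect[OF ee[OF k] discard_effect])
    note Ct = channel_transf[OF C(1)]
    have "cond_left B ((e k \<otimes> disc S') \<odot> C) \<Phi> = cond_right B ((e k \<otimes> disc S') \<odot> C) \<Phi>'"
      unfolding \<Phi>'_def by (rule cond_right_swap[OF \<Phi>s seq_effect[OF Ct ek], symmetric])
    also have "\<dots> = cond_right B (e k \<otimes> disc S') \<Psi>"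
      using cond_right_remote[OF pure_states_state[OF \<Phi>'] ek Ct] C(2) by simp
    also have "\<dots> = D k" using cr[OF ee[OF k]] \<Psi>(2) De[OF k] by simp
    finally show "cond_left B ((e k \<otimes> disc S') \<odot> C) \<Phi> = D k" .
  qed
qed

section \<open>Pure maximal sets and the microcanonical state\<close>

definition invariant_state :: "'a \<Rightarrow> 'b \<Rightarrow> bool" where
  "invariant_state A \<chi> \<longleftrightarrow> \<chi> \<in> NSt A \<and> (\<forall>U. Rev A A U \<longrightarrow> U \<odot> \<chi> = \<chi>)"

lemma invariant_state_normalised: "invariant_state A \<chi> \<Longrightarrow> \<chi> \<in> NSt A"
  by (simp add: invariant_state_def)

text \<open>A pure component of \<open>\<chi>\<close> carrying all the probability of
  \<open>a\<close> has weight at least \<open>\<langle>a, \<chi>\<rangle>\<close>. By transitivity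
  it can be rotated to the state detected by \<open>b\<close>, and invariance of
  \<open>\<chi>\<close> keeps its weight.\<close>

lemma invariant_weight_le:
  assumes \<chi>: "invariant_state A \<chi>" and a: "a \<in> sharp_effects A" "0 < \<langle>a, \<chi>\<rangle>" and b: "b \<in> sharp_effects A"
  shows "\<langle>a, \<chi>\<rangle> \<le> \<langle>b, \<chi>\<rangle>"
proof -
  note be = sharp_effects_effect[OF b]
  note \<chi>s = normalised_state[OF invariant_state_normalised[OF \<chi>]]
  obtain \<alpha> R w where \<alpha>: "\<alpha> \<in> PSt A" "R \<in> St A" "0 < w" "\<langle>a, \<chi>\<rangle> = w * \<langle>a, \<alpha>\<rangle>"
    "\<And>e. e \<in> Eff A \<Longrightarrow> \<langle>e, \<chi>\<rangle> = w * \<langle>e, \<alpha>\<rangle> + \<langle>e, R\<rangle>"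
    using pure_component[OF sharp_effects_pure[OF a(1)] invariant_state_normalised[OF \<chi>] a(2)] by blast
  obtain \<beta> where \<beta>: "\<beta> \<in> PSt A" "\<langle>b, \<beta>\<rangle> = 1" using sharp_effectE[OF b] by blast
  obtain V where V: "Rev A A V" "\<beta> = V \<odot> \<alpha>" using pure_states_transitive[OF \<alpha>(1) \<beta>(1)] by blast
  note Vt = channel_transf[OF reversible_channel[OF V(1)]]
  have bV: "b \<odot> V \<in> Eff A" by (rule seq_effect[OF Vt be])
  have "\<langle>a, \<chi>\<rangle> \<le> w * 1"
    using \<alpha>(3,4) pairing_range(2)[OF sharp_effects_effect[OF a(1)] pure_states_state[OF \<alpha>(1)]]
    by (metis less_imp_le mult_left_mono)
  also have "w * 1 = w * \<langle>b \<odot> V, \<alpha>\<rangle>"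
    using pairing_seq[OF pure_states_state[OF \<alpha>(1)] Vt be] \<beta>(2) V(2) by simp
  also have "\<dots> \<le> \<langle>b \<odot> V, \<chi>\<rangle>" using \<alpha>(5)[OF bV] pairing_range(1)[OF bV \<alpha>(2)] by simp
  also have "\<dots> = \<langle>b, \<chi>\<rangle>" using pairing_seq[OF \<chi>s Vt be] \<chi> V(1) by (simp add: invariant_state_def)
  finally show ?thesis .
qed

lemma invariant_weight:
  assumes \<chi>: "invariant_state A \<chi>"
  obtains p where "0 < p" "\<And>a. a \<in> sharp_effects A \<Longrightarrow> \<langle>a, \<chi>\<rangle> = p"
proof -
  obtain a where a: "a \<in> sharp_effects A" "0 < \<langle>a, \<chi>\<rangle>"
    using some_sharp_effect_positive[OF invariant_state_normalised[OF \<chi>]] by blast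
  show ?thesis
  proof (rule that[OF a(2)])
    fix b assume b: "b \<in> sharp_effects A"
    have "\<langle>a, \<chi>\<rangle> \<le> \<langle>b, \<chi>\<rangle>" by (rule invariant_weight_le[OF \<chi> a b])
    moreover have "\<langle>b, \<chi>\<rangle> \<le> \<langle>a, \<chi>\<rangle>" using invariant_weight_le[OF \<chi> b _ a(1)] a(2) calculation by simp
    ultimately show "\<langle>b, \<chi>\<rangle> = \<langle>a, \<chi>\<rangle>" by simp
  qed
qed

text \<open>The purification \<open>\<Phi>\<close> of an invariant state pairs the pure states \<open>\<alpha> i\<close> of \<open>A\<close> with pure states
  \<open>\<beta> i\<close> of the purifying system \<open>B\<close>. The distinguishing test \<open>e\<close> on \<open>A\<close> splits the marginal on \<open>B\<close> into
  pieces containing \<open>\<beta> i\<close> with maximal weight; this transports back to orthogonality of the sharp effects \<open>a i\<close>.\<close>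

lemma distinguishable_pure_states_below_invariant:
  fixes \<alpha> :: "nat \<Rightarrow> 'b"
  assumes \<chi>: "invariant_state A \<chi>" and p: "0 < p" "\<And>a. a \<in> sharp_effects A \<Longrightarrow> \<langle>a, \<chi>\<rangle> = p"
    and \<alpha>: "\<And>i. i < n \<Longrightarrow> \<alpha> i \<in> PSt A"
    and e: "Test A \<I> {..<n} e" and e\<alpha>: "\<And>i j. i < n \<Longrightarrow> j < n \<Longrightarrow> \<langle>e i, \<alpha> j\<rangle> = (if i = j then 1 else 0)"
  obtains E c where "E \<in> St A"
    "\<And>f. f \<in> Eff A \<Longrightarrow> \<langle>f, \<chi>\<rangle> = p * (\<Sum>i<n. \<langle>f, \<alpha> i\<rangle>) + \<langle>f, E\<rangle>"
    "Test A \<I> {..n} c"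
    "\<And>i j. i < n \<Longrightarrow> j < n \<Longrightarrow> \<langle>c i, \<alpha> j\<rangle> = (if i = j then 1 else 0)" "\<And>i. i < n \<Longrightarrow> \<langle>c i, E\<rangle> = 0"
proof -
  have \<chi>N: "\<chi> \<in> NSt A" by (rule invariant_state_normalised[OF \<chi>])
  have ee: "e i \<in> Eff A" if "i < n" for i using transfI[OF e] that by (simp add: effects_def)
  obtain B \<Phi> where \<Phi>: "\<Phi> \<in> PSt (A \<boxtimes> B)" "cond_right A (disc B) \<Phi> = \<chi>"
    using purify[OF \<chi>N] by blast
  note \<Phi>s = pure_states_state[OF \<Phi>(1)] and \<Phi>p = pure_states_pure[OF \<Phi>(1)]
  define \<chi>B where "\<chi>B = cond_left B (disc A) \<Phi>"
  \<comment> \<open>Conditioning on \<open>b\<close> prepares a pure state of \<open>A\<close> that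
    is a component of \<open>\<chi>\<close> with weight \<open>\<langle>b, \<chi>B\<rangle>\<close>;
    its dual effect has probability only \<open>p\<close> on \<open>\<chi>\<close>.\<close>
  have weightB: "\<langle>b, \<chi>B\<rangle> \<le> p" if b: "b \<in> sharp_effects B" for b
  proof (cases "\<langle>b, \<chi>B\<rangle> = 0")
    case False
    note be = sharp_effects_effect[OF b]
    let ?t = "cond_right A b \<Phi>"
    have t1: "\<langle>disc A, ?t\<rangle> = \<langle>b, \<chi>B\<rangle>" using cond_swap[OF \<Phi>s discard_effect be] by (simp add: \<chi>B_def)
    then obtain \<alpha>' where \<alpha>': "\<alpha>' \<in> PSt A" "\<And>f. f \<in> Eff A \<Longrightarrow> \<langle>f, ?t\<rangle> = \<langle>b, \<chi>B\<rangle> * \<langle>f, \<alpha>'\<rangle>"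
      using normalise_pureE[OF cond_right_pure[OF \<Phi>p sharp_effects_pure[OF b]]] False by metis
    obtain a' where a': "a' \<in> sharp_effects A" "\<langle>a', \<alpha>'\<rangle> = 1" using dual_sharp_effect[OF \<alpha>'(1)] by blast
    note a'e = sharp_effects_effect[OF a'(1)]
    obtain R where R: "R \<in> St A" "\<And>f. f \<in> Eff A \<Longrightarrow> \<langle>f, \<chi>\<rangle> = \<langle>f, ?t\<rangle> + \<langle>f, R\<rangle>"
      using cond_right_complement[OF \<Phi>s be] unfolding \<Phi>(2) by blast
    show ?thesis
      using R(2)[OF a'e] \<alpha>'(2)[OF a'e] a'(2) p(2)[OF a'(1)] pairing_range(1)[OF a'e R(1)] by simp
  qed (use p in simp)
  have "\<exists>a. a \<in> sharp_effects A \<and> \<langle>a, \<alpha> i\<rangle> = 1" if "i < n" for i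
    using dual_sharp_effect[OF \<alpha>[OF that]] by blast
  then obtain a where a: "\<And>i. i < n \<Longrightarrow> a i \<in> sharp_effects A" "\<And>i. i < n \<Longrightarrow> \<langle>a i, \<alpha> i\<rangle> = 1" by metis
  note ae = sharp_effects_effect[OF a(1)]
  define s where "s = (\<lambda>i. cond_left B (a i) \<Phi>)"
  have ss: "s i \<in> St B" if "i < n" for i unfolding s_def by (rule cond_left_state[OF \<Phi>s ae[OF that]])
  have s1: "\<langle>disc B, s i\<rangle> = p" if "i < n" for i
    using cond_swap[OF \<Phi>s ae[OF that] discard_effect] \<Phi>(2) p(2)[OF a(1)[OF that]] by (simp add: s_def)
  have "\<exists>\<beta>. \<beta> \<in> PSt B \<and> (\<forall>f\<in>Eff B. \<langle>f, s i\<rangle> = p * \<langle>f, \<beta>\<rangle>)" if i: "i < n" for i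
    using normalise_pureE[OF cond_left_pure[OF \<Phi>p sharp_effects_pure[OF a(1)[OF i]]]] s1[OF i] p(1)
    unfolding s_def by (metis less_irrefl)
  then obtain \<beta> where \<beta>: "\<And>i. i < n \<Longrightarrow> \<beta> i \<in> PSt B"
    "\<And>i f. i < n \<Longrightarrow> f \<in> Eff B \<Longrightarrow> \<langle>f, s i\<rangle> = p * \<langle>f, \<beta> i\<rangle>" by metis
  have "\<exists>b. b \<in> sharp_effects B \<and> \<langle>b, \<beta> i\<rangle> = 1" if "i < n" for i
    using dual_sharp_effect[OF \<beta>(1)[OF that]] by blast
  then obtain b where b: "\<And>i. i < n \<Longrightarrow> b i \<in> sharp_effects B" "\<And>i. i < n \<Longrightarrow> \<langle>b i, \<beta> i\<rangle> = 1" by metis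
  note be = sharp_effects_effect[OF b(1)]
  have bs: "\<langle>b i, s i\<rangle> = p" if "i < n" for i using \<beta>(2)[OF that be[OF that]] b(2)[OF that] by simp
  have b\<chi>: "\<langle>b i, \<chi>B\<rangle> = p" if i: "i < n" for i
  proof -
    obtain R where R: "R \<in> St B" "\<And>f. f \<in> Eff B \<Longrightarrow> \<langle>f, \<chi>B\<rangle> = \<langle>f, s i\<rangle> + \<langle>f, R\<rangle>"
      using cond_left_complement[OF \<Phi>s ae[OF i]] unfolding \<chi>B_def s_def by blast
    show ?thesis
      using R(2)[OF be[OF i]] pairing_range(1)[OF be[OF i] R(1)] weightB[OF b(1)[OF i]] bs[OF i] by simp
  qed
  \<comment> \<open>Going back from \<open>b i\<close> returns \<open>\<alpha> i\<close>: the
    conditional state has norm \<open>p\<close>, and \<open>a i\<close> has the same probability on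
    it, so \<open>a i\<close> is certain after normalisation.\<close>
  have t\<alpha>: "\<langle>f, cond_right A (b i) \<Phi>\<rangle> = p * \<langle>f, \<alpha> i\<rangle>" if i: "i < n" and f: "f \<in> Eff A" for i f
  proof -
    let ?t = "cond_right A (b i) \<Phi>"
    have t1: "\<langle>disc A, ?t\<rangle> = p"
      using cond_swap[OF \<Phi>s discard_effect be[OF i]] b\<chi>[OF i] by (simp add: \<chi>B_def)
    have "\<langle>disc A, ?t\<rangle> \<noteq> 0" using t1 p(1) by simp
    then obtain \<tau> where \<tau>: "\<tau> \<in> NSt A" "\<And>f. f \<in> Eff A \<Longrightarrow> \<langle>f, ?t\<rangle> = p * \<langle>f, \<tau>\<rangle>"
      using normaliseE[OF cond_right_state[OF \<Phi>s be[OF i]]] unfolding t1 by blast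
    have "\<langle>a i, ?t\<rangle> = p" using cond_swap[OF \<Phi>s ae[OF i] be[OF i]] bs[OF i] by (simp add: s_def)
    then have "\<langle>a i, \<tau>\<rangle> = 1" using \<tau>(2)[OF ae[OF i]] p(1) by simp
    then have "\<tau> = \<alpha> i"
      using certain_state_unique[OF sharp_effects_pure[OF a(1)[OF i]] \<tau>(1)] a(2)[OF i]
        pure_states_normalised[OF \<alpha>[OF i]] by blast
    then show ?thesis using \<tau>(2)[OF f] by simp
  qed
  define E where "E = (\<lambda>i. cond_left B (e i) \<Phi>)"
  have Es: "E i \<in> St B" if "i < n" for i unfolding E_def by (rule cond_left_state[OF \<Phi>s ee[OF that]])
  have bE: "\<langle>b i, E j\<rangle> = (if j = i then p else 0)" if "i < n" "j < n" for i j
    using cond_swap[OF \<Phi>s ee[OF that(2)] be[OF that(1)]] t\<alpha>[OF that(1) ee[OF that(2)]] e\<alpha>[OF that(2,1)]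
    by (simp add: E_def)
  have Esum: "\<langle>f, \<chi>B\<rangle> = (\<Sum>i<n. \<langle>f, E i\<rangle>)" if f: "f \<in> Eff B" for f
  proof -
    have "(\<Sum>i<n. \<langle>f, E i\<rangle>) = (\<Sum>i<n. \<langle>e i, cond_right A f \<Phi>\<rangle>)"
      using cond_swap[OF \<Phi>s ee f] by (intro sum.cong refl) (simp add: E_def)
    also have "\<dots> = \<langle>f, \<chi>B\<rangle>"
      using test_sum_effect[OF e cond_right_state[OF \<Phi>s f]] cond_swap[OF \<Phi>s discard_effect f]
      by (simp add: \<chi>B_def)
    finally show ?thesis by simp
  qed
  \<comment> \<open>No sharp effect exceeds \<open>p\<close> on \<open>\<chi>B\<close>, hence none
    does on its piece \<open>E i\<close>, while \<open>b i\<close> attains \<open>p\<close> there.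
    So \<open>\<beta> i\<close> splits off from \<open>E i\<close> with weight
    \<open>p\<close>.\<close>
  have "\<exists>R. R \<in> St B \<and> (\<forall>f\<in>Eff B. \<langle>f, E i\<rangle> = p * \<langle>f, \<beta> i\<rangle> + \<langle>f, R\<rangle>)" if i: "i < n" for i
  proof -
    have le: "\<langle>f, E i\<rangle> \<le> p" if f: "f \<in> sharp_effects B" for f
    proof -
      note fe = sharp_effects_effect[OF f]
      have "\<langle>f, E i\<rangle> \<le> (\<Sum>i<n. \<langle>f, E i\<rangle>)"
        using i pairing_range(1)[OF fe Es] by (intro member_le_sum) auto
      then show ?thesis using Esum[OF fe] weightB[OF f] by simp
    qed
    have "\<langle>b i, E i\<rangle> = p" using bE[OF i i] by simp
    then obtain R where "R \<in> St B" "\<And>f. f \<in> Eff B \<Longrightarrow> \<langle>f, E i\<rangle> = p * \<langle>f, \<beta> i\<rangle> + \<langle>f, R\<rangle>"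
      using maximal_weight_component[OF Es[OF i] b(1)[OF i] pure_states_normalised[OF \<beta>(1)[OF i]] b(2)[OF i] _ p(1) le]
      by blast
    then show ?thesis by blast
  qed
  then obtain R where R: "\<And>i. i < n \<Longrightarrow> R i \<in> St B"
    "\<And>i f. i < n \<Longrightarrow> f \<in> Eff B \<Longrightarrow> \<langle>f, E i\<rangle> = p * \<langle>f, \<beta> i\<rangle> + \<langle>f, R i\<rangle>" by metis
  \<comment> \<open>For distinct indices \<open>b i\<close> has probability zero on
    \<open>E j\<close>, hence also on its component \<open>\<beta> j\<close>.\<close>
  have orthB: "\<langle>b i, \<beta> j\<rangle> = (if i = j then 1 else 0)" if ij: "i < n" "j < n" for i j
  proof (cases "i = j")
    case True
    then show ?thesis using b(2) ij by simp
  next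
    case False
    have "p * \<langle>b i, \<beta> j\<rangle> + \<langle>b i, R j\<rangle> = 0" using R(2)[OF ij(2) be[OF ij(1)]] bE[OF ij] False by simp
    moreover have "0 \<le> \<langle>b i, R j\<rangle>" by (rule pairing_range(1)[OF be[OF ij(1)] R(1)[OF ij(2)]])
    moreover have "0 \<le> p * \<langle>b i, \<beta> j\<rangle>"
      using p(1) pairing_range(1)[OF be[OF ij(1)] pure_states_state[OF \<beta>(1)[OF ij(2)]]] by simp
    ultimately have "p * \<langle>b i, \<beta> j\<rangle> = 0" by linarith
    then show ?thesis using p(1) False by simp
  qed
  have transport: "\<langle>f, \<alpha> i\<rangle> = (if i = j then 1 else 0)"
    if ij: "i < n" "j < n" and f: "f \<in> Eff A" "cond_left B f \<Phi> = s j" for f i j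
  proof -
    have "p * \<langle>f, \<alpha> i\<rangle> = \<langle>f, cond_right A (b i) \<Phi>\<rangle>" by (rule t\<alpha>[OF ij(1) f(1), symmetric])
    also have "\<dots> = \<langle>b i, s j\<rangle>" using cond_swap[OF \<Phi>s f(1) be[OF ij(1)]] f(2) by simp
    also have "\<dots> = p * \<langle>b i, \<beta> j\<rangle>" by (rule \<beta>(2)[OF ij(2) be[OF ij(1)]])
    finally have "p * \<langle>f, \<alpha> i\<rangle> = p * \<langle>b i, \<beta> j\<rangle>" .
    then show ?thesis using p(1) orthB[OF ij] by simp
  qed
  have orthA: "\<langle>a j, \<alpha> i\<rangle> = (if i = j then 1 else 0)" if "i < n" "j < n" for i j
    using transport[OF that ae[OF that(2)]] by (simp add: s_def)
  \<comment> \<open>Split off the \<open>\<alpha> i\<close> one at a time: by orthogonality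
    \<open>a m\<close> keeps the maximal probability \<open>p\<close> on what is left.\<close>
  have "\<exists>F\<in>St A. \<forall>f\<in>Eff A. \<langle>f, \<chi>\<rangle> = p * (\<Sum>i<m. \<langle>f, \<alpha> i\<rangle>) + \<langle>f, F\<rangle>" if "m \<le> n" for m
    using that
  proof (induction m)
    case 0
    then show ?case using normalised_state[OF \<chi>N] by auto
  next
    case (Suc m)
    then obtain F where F: "F \<in> St A"
      "\<And>f. f \<in> Eff A \<Longrightarrow> \<langle>f, \<chi>\<rangle> = p * (\<Sum>i<m. \<langle>f, \<alpha> i\<rangle>) + \<langle>f, F\<rangle>" by auto
    have m: "m < n" using Suc.prems by simp
    have "(\<Sum>i<m. \<langle>a m, \<alpha> i\<rangle>) = 0" using orthA[OF _ m] m by (intro sum.neutral) auto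
    then have w: "\<langle>a m, F\<rangle> = p" using F(2)[OF ae[OF m]] p(2)[OF a(1)[OF m]] by simp
    have le: "\<langle>f, F\<rangle> \<le> p" if f: "f \<in> sharp_effects A" for f
    proof -
      have "0 \<le> \<langle>f, \<alpha> i\<rangle>" if "i < m" for i
        using pairing_range(1)[OF sharp_effects_effect[OF f] pure_states_state[OF \<alpha>]] that m by simp
      then have "0 \<le> p * (\<Sum>i<m. \<langle>f, \<alpha> i\<rangle>)" using p(1) by (intro mult_nonneg_nonneg sum_nonneg) auto
      then show ?thesis using F(2)[OF sharp_effects_effect[OF f]] p(2)[OF f] by simp
    qed
    obtain G where "G \<in> St A" "\<And>f. f \<in> Eff A \<Longrightarrow> \<langle>f, F\<rangle> = p * \<langle>f, \<alpha> m\<rangle> + \<langle>f, G\<rangle>"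
      using maximal_weight_component[OF F(1) a(1)[OF m] pure_states_normalised[OF \<alpha>[OF m]] a(2)[OF m] w p(1) le]
      by blast
    then show ?case using F(2) by (intro bexI[of _ G]) (auto simp: distrib_left)
  qed
  from this[of n] obtain F where F: "F \<in> St A"
    "\<And>f. f \<in> Eff A \<Longrightarrow> \<langle>f, \<chi>\<rangle> = p * (\<Sum>i<n. \<langle>f, \<alpha> i\<rangle>) + \<langle>f, F\<rangle>" by auto
  \<comment> \<open>A finer ensemble for \<open>\<chi>B\<close>, with each \<open>E i\<close> cut
    into \<open>s i\<close>, that is \<open>p\<close> times \<open>\<beta> i\<close>, and the
    remainder \<open>R i\<close>. Steering makes it a test on \<open>A\<close> whose first
    \<open>n\<close> effects prepare exactly the \<open>s i\<close>, which those of \<open>e\<close>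
    need not do.\<close>
  define D where "D = (\<lambda>k. if k < n then s k else R (k - n))"
  have Dsum: "(\<Sum>k<n + n. \<langle>f, D k\<rangle>) = \<langle>f, \<chi>B\<rangle>" if f: "f \<in> Eff B" for f
  proof -
    have "(\<Sum>k<n + m. \<langle>f, D k\<rangle>) = (\<Sum>k<n. \<langle>f, s k\<rangle>) + (\<Sum>k<m. \<langle>f, R k\<rangle>)" for m
      by (induction m) (simp_all add: D_def)
    also have "(\<Sum>k<n. \<langle>f, s k\<rangle>) + (\<Sum>k<n. \<langle>f, R k\<rangle>) = (\<Sum>k<n. \<langle>f, E k\<rangle>)"
      using \<beta>(2)[OF _ f] R(2)[OF _ f] by (simp flip: sum.distrib)
    finally show ?thesis using Esum[OF f] by simp
  qed
  have "\<langle>disc B, \<chi>B\<rangle> = 1"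
    using normalised_discard[OF cond_left_discard[OF pure_states_normalised[OF \<Phi>(1)]]] by (simp add: \<chi>B_def)
  then have "Test \<I> B {..<n + n} D"
    using Dsum[OF discard_effect] ss R(1) by (intro ensemble_test) (auto simp: D_def)
  then obtain d where d: "Test A \<I> {..<n + n} d" "\<And>k. k < n + n \<Longrightarrow> cond_left B (d k) \<Phi> = D k"
    using steering[OF \<Phi>(1)] Dsum unfolding \<chi>B_def by (metis lessThan_iff)
  have de: "d k \<in> Eff A" if "k < n" for k using transfI[OF d(1)] that by (simp add: effects_def)
  have ds: "cond_left B (d k) \<Phi> = s k" if "k < n" for k using d(2)[of k] that by (simp add: D_def)
  have d\<alpha>: "\<langle>d i, \<alpha> j\<rangle> = (if i = j then 1 else 0)" if "i < n" "j < n" for i j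
    using transport[OF that(2,1) de[OF that(1)] ds[OF that(1)]] by auto
  \<comment> \<open>\<open>d i\<close> has probability \<open>p\<close> on \<open>\<chi>\<close>,
    and the component \<open>\<alpha> i\<close> already accounts for all of it.\<close>
  have dF: "\<langle>d i, F\<rangle> = 0" if i: "i < n" for i
  proof -
    have "\<langle>d i, \<chi>\<rangle> = p"
      using cond_swap[OF \<Phi>s de[OF i] discard_effect] ds[OF i] s1[OF i] \<Phi>(2) by simp
    moreover have "(\<Sum>j<n. \<langle>d i, \<alpha> j\<rangle>) = 1" using d\<alpha>[OF i] i by simp
    ultimately show ?thesis using F(2)[OF de[OF i]] by simp
  qed
  have n: "0 < n" using no_empty_test[OF normalised_state[OF \<chi>N], of \<I> e] e by (cases n) auto
  \<comment> \<open>The effects preparing the remainders \<open>R i\<close> merge into the single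
    outcome \<open>n\<close>, which can later detect one further state. Because
    \<open>0 < n\<close>, this outcome does occur.\<close>
  let ?g = "\<lambda>k. if k < n then k else n"
  have img: "?g ` {..<n + n} = {..n}"
  proof
    show "{..n} \<subseteq> ?g ` {..<n + n}"
    proof
      fix k assume "k \<in> {..n}"
      then have "k = ?g k" "k \<in> {..<n + n}" using n by auto
      then show "k \<in> ?g ` {..<n + n}" by (rule image_eqI)
    qed
  qed auto
  obtain c where c: "Test A \<I> {..n} c" "\<And>j. j \<le> n \<Longrightarrow> is_sum \<Theta> A \<I> (c j) {k \<in> {..<n + n}. ?g k = j} d"
    using coarse_grain[OF d(1), of ?g] unfolding img by auto
  have cd: "c j = d j" if "j < n" for j
  proof -
    have J: "{k \<in> {..<n + n}. ?g k = j} = {j}" using that by auto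
    have "is_sum \<Theta> A \<I> (c j) {j} d" using c(2)[of j] that unfolding J by simp
    then show ?thesis by (rule is_sum_singleton)
  qed
  show ?thesis
    by (rule that[OF F c(1)]) (simp_all add: cd d\<alpha> dF)
qed

text \<open>If the remainder \<open>E\<close> were not zero, outcome \<open>n\<close> of
  \<open>c\<close> would be certain on its normalisation and impossible on every
  \<open>\<alpha> i\<close>, contradicting maximality. So \<open>\<chi>\<close> is \<open>p\<close>
  times the sum of the \<open>\<alpha> i\<close>, and normalisation gives
  \<open>p = 1 / n\<close>.\<close>

lemma pure_maximal_set_uniform:
  fixes \<alpha> :: "nat \<Rightarrow> 'b"
  assumes \<chi>: "invariant_state A \<chi>" and \<alpha>: "\<And>i. i < n \<Longrightarrow> \<alpha> i \<in> PSt A"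
    and e: "Test A \<I> {..<n} e" and e\<alpha>: "\<And>i j. i < n \<Longrightarrow> j < n \<Longrightarrow> \<langle>e i, \<alpha> j\<rangle> = (if i = j then 1 else 0)"
    and max: "\<And>\<tau>. \<tau> \<in> NSt A - \<alpha> ` {..<n} \<Longrightarrow> \<not> perfectly_distinguishable \<Theta> A (insert \<tau> (\<alpha> ` {..<n}))"
  shows "0 < n" "a \<in> sharp_effects A \<Longrightarrow> \<langle>a, \<chi>\<rangle> = 1 / n"
    "f \<in> Eff A \<Longrightarrow> \<langle>f, \<chi>\<rangle> = (\<Sum>i<n. \<langle>f, \<alpha> i\<rangle>) / n"
proof -
  obtain p where p: "0 < p" "\<And>a. a \<in> sharp_effects A \<Longrightarrow> \<langle>a, \<chi>\<rangle> = p" using invariant_weight[OF \<chi>] by blast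
  obtain E c where E: "E \<in> St A"
    "\<And>f. f \<in> Eff A \<Longrightarrow> \<langle>f, \<chi>\<rangle> = p * (\<Sum>i<n. \<langle>f, \<alpha> i\<rangle>) + \<langle>f, E\<rangle>"
    and c: "Test A \<I> {..n} c"
    "\<And>i j. i < n \<Longrightarrow> j < n \<Longrightarrow> \<langle>c i, \<alpha> j\<rangle> = (if i = j then 1 else 0)" "\<And>i. i < n \<Longrightarrow> \<langle>c i, E\<rangle> = 0"
    by (rule distinguishable_pure_states_below_invariant[OF \<chi> p \<alpha> e e\<alpha>]) auto
  have ce: "c i \<in> Eff A" if "i \<le> n" for i using transfI[OF c(1)] that by (simp add: effects_def)
  have E0: "\<langle>disc A, E\<rangle> = 0"
  proof (rule ccontr)
    assume pos: "\<langle>disc A, E\<rangle> \<noteq> 0"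
    obtain \<tau> where \<tau>: "\<tau> \<in> NSt A"
      "\<And>f. f \<in> Eff A \<Longrightarrow> \<langle>f, E\<rangle> = \<langle>disc A, E\<rangle> * \<langle>f, \<tau>\<rangle>"
      using normaliseE[OF E(1) pos] by blast
    define \<beta> where "\<beta> = (\<lambda>i. if i < n then \<alpha> i else \<tau>)"
    have c\<tau>: "\<langle>c i, \<tau>\<rangle> = 0" if "i < n" for i using \<tau>(2)[OF ce, of i] c(3)[OF that] pos that by simp
    have split: "(\<Sum>i<n. \<langle>c i, \<sigma>\<rangle>) + \<langle>c n, \<sigma>\<rangle> = 1" if "\<sigma> \<in> NSt A" for \<sigma>
      using test_sum_effect[OF c(1) normalised_state[OF that]] normalised_discard[OF that]
      by (simp add: lessThan_Suc_atMost[symmetric])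
    have "\<langle>c n, \<tau>\<rangle> = 1" using split[OF \<tau>(1)] c\<tau> by simp
    moreover have "\<langle>c n, \<alpha> j\<rangle> = 0" if "j < n" for j
      using split[OF pure_states_normalised[OF \<alpha>[OF that]]] c(2)[OF _ that] that by simp
    ultimately have dist: "\<langle>c i, \<beta> j\<rangle> = (if i = j then 1 else 0)" if "i \<le> n" "j \<le> n" for i j
      using that c(2) c\<tau> by (cases "i = n"; cases "j = n") (auto simp: \<beta>_def)
    have inj: "inj_on \<beta> {..n}"
    proof (rule inj_onI)
      fix i j assume "i \<in> {..n}" "j \<in> {..n}" "\<beta> i = \<beta> j"
      then have "\<langle>c i, \<beta> j\<rangle> = 1" using dist[of i i] by simp
      then show "i = j" using dist[of i j] \<open>i \<in> {..n}\<close> \<open>j \<in> {..n}\<close> by (simp split: if_splits)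
    qed
    have img: "\<beta> ` {..n} = insert \<tau> (\<alpha> ` {..<n})"
    proof -
      have "\<beta> ` {..<n} = \<alpha> ` {..<n}" by (rule image_cong) (simp_all add: \<beta>_def)
      moreover have "\<beta> n = \<tau>" by (simp add: \<beta>_def)
      ultimately show ?thesis unfolding lessThan_Suc_atMost[symmetric] lessThan_Suc image_insert by simp
    qed
    have "\<tau> \<notin> \<alpha> ` {..<n}"
    proof
      assume "\<tau> \<in> \<alpha> ` {..<n}"
      then obtain j where "j < n" "\<beta> n = \<beta> j" by (auto simp: \<beta>_def)
      then show False using inj_onD[OF inj, of n j] by simp
    qed
    moreover have "perfectly_distinguishable \<Theta> A (insert \<tau> (\<alpha> ` {..<n}))"
      unfolding perfectly_distinguishable_def
    proof (intro conjI exI)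
      show "insert \<tau> (\<alpha> ` {..<n}) \<subseteq> NSt A"
        using \<tau>(1) \<alpha> pure_states_normalised by auto
      show "bij_betw \<beta> {..n} (insert \<tau> (\<alpha> ` {..<n}))" using inj img by (simp add: bij_betw_def)
      show "Test A \<I> {..n} c" by (rule c(1))
      show "\<forall>i\<in>{..n}. \<forall>j\<in>{..n}. \<langle>c i, \<beta> j\<rangle> = (if i = j then 1 else 0)" using dist by auto
    qed
    ultimately show False using max \<tau>(1) by blast
  qed
  have \<chi>eq: "\<langle>f, \<chi>\<rangle> = p * (\<Sum>i<n. \<langle>f, \<alpha> i\<rangle>)" if "f \<in> Eff A" for f
    using E(2)[OF that] state_zero[OF E(1) E0 that] by simp
  have pn: "p * n = 1"
    using \<chi>eq[OF discard_effect] normalised_discard[OF invariant_state_normalised[OF \<chi>]]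
      normalised_discard[OF pure_states_normalised[OF \<alpha>]] by simp
  show n: "0 < n" using pn by (cases n) auto
  have "p = 1 / n" using pn n by (simp add: field_simps)
  then show "a \<in> sharp_effects A \<Longrightarrow> \<langle>a, \<chi>\<rangle> = 1 / n"
    "f \<in> Eff A \<Longrightarrow> \<langle>f, \<chi>\<rangle> = (\<Sum>i<n. \<langle>f, \<alpha> i\<rangle>) / n"
    using p(2) \<chi>eq by simp_all
qed

lemma perfectly_distinguishable_listE:
  assumes "distinct xs" "perfectly_distinguishable \<Theta> A (set xs)"
  obtains e where "Test A \<I> {..<length xs} e"
    "\<And>i j. i < length xs \<Longrightarrow> j < length xs \<Longrightarrow> \<langle>e i, xs ! j\<rangle> = (if i = j then 1 else 0)"
proof -
  obtain X \<rho> a where \<rho>: "bij_betw \<rho> X (set xs)" and a: "Test A \<I> X a"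
    and d: "\<And>i j. i \<in> X \<Longrightarrow> j \<in> X \<Longrightarrow> \<langle>a i, \<rho> j\<rangle> = (if i = j then 1 else 0)"
    using assms(2) unfolding perfectly_distinguishable_def by blast
  have nth: "bij_betw ((!) xs) {..<length xs} (set xs)" using assms(1) by (rule bij_betw_nth) auto
  define f where "f = inv_into {..<length xs} ((!) xs) \<circ> \<rho>"
  have f: "bij_betw f X {..<length xs}"
    unfolding f_def by (rule bij_betw_trans[OF \<rho> bij_betw_inv_into[OF nth]])
  have xf: "xs ! f k = \<rho> k" if "k \<in> X" for k
    unfolding f_def comp_def using nth bij_betwE[OF \<rho>] that by (intro f_inv_into_f) (auto simp: bij_betw_def)
  define g where "g = inv_into X f"
  have gX: "g i \<in> X" "f (g i) = i" if "i < length xs" for i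
    using f that unfolding g_def bij_betw_def by (auto intro: inv_into_into f_inv_into_f)
  have "Test A \<I> (f ` X) (a \<circ> g)"
    using f by (intro test_relabel[OF a]) (auto simp: bij_betw_def g_def)
  then have "Test A \<I> {..<length xs} (a \<circ> g)" using f by (simp add: bij_betw_def)
  moreover have "\<langle>(a \<circ> g) i, xs ! j\<rangle> = (if i = j then 1 else 0)" if "i < length xs" "j < length xs" for i j
  proof -
    have "xs ! j = \<rho> (g j)" using xf[OF gX(1)[OF that(2)]] unfolding gX(2)[OF that(2)] .
    moreover have "g i = g j \<longleftrightarrow> i = j" using gX(2)[OF that(1)] gX(2)[OF that(2)] by metis
    ultimately show ?thesis using d[OF gX(1)[OF that(1)] gX(1)[OF that(2)]] by simp
  qed
  ultimately show ?thesis using that by blast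
qed

lemma pure_maximal_listE:
  assumes \<chi>: "invariant_state A \<chi>" and xs: "distinct xs" "pure_maximal_set \<Theta> A (set xs)"
  obtains e where "Test A \<I> {..<length xs} e"
    "\<And>i j. i < length xs \<Longrightarrow> j < length xs \<Longrightarrow> \<langle>e i, xs ! j\<rangle> = (if i = j then 1 else 0)"
    "0 < length xs" "\<And>a. a \<in> sharp_effects A \<Longrightarrow> \<langle>a, \<chi>\<rangle> = 1 / length xs"
    "\<And>f. f \<in> Eff A \<Longrightarrow> \<langle>f, \<chi>\<rangle> = (\<Sum>i<length xs. \<langle>f, xs ! i\<rangle>) / length xs"
proof -
  have img: "(!) xs ` {..<length xs} = set xs" by (auto simp: set_conv_nth)
  have dist: "perfectly_distinguishable \<Theta> A (set xs)" and ps: "set xs \<subseteq> PSt A"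
    and max: "\<And>\<tau>. \<tau> \<in> NSt A - set xs \<Longrightarrow> \<not> perfectly_distinguishable \<Theta> A (insert \<tau> (set xs))"
    using xs(2) by (auto simp: pure_maximal_set_def)
  obtain e where e: "Test A \<I> {..<length xs} e"
    "\<And>i j. i < length xs \<Longrightarrow> j < length xs \<Longrightarrow> \<langle>e i, xs ! j\<rangle> = (if i = j then 1 else 0)"
    using perfectly_distinguishable_listE[OF xs(1) dist] by blast
  have p: "xs ! i \<in> PSt A" if "i < length xs" for i using ps nth_mem[OF that] by blast
  have max': "\<not> perfectly_distinguishable \<Theta> A (insert \<tau> ((!) xs ` {..<length xs}))"
    if "\<tau> \<in> NSt A - (!) xs ` {..<length xs}" for \<tau>
    using max that unfolding img by blast
  show ?thesis
  proof (rule that[OF e])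
    show "0 < length xs" by (rule pure_maximal_set_uniform(1)[OF \<chi> p e max'])
    show "\<langle>a, \<chi>\<rangle> = 1 / length xs" if "a \<in> sharp_effects A" for a
      by (rule pure_maximal_set_uniform(2)[OF \<chi> p e max' that])
    show "\<langle>f, \<chi>\<rangle> = (\<Sum>i<length xs. \<langle>f, xs ! i\<rangle>) / length xs" if "f \<in> Eff A" for f
      by (rule pure_maximal_set_uniform(3)[OF \<chi> p e max' that])
  qed
qed

text \<open>Every invariant state has the statistics of the uniform mixture of \<open>xs\<close>, so
  any two agree and the definite description is proper.\<close>

lemma microcanonical_eq:
  assumes \<chi>: "invariant_state A \<chi>" and xs: "distinct xs" "pure_maximal_set \<Theta> A (set xs)"
  shows "microcanonical \<Theta> A = \<chi>"
  unfolding microcanonical_def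
proof (rule the_equality)
  show "\<chi> \<in> NSt A \<and> (\<forall>U. Rev A A U \<longrightarrow> U \<odot> \<chi> = \<chi>)"
    using \<chi> by (simp add: invariant_state_def)
  fix \<psi> assume "\<psi> \<in> NSt A \<and> (\<forall>U. Rev A A U \<longrightarrow> U \<odot> \<psi> = \<psi>)"
  then have \<psi>: "invariant_state A \<psi>" by (simp add: invariant_state_def)
  have val: "\<langle>f, \<phi>\<rangle> = (\<Sum>i<length xs. \<langle>f, xs ! i\<rangle>) / length xs"
    if "invariant_state A \<phi>" "f \<in> Eff A" for \<phi> f
    by (rule pure_maximal_listE[OF that(1) xs]) (use that(2) in blast)
  show "\<psi> = \<chi>"
  proof (rule state_eqI)
    show "\<psi> \<in> St A" "\<chi> \<in> St A"
      using \<psi> \<chi> by (auto intro: normalised_state invariant_state_normalised)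
    show "\<langle>f, \<psi>\<rangle> = \<langle>f, \<chi>\<rangle>" if "f \<in> Eff A" for f
      unfolding val[OF \<psi> that] val[OF \<chi> that] ..
  qed
qed

theorem unital_convertible_iff_majorises:
  assumes \<rho>: "\<rho> \<in> NSt A" and \<sigma>: "\<sigma> \<in> NSt A"
    and p: "is_spectrum \<Theta> A \<rho> p" and q: "is_spectrum \<Theta> A \<sigma> q"
  shows "(\<exists>D. unital_channel \<Theta> A A D \<and> \<sigma> = D \<odot> \<rho>) \<longleftrightarrow> majorises p q"
proof -
  obtain \<chi> where \<chi>: "invariant_state A \<chi>"
    using invariant_state_exists[OF normalised_states_nonempty] unfolding invariant_state_def by blast
  note \<chi>s = normalised_state[OF invariant_state_normalised[OF \<chi>]]
  define n where "n = length p"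
  obtain \<alpha> where \<alpha>: "distinct \<alpha>" "length \<alpha> = n" "pure_maximal_set \<Theta> A (set \<alpha>)"
    and \<rho>\<alpha>: "lin_comb \<Theta> \<I> A \<rho> {..<n} (\<lambda>i. p ! i) (\<lambda>i. \<alpha> ! i)"
    using p by (auto simp: is_spectrum_def n_def)
  obtain \<beta> where \<beta>: "distinct \<beta>" "length \<beta> = length q" "pure_maximal_set \<Theta> A (set \<beta>)"
    and \<sigma>\<beta>: "lin_comb \<Theta> \<I> A \<sigma> {..<length q} (\<lambda>i. q ! i) (\<lambda>i. \<beta> ! i)"
    using q by (auto simp: is_spectrum_def)
  obtain a where a: "Test A \<I> {..<n} a"
    "\<And>i j. i < n \<Longrightarrow> j < n \<Longrightarrow> \<langle>a i, \<alpha> ! j\<rangle> = (if i = j then 1 else 0)"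
    and n: "0 < n" "\<And>c. c \<in> sharp_effects A \<Longrightarrow> \<langle>c, \<chi>\<rangle> = 1 / n"
    "\<And>f. f \<in> Eff A \<Longrightarrow> \<langle>f, \<chi>\<rangle> = (\<Sum>i<n. \<langle>f, \<alpha> ! i\<rangle>) / n"
    using pure_maximal_listE[OF \<chi> \<alpha>(1,3)] unfolding \<alpha>(2) by blast
  obtain b where b: "Test A \<I> {..<length q} b"
    "\<And>i j. i < length q \<Longrightarrow> j < length q \<Longrightarrow> \<langle>b i, \<beta> ! j\<rangle> = (if i = j then 1 else 0)"
    and m: "0 < length q" "\<And>c. c \<in> sharp_effects A \<Longrightarrow> \<langle>c, \<chi>\<rangle> = 1 / length q"
    "\<And>f. f \<in> Eff A \<Longrightarrow> \<langle>f, \<chi>\<rangle> = (\<Sum>i<length q. \<langle>f, \<beta> ! i\<rangle>) / length q"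
    using pure_maximal_listE[OF \<chi> \<beta>(1,3)] unfolding \<beta>(2) by blast
  obtain c where "c \<in> sharp_effects A"
    using some_sharp_effect_positive[OF \<rho>] by blast
  \<comment> \<open>The probability of one sharp effect on \<open>\<chi>\<close>, read off from
    \<open>\<alpha>\<close> and from \<open>\<beta>\<close>.\<close>
  then have "1 / real n = 1 / real (length q)" using n(2) m(2) by simp
  then have lq: "length q = n" using n(1) m(1) by simp
  note \<beta> = \<beta>[unfolded lq] and \<sigma>\<beta> = \<sigma>\<beta>[unfolded lq] and b = b[unfolded lq] and m = m[unfolded lq]
  note \<rho>e = lin_comb_statesD[OF \<rho>\<alpha>] and \<sigma>e = lin_comb_statesD[OF \<sigma>\<beta>]
  have \<alpha>N: "\<alpha> ! i \<in> NSt A" and \<beta>N: "\<beta> ! i \<in> NSt A" if "i < n" for i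
    using that \<alpha>(2,3) \<beta>(2,3) nth_mem[of i \<alpha>] nth_mem[of i \<beta>] pure_states_normalised[of _ A]
    unfolding pure_maximal_set_def by (simp_all add: subset_iff)
  have ae: "a i \<in> Eff A" and be: "b i \<in> Eff A" if "i < n" for i
    using transfI[OF a(1)] transfI[OF b(1)] that by (auto simp: effects_def)
  have mc: "microcanonical \<Theta> A = \<chi>" by (rule microcanonical_eq[OF \<chi> \<alpha>(1,3)])
  have "(\<exists>D. unital_channel \<Theta> A A D \<and> \<sigma> = D \<odot> \<rho>) \<longleftrightarrow> mixes_to n ((!) p) ((!) q)"
  proof
    assume "\<exists>D. unital_channel \<Theta> A A D \<and> \<sigma> = D \<odot> \<rho>"
    then obtain D where D: "Ch A A D" "D \<odot> \<chi> = \<chi>" "\<sigma> = D \<odot> \<rho>"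
      by (auto simp: unital_channel_def mc)
    note Dt = channel_transf[OF D(1)]
    \<comment> \<open>The transition probabilities from the eigenstates of \<open>\<rho>\<close> to
      those of \<open>\<sigma>\<close>.\<close>
    define M where "M = (\<lambda>i j. \<langle>b i, D \<odot> (\<alpha> ! j)\<rangle>)"
    have M: "M i j = \<langle>b i \<odot> D, \<alpha> ! j\<rangle>" if "i < n" "j < n" for i j
      unfolding M_def by (rule pairing_seq[OF normalised_state[OF \<alpha>N[OF that(2)]] Dt be[OF that(1)]])
    have bD: "b i \<odot> D \<in> Eff A" if "i < n" for i by (rule seq_effect[OF Dt be[OF that]])
    have "0 \<le> M i j" if "i < n" "j < n" for i j
      using pairing_range(1)[OF bD[OF that(1)] normalised_state[OF \<alpha>N[OF that(2)]]] M[OF that] by simp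
    moreover have "(\<Sum>i<n. M i j) = 1" if "j < n" for j
      using test_sum_effect[OF b(1) normalised_state[OF channel_normalised[OF D(1) \<alpha>N[OF that]]]]
        normalised_discard[OF channel_normalised[OF D(1) \<alpha>N[OF that]]] by (simp add: M_def)
    \<comment> \<open>Unitality enters here: the average of the \<open>\<alpha> ! j\<close> is
      \<open>\<chi>\<close>, which \<open>D\<close> fixes and on which \<open>b i\<close> has
      probability \<open>1 / n\<close>.\<close>
    moreover have "(\<Sum>j<n. M i j) = 1" if i: "i < n" for i
    proof -
      have "(\<Sum>j<n. M i j) / n = \<langle>b i \<odot> D, \<chi>\<rangle>"
        using n(3)[OF bD[OF i]] M[OF i] by simp
      also have "\<dots> = \<langle>b i, \<chi>\<rangle>" using pairing_seq[OF \<chi>s Dt be[OF i]] D(2) by simp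
      also have "\<dots> = 1 / n" using m(3)[OF be[OF i]] b(2)[OF i] i by simp
      finally show ?thesis using n(1) by simp
    qed
    ultimately have "doubly_stochastic n M" by (simp add: doubly_stochastic_def)
    moreover have "q ! i = (\<Sum>j<n. M i j * p ! j)" if i: "i < n" for i
    proof -
      have "q ! i = (\<Sum>j<n. q ! j * \<langle>b i, \<beta> ! j\<rangle>)"
        using b(2)[OF i] i by (simp add: if_distrib[where f = "\<lambda>x. _ * x"] cong: if_cong)
      also have "\<dots> = \<langle>b i, D \<odot> \<rho>\<rangle>" using \<sigma>e[OF be[OF i]] D(3) by simp
      also have "\<dots> = \<langle>b i \<odot> D, \<rho>\<rangle>" by (rule pairing_seq[OF normalised_state[OF \<rho>] Dt be[OF i]])
      also have "\<dots> = (\<Sum>j<n. M i j * p ! j)" using \<rho>e[OF bD[OF i]] M[OF i] by (simp add: mult.commute)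
      finally show ?thesis .
    qed
    ultimately show "mixes_to n ((!) p) ((!) q)" by (auto simp: mixes_to_def)
  next
    assume "mixes_to n ((!) p) ((!) q)"
    then obtain M where M: "doubly_stochastic n M" "\<And>i. i < n \<Longrightarrow> q ! i = (\<Sum>j<n. M i j * p ! j)"
      by (auto simp: mixes_to_def)
    \<comment> \<open>Column \<open>j\<close> of \<open>M\<close> gives the mixture of the
      \<open>\<beta> ! i\<close> to prepare after outcome \<open>j\<close> of the measurement of the
      \<open>\<alpha> ! j\<close>.\<close>
    have "\<exists>\<tau>. \<tau> \<in> NSt A \<and> (\<forall>f\<in>Eff A. \<langle>f, \<tau>\<rangle> = (\<Sum>i<n. M i j * \<langle>f, \<beta> ! i\<rangle>))"
      if j: "j < n" for j
    proof -
      obtain \<tau> where "\<tau> \<in> NSt A"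
        "\<And>f. f \<in> Eff A \<Longrightarrow> \<langle>f, \<tau>\<rangle> = (\<Sum>i<n. M i j * \<langle>f, \<beta> ! i\<rangle>)"
        using mixture[of "{..<n}" "\<lambda>i. \<beta> ! i" A "\<lambda>i. M i j"] \<beta>N M(1) j
        unfolding doubly_stochastic_def by auto
      then show ?thesis by blast
    qed
    then obtain \<tau> where \<tau>: "\<And>j. j < n \<Longrightarrow> \<tau> j \<in> NSt A"
      "\<And>j f. j < n \<Longrightarrow> f \<in> Eff A \<Longrightarrow> \<langle>f, \<tau> j\<rangle> = (\<Sum>i<n. M i j * \<langle>f, \<beta> ! i\<rangle>)" by metis
    have "{..<n} \<noteq> {}" using n(1) by auto
    then obtain D where D: "Ch A A D"
      "\<And>\<omega> f. \<omega> \<in> St A \<Longrightarrow> f \<in> Eff A \<Longrightarrow> \<langle>f, D \<odot> \<omega>\<rangle> = (\<Sum>j<n. \<langle>a j, \<omega>\<rangle> * \<langle>f, \<tau> j\<rangle>)"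
      using measure_prepare[OF a(1), of \<tau> A] \<tau>(1) by auto
    have Df: "\<langle>f, D \<odot> \<omega>\<rangle> = (\<Sum>i<n. (\<Sum>j<n. M i j * \<langle>a j, \<omega>\<rangle>) * \<langle>f, \<beta> ! i\<rangle>)"
      if "\<omega> \<in> St A" "f \<in> Eff A" for \<omega> f
    proof -
      have "\<langle>f, D \<odot> \<omega>\<rangle> = (\<Sum>j<n. \<Sum>i<n. M i j * \<langle>a j, \<omega>\<rangle> * \<langle>f, \<beta> ! i\<rangle>)"
        unfolding D(2)[OF that]
        by (intro sum.cong refl) (simp add: \<tau>(2) that sum_distrib_left mult.left_commute mult.assoc)
      also have "\<dots> = (\<Sum>i<n. (\<Sum>j<n. M i j * \<langle>a j, \<omega>\<rangle>) * \<langle>f, \<beta> ! i\<rangle>)"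
        by (subst sum.swap) (simp add: sum_distrib_right)
      finally show ?thesis .
    qed
    have a\<rho>: "\<langle>a j, \<rho>\<rangle> = p ! j" if j: "j < n" for j
      using \<rho>e[OF ae[OF j]] a(2)[OF j] j by (simp add: if_distrib[where f = "\<lambda>x. _ * x"] cong: if_cong)
    have a\<chi>: "\<langle>a j, \<chi>\<rangle> = 1 / n" if j: "j < n" for j
      using n(3)[OF ae[OF j]] a(2)[OF j] j by simp
    have "\<sigma> = D \<odot> \<rho>"
    proof (rule state_eqI)
      show "\<sigma> \<in> St A" "D \<odot> \<rho> \<in> St A"
        using normalised_state[OF \<sigma>] normalised_state[OF channel_normalised[OF D(1) \<rho>]] by auto
      fix f assume f: "f \<in> Eff A"
      show "\<langle>f, \<sigma>\<rangle> = \<langle>f, D \<odot> \<rho>\<rangle>"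
        unfolding Df[OF normalised_state[OF \<rho>] f] \<sigma>e[OF f] by (intro sum.cong refl) (simp add: M(2) a\<rho>)
    qed
    moreover have "D \<odot> \<chi> = \<chi>"
    proof (rule state_eqI)
      show "D \<odot> \<chi> \<in> St A" "\<chi> \<in> St A"
        using \<chi>s seq_state[OF \<chi>s channel_transf[OF D(1)]] by auto
      fix f assume f: "f \<in> Eff A"
      \<comment> \<open>Since the rows of \<open>M\<close> sum to 1, the uniform outcome
        distribution on \<open>\<chi>\<close> stays uniform, and the channel is unital.\<close>
      have "(\<Sum>j<n. M i j * \<langle>a j, \<chi>\<rangle>) = 1 / n" if "i < n" for i
        using M(1) that by (simp add: a\<chi> doubly_stochastic_def flip: sum_divide_distrib)
      then show "\<langle>f, D \<odot> \<chi>\<rangle> = \<langle>f, \<chi>\<rangle>"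
        unfolding Df[OF \<chi>s f] m(3)[OF f] by (simp add: sum_divide_distrib)
    qed
    ultimately show "\<exists>D. unital_channel \<Theta> A A D \<and> \<sigma> = D \<odot> \<rho>"
      using D(1) by (auto simp: unital_channel_def mc)
  qed
  then show ?thesis using majorises_iff_mixes_to[of p n q] lq by (simp add: n_def)
qed

end

theorem theorem5p3p4:
  fixes \<Theta> :: "('s, 't) opt" and A :: 's and \<rho> \<sigma> :: 't and p q :: "real list"
  assumes "sharp_theory_with_purification \<Theta>"
    and "\<rho> \<in> normalised_states \<Theta> A" and "\<sigma> \<in> normalised_states \<Theta> A"
    and "is_spectrum \<Theta> A \<rho> p" and "is_spectrum \<Theta> A \<sigma> q"
  shows "(\<exists>D. unital_channel \<Theta> A A D \<and> \<sigma> = seq \<Theta> D \<rho>) \<longleftrightarrow> majorises p q"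
  using assms by (rule sharp_theory_with_purification.unital_convertible_iff_majorises)

end
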